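(* Let $n\ge 1$, $-2<p<0$, $R>0$, $T>0$. For every $u\in L^\infty((-T,0];L^2(B_R^+,x_n^p\,dx))\cap L^2((-T,0];H^1_{0,L}(B_R^+))$ one has $$\left(\int_{Q^+_{R,T}}|u|^{2\chi}x_n^p\,dx\,dt\right)^{1/\chi}\le C\,\|u\|_{V_2(Q^+_{R,T})}^2,$$ where: if $n\ge 3$, then $\chi=\frac{n+2p+2}{n+p}$ and $C$ depends only on $n$ and $p$; if $n=1,2$, then $\chi=\frac32$ and $C=C(p)\,R^{\frac{p+4-n}{3}}$ with $C(p)$ depending only on $p$.
   Context: Write $x=(x',x_n)\in\mathbb{R}^n$, $B_R$ for the open ball of radius $R$ centered at $0$, $B_R^+=B_R\cap\{x_n>0\}$, and $Q^+_{R,T}=B_R^+\times(-T,0]$. The space $H^1_{0,L}(B_R^+)$ consists of all $u\in H^1(B_R^+)$ with $u=0$ (in the trace sense) on the flat part $\partial'B_R^+=B_R\cap\{x_n=0\}$. The norm is $$\|u\|_{V_2(Q^+_{R,T})}=\left(\sup_{-T<t<0}\int_{B_R^+}u(x,t)^2x_n^p\,dx+\|\nabla u\|_{L^2(B_R^+\times(-T,0])}^2\right)^{1/2},$$ where the supremum is an essential supremum and $\nabla$ is the gradient in $x$. *)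

theory Defs
  imports "HOL-Analysis.Analysis" "HOL-Probability.Essential_Supremum"
begin

section \<open>Domains\<close>

text \<open>Points of \<open>n\<close>-space are vectors of type \<open>real ^ 'n\<close>. The coordinate playing the role of
  \<open>x\<^sub>n\<close> is an arbitrary but fixed index \<open>k :: 'n\<close>.\<close>

definition half_ball :: "'n::finite \<Rightarrow> real \<Rightarrow> (real ^ 'n) set" where
  "half_ball k R = ball 0 R \<inter> {x. 0 < x $ k}"

definition flat_part :: "'n::finite \<Rightarrow> real \<Rightarrow> (real ^ 'n) set" where
  "flat_part k R = ball 0 R \<inter> {x. x $ k = 0}"

definition cyl :: "'n::finite \<Rightarrow> real \<Rightarrow> real \<Rightarrow> ((real ^ 'n) \<times> real) set" where
  "cyl k R T = half_ball k R \<times> {- T<..0}"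

text \<open>The \<open>(n - 1)\<close>-dimensional Lebesgue measure on the hyperplane \<open>x\<^sub>k = 0\<close>, as a measure on
  \<open>n\<close>-space. The product is over an empty index set when \<open>n = 1\<close>; the result is then the point
  mass at the origin.\<close>

definition hyperplane_measure :: "'n::finite \<Rightarrow> (real ^ 'n) measure" where
  "hyperplane_measure k =
     completion (distr (\<Pi>\<^sub>M i\<in>UNIV - {k}. lborel) borel (\<lambda>y. \<chi> i. if i = k then 0 else y i))"

section \<open>Sobolev functions\<close>

text \<open>Functions are total; membership in a function space over a set \<open>S\<close> depends only on the
  values on \<open>S\<close>, up to null sets.\<close>

definition L2_on :: "'a measure \<Rightarrow> 'a set \<Rightarrow> ('a \<Rightarrow> 'b::real_normed_vector) \<Rightarrow> bool" where
  "L2_on M S f \<longleftrightarrow> f \<in> borel_measurable (restrict_space M S) \<and>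
     (\<integral>\<^sup>+x\<in>S. ennreal ((norm (f x))\<^sup>2) \<partial>M) < \<infinity>"

text \<open>\<open>D [i\<^sub>1, \<dots>, i\<^sub>m]\<close> below is the iterated partial derivative in the directions
  \<open>i\<^sub>m, \<dots>, i\<^sub>1\<close>.\<close>

definition smooth_fun :: "(real ^ 'n::finite \<Rightarrow> real) \<Rightarrow> bool" where
  "smooth_fun f \<longleftrightarrow> (\<exists>D :: 'n list \<Rightarrow> real ^ 'n \<Rightarrow> real. D [] = f \<and>
     (\<forall>is x. (D is has_derivative (\<lambda>h. \<Sum>i\<in>UNIV. D (i # is) x * h $ i)) (at x)))"

definition grad :: "(real ^ 'n::finite \<Rightarrow> real) \<Rightarrow> real ^ 'n \<Rightarrow> real ^ 'n" where
  "grad f x = (\<chi> i. frechet_derivative f (at x) (axis i 1))"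

definition test_fun :: "(real ^ 'n::finite) set \<Rightarrow> (real ^ 'n \<Rightarrow> real) \<Rightarrow> bool" where
  "test_fun S \<phi> \<longleftrightarrow> smooth_fun \<phi> \<and> compact (closure {x. \<phi> x \<noteq> 0}) \<and> closure {x. \<phi> x \<noteq> 0} \<subseteq> S"

definition weak_grad ::
    "(real ^ 'n::finite) set \<Rightarrow> (real ^ 'n \<Rightarrow> real) \<Rightarrow> (real ^ 'n \<Rightarrow> real ^ 'n) \<Rightarrow> bool" where
  "weak_grad S u G \<longleftrightarrow>
     (\<forall>K. compact K \<and> K \<subseteq> S \<longrightarrow> set_integrable lebesgue K u \<and> set_integrable lebesgue K G) \<and>
     (\<forall>\<phi> i. test_fun S \<phi> \<longrightarrow>
       (LINT x:S|lebesgue. u x * grad \<phi> x $ i) = - (LINT x:S|lebesgue. G x $ i * \<phi> x))"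

definition H1 :: "(real ^ 'n::finite) set \<Rightarrow> (real ^ 'n \<Rightarrow> real) set" where
  "H1 S = {u. L2_on lebesgue S u \<and> (\<exists>G. weak_grad S u G \<and> L2_on lebesgue S G)}"

text \<open>The trace operator on \<open>H1 (half_ball k R)\<close> is the continuous extension of the restriction
  map to the flat part from functions smooth up to the boundary: \<open>g\<close> is the trace of \<open>u\<close> if
  restrictions \<open>v j\<close> of smooth functions converge to \<open>u\<close> in \<open>H\<^sup>1\<close> and to \<open>g\<close> in \<open>L\<^sup>2\<close> of the
  flat part.\<close>

definition has_flat_trace ::
    "'n::finite \<Rightarrow> real \<Rightarrow> (real ^ 'n \<Rightarrow> real) \<Rightarrow> (real ^ 'n \<Rightarrow> real) \<Rightarrow> bool" where
  "has_flat_trace k R u g \<longleftrightarrow>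
     L2_on (hyperplane_measure k) (flat_part k R) g \<and>
     (\<exists>G v. weak_grad (half_ball k R) u G \<and> L2_on lebesgue (half_ball k R) G \<and>
        (\<forall>j::nat. smooth_fun (v j)) \<and>
        (\<lambda>j. \<integral>\<^sup>+x\<in>half_ball k R.
           ennreal ((v j x - u x)\<^sup>2 + (norm (grad (v j) x - G x))\<^sup>2) \<partial>lebesgue) \<longlonglongrightarrow> 0 \<and>
        (\<lambda>j. \<integral>\<^sup>+x\<in>flat_part k R. ennreal ((v j x - g x)\<^sup>2) \<partial>hyperplane_measure k) \<longlonglongrightarrow> 0)"

definition H1_0L :: "'n::finite \<Rightarrow> real \<Rightarrow> (real ^ 'n \<Rightarrow> real) set" where
  "H1_0L k R = {u \<in> H1 (half_ball k R). has_flat_trace k R u (\<lambda>_. 0)}"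

section \<open>Time-dependent functions\<close>

text \<open>Elements of the Bochner spaces are represented by jointly measurable functions \<open>u x t\<close>.
  The gradient in \<open>x\<close> is then a jointly measurable function too, unique up to null sets.
  Since the spaces are separable, joint measurability of \<open>u\<close> and of its gradient amounts to strong
  measurability of \<open>t \<mapsto> u(\<cdot>, t)\<close>, and the Bochner norm of \<open>L\<^sup>2((-T, 0]; H\<^sup>1)\<close> is that of
  \<open>L\<^sup>2\<close> of the cylinder for \<open>u\<close> and its gradient.\<close>

definition is_spatial_grad ::
    "'n::finite \<Rightarrow> real \<Rightarrow> real \<Rightarrow> (real ^ 'n \<Rightarrow> real \<Rightarrow> real) \<Rightarrow>
     (real ^ 'n \<Rightarrow> real \<Rightarrow> real ^ 'n) \<Rightarrow> bool" where
  "is_spatial_grad k R T u G \<longleftrightarrow>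
     (\<lambda>(x, t). G x t) \<in> borel_measurable (lebesgue_on (cyl k R T)) \<and>
     (AE t in lebesgue_on {- T<..0}. weak_grad (half_ball k R) (\<lambda>x. u x t) (\<lambda>x. G x t))"

definition spatial_grad ::
    "'n::finite \<Rightarrow> real \<Rightarrow> real \<Rightarrow> (real ^ 'n \<Rightarrow> real \<Rightarrow> real) \<Rightarrow> real ^ 'n \<Rightarrow> real \<Rightarrow> real ^ 'n" where
  "spatial_grad k R T u = (SOME G. is_spatial_grad k R T u G)"

definition sup_weighted_L2 ::
    "'n::finite \<Rightarrow> real \<Rightarrow> real \<Rightarrow> real \<Rightarrow> (real ^ 'n \<Rightarrow> real \<Rightarrow> real) \<Rightarrow> ennreal" where
  "sup_weighted_L2 k p R T u = esssup (lebesgue_on {- T<..<0})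
     (\<lambda>t. \<integral>\<^sup>+x\<in>half_ball k R. ennreal ((u x t)\<^sup>2 * (x $ k) powr p) \<partial>lebesgue)"

definition Linf_L2w :: "'n::finite \<Rightarrow> real \<Rightarrow> real \<Rightarrow> real \<Rightarrow> (real ^ 'n \<Rightarrow> real \<Rightarrow> real) set" where
  "Linf_L2w k p R T = {u. (\<lambda>(x, t). u x t) \<in> borel_measurable (lebesgue_on (cyl k R T)) \<and>
     sup_weighted_L2 k p R T u < \<infinity>}"

definition L2_H1_0L :: "'n::finite \<Rightarrow> real \<Rightarrow> real \<Rightarrow> (real ^ 'n \<Rightarrow> real \<Rightarrow> real) set" where
  "L2_H1_0L k R T = {u. L2_on lebesgue (cyl k R T) (\<lambda>(x, t). u x t) \<and>
     (AE t in lebesgue_on {- T<..0}. (\<lambda>x. u x t) \<in> H1_0L k R) \<and>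
     (\<exists>G. is_spatial_grad k R T u G) \<and>
     L2_on lebesgue (cyl k R T) (\<lambda>(x, t). spatial_grad k R T u x t)}"

text \<open>Both summands are finite on \<open>Linf_L2w k p R T \<inter> L2_H1_0L k R T\<close>, the only place where
  the norm is used, so no value is lost by \<open>enn2real\<close>.\<close>

definition V2_norm ::
    "'n::finite \<Rightarrow> real \<Rightarrow> real \<Rightarrow> real \<Rightarrow> (real ^ 'n \<Rightarrow> real \<Rightarrow> real) \<Rightarrow> real" where
  "V2_norm k p R T u = sqrt (enn2real (sup_weighted_L2 k p R T u +
     (\<integral>\<^sup>+z\<in>cyl k R T. ennreal ((norm (spatial_grad k R T u (fst z) (snd z)))\<^sup>2) \<partial>lebesgue)))"

text \<open>Integrability is part of the inequality, as the Bochner integral of a non-integrable function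
  is \<open>0\<close>.\<close>

definition V2_embedding_ineq ::
    "'n::finite \<Rightarrow> real \<Rightarrow> real \<Rightarrow> real \<Rightarrow> real \<Rightarrow> real \<Rightarrow> (real ^ 'n \<Rightarrow> real \<Rightarrow> real) \<Rightarrow> bool" where
  "V2_embedding_ineq k p R T q C u \<longleftrightarrow>
     set_integrable lebesgue (cyl k R T) (\<lambda>(x, t). \<bar>u x t\<bar> powr (2 * q) * (x $ k) powr p) \<and>
     (LINT (x, t):cyl k R T|lebesgue. \<bar>u x t\<bar> powr (2 * q) * (x $ k) powr p) powr (1 / q)
       \<le> C * (V2_norm k p R T u)\<^sup>2"

end

theory Submission
  imports Defs
begin

text \<open>At almost every time, interpolating by Hoelder's inequality between the weighted \<open>L\<^sup>2\<close> norm,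
  Hardy's inequality \<open>\<integral> u\<^sup>2 / x\<^sub>n\<^sup>2 \<le> 8 \<integral> |\<nabla>u|\<^sup>2\<close> and Sobolev's inequality bounds \<open>\<integral> |u|\<^bsup>2\<chi>\<^esup> x\<^sub>n\<^sup>p\<close> by
  \<open>C (\<integral> u\<^sup>2 x\<^sub>n\<^sup>p)\<^bsup>\<chi> - 1\<^esup> \<integral> |\<nabla>u|\<^sup>2\<close>; integrating in time gives the claim.

  Nothing is known on the curved part of the boundary, so Sobolev's inequality is proved by
  Gagliardo's method along lines that reach the flat part inside the half ball: from a point \<open>x\<close>
  one may go down in the direction \<open>e\<^sub>n\<close> and in the directions \<open>e\<^sub>n + sgn (x\<^sub>i) e\<^sub>i\<close>. On the set where the
  signs of the \<open>x\<^sub>i\<close> are fixed, a shear turns these into the coordinate directions, where the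
  Loomis--Whitney inequality applies. All estimates are shown for smooth functions with an error
  term on the flat part, which vanishes for an approximating sequence.\<close>

section \<open>Integrals over coordinate lines\<close>

text \<open>The exponent \<chi> is forced by the integration in time: the weighted norm is bounded
  uniformly in time, the energy is only integrable, so a slice estimate must be exactly linear in
  the energy. Together with the power of \<open>x $ k\<close> and the sum of the Hoelder exponents
  this gives three equations for three exponents, and the power of \<open>u\<close> comes out as
  twice \<chi>. In dimensions 1 and 2 linearity is reached by replacing the bound of the weighted
  norm by its geometric mean with Hardy's bound, which costs a power of \<open>R\<close>. Zero trace
  means only that the approximating functions are small in mean square on the flat part. Boundary
  errors are therefore kept until the sequence has converged, and since they carry factors such as
  \<open>2 / e\<close> or \<open>\<omega> 0\<close>, singular weights are shifted to
  \<open>x $ k + e\<close> and the shift is removed afterwards. Powers are truncated because mean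
  square convergence controls quadratic growth only. Finally, the gradient in the trace and the one
  in the norm are chosen independently, so weak gradients must be shown unique, for which test
  functions are constructed.\<close>

lemma borel_measurable_vec_lambda:
  fixes f :: "'a \<Rightarrow> 'n::finite \<Rightarrow> real"
  assumes "\<And>i. (\<lambda>x. f x i) \<in> borel_measurable M"
  shows "(\<lambda>x. \<chi> i. f x i) \<in> borel_measurable M"
  using assms by (subst borel_measurable_euclidean_space) (auto simp: Basis_vec_def inner_axis)

text \<open>Agreement on boxes identifies Lebesgue measure on vectors with a product over the
  coordinate indices, the form in which \<open>hyperplane_measure\<close> is given.\<close>

lemma lborel_vec:
  "(lborel :: (real ^ 'n::finite) measure) = distr (\<Pi>\<^sub>M i\<in>UNIV. lborel) borel (\<lambda>y. \<chi> i. y i)"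
proof (rule lborel_eqI)
  interpret product_sigma_finite "\<lambda>_::'n. lborel :: real measure" by standard
  fix l u :: "real ^ 'n" assume le: "\<And>b. b \<in> Basis \<Longrightarrow> l \<bullet> b \<le> u \<bullet> b"
  have le': "l $ i \<le> u $ i" for i
    using le[of "axis i 1"] by (simp add: inner_axis)
  have m: "(\<lambda>y. \<chi> i. y i) \<in> (\<Pi>\<^sub>M i\<in>UNIV. lborel :: real measure) \<rightarrow>\<^sub>M (borel :: (real ^ 'n) measure)"
    by (rule borel_measurable_vec_lambda) simp
  have "(\<lambda>y::'n \<Rightarrow> real. \<chi> i. y i) -` box l u \<inter> space (\<Pi>\<^sub>M i\<in>UNIV. lborel)
      = Pi\<^sub>E UNIV (\<lambda>i. {l $ i<..<u $ i})"
    by (auto simp: space_PiM PiE_def Pi_def extensional_def mem_box_cart)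
  then have "emeasure (distr (\<Pi>\<^sub>M i\<in>UNIV. lborel) borel (\<lambda>y. \<chi> i. y i)) (box l u)
      = emeasure (\<Pi>\<^sub>M i\<in>(UNIV::'n set). lborel) (Pi\<^sub>E UNIV (\<lambda>i. {l $ i<..<u $ i}))"
    using m by (simp add: emeasure_distr)
  also have "\<dots> = (\<Prod>i\<in>UNIV. emeasure lborel {l $ i<..<u $ i})"
    by (subst emeasure_PiM) auto
  also have "\<dots> = ennreal (\<Prod>i\<in>UNIV. u $ i - l $ i)"
    using le' by (simp add: prod_ennreal)
  also have "(\<Prod>i\<in>UNIV. u $ i - l $ i) = (\<Prod>b\<in>Basis. (u - l) \<bullet> b)"
  proof -
    have B: "(Basis :: (real ^ 'n) set) = (\<lambda>i. axis i 1) ` UNIV"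
      by (auto simp: Basis_vec_def)
    show ?thesis
      unfolding B by (subst prod.reindex) (auto simp: inj_on_def axis_eq_axis inner_axis)
  qed
  finally show "emeasure (distr (\<Pi>\<^sub>M i\<in>UNIV. lborel) borel (\<lambda>y. \<chi> i. y i)) (box l u)
      = (\<Prod>b\<in>Basis. (u - l) \<bullet> b)" .
qed simp

lemma nn_integral_lborel_translate:
  fixes f :: "'a::euclidean_space \<Rightarrow> ennreal"
  assumes [measurable]: "f \<in> borel_measurable borel"
  shows "(\<integral>\<^sup>+x. f (a + x) \<partial>lborel) = (\<integral>\<^sup>+x. f x \<partial>lborel)"
  by (subst (2) lborel_distr_plus[symmetric, of a], subst nn_integral_distr) auto

text \<open>Partial integrals stay functions on the whole space, constant in the coordinates already
  integrated, so Fubini arguments need no splitting of the type \<open>real ^ 'n\<close>.\<close>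

primrec iter_int :: "'n::finite list \<Rightarrow> (real ^ 'n \<Rightarrow> ennreal) \<Rightarrow> real ^ 'n \<Rightarrow> ennreal" where
  "iter_int [] f = f"
| "iter_int (j # js) f = (\<lambda>x. \<integral>\<^sup>+s. iter_int js f (x + s *\<^sub>R axis j 1) \<partial>lborel)"

lemma borel_measurable_line_integral [measurable (raw)]:
  fixes f :: "'a::euclidean_space \<Rightarrow> ennreal"
  assumes [measurable]: "f \<in> borel_measurable borel"
  shows "(\<lambda>x. \<integral>\<^sup>+s. f (x + s *\<^sub>R d) \<partial>lborel) \<in> borel_measurable borel"
  by measurable

lemma iter_int_measurable [measurable (raw)]:
  "f \<in> borel_measurable borel \<Longrightarrow> iter_int js f \<in> borel_measurable borel"
  by (induction js) (auto intro!: borel_measurable_line_integral)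

lemma iter_int_append: "iter_int (js @ ks) f = iter_int js (iter_int ks f)"
  by (induction js) auto

lemma iter_int_invariant:
  assumes "\<And>x s. f (x + s *\<^sub>R axis j 1) = f x"
  shows "iter_int js f (x + s *\<^sub>R axis j 1) = iter_int js f x"
proof (induction js arbitrary: x)
  case (Cons i js)
  have "x + s *\<^sub>R axis j 1 + t *\<^sub>R axis i 1 = (x + t *\<^sub>R axis i 1) + s *\<^sub>R axis j 1" for t
    by (simp add: ac_simps)
  then show ?case
    by (simp only: iter_int.simps Cons)
qed (use assms in simp)

text \<open>Tonelli, one coordinate at a time. The right-hand side sees only \<open>set js\<close>,
  so the order of integration becomes irrelevant.\<close>

lemma iter_int_eq_PiM:
  fixes f :: "real ^ 'n::finite \<Rightarrow> ennreal"
  assumes f: "f \<in> borel_measurable borel" and "distinct js"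
  shows "iter_int js f x
    = (\<integral>\<^sup>+y. f (x + (\<chi> i. if i \<in> set js then y i else 0)) \<partial>(\<Pi>\<^sub>M i\<in>set js. lborel))"
  using assms(2)
proof (induction js arbitrary: x)
  case Nil
  interpret product_sigma_finite "\<lambda>_::'n. lborel :: real measure" by standard
  have "(\<chi> i. 0) = (0 :: real ^ 'n)" by (simp add: vec_eq_iff)
  then show ?case
    by (simp add: PiM_empty nn_integral_count_space_finite)
next
  case (Cons j js)
  interpret product_sigma_finite "\<lambda>_::'n. lborel :: real measure" by standard
  have [measurable]: "f \<in> borel_measurable borel" by fact
  have [measurable]: "(\<lambda>y. \<chi> i. if i \<in> set (j # js) then y i else 0)
      \<in> (\<Pi>\<^sub>M i\<in>set (j # js). lborel) \<rightarrow>\<^sub>M (borel :: (real ^ 'n) measure)"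
  proof (rule borel_measurable_vec_lambda)
    show "(\<lambda>y. if i \<in> set (j # js) then y i else 0)
      \<in> (\<Pi>\<^sub>M i\<in>set (j # js). lborel) \<rightarrow>\<^sub>M (borel :: real measure)" for i
      by (cases "i \<in> set (j # js)") simp_all
  qed
  let ?f = "\<lambda>y. f (x + (\<chi> i. if i \<in> set (j # js) then y i else 0))"
  have "(\<integral>\<^sup>+y. ?f y \<partial>(\<Pi>\<^sub>M i\<in>set (j # js). lborel))
    = (\<integral>\<^sup>+y. ?f y \<partial>(\<Pi>\<^sub>M i\<in>insert j (set js). lborel))"
    by simp
  also have "\<dots> = (\<integral>\<^sup>+s. (\<integral>\<^sup>+y. ?f (y(j := s))
          \<partial>(\<Pi>\<^sub>M i\<in>set js. lborel)) \<partial>lborel)"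
    using Cons.prems by (intro product_nn_integral_insert_rev) (auto simp flip: list.set)
  also have "\<dots> = (\<integral>\<^sup>+s. iter_int js f (x + s *\<^sub>R axis j 1) \<partial>lborel)"
  proof (rule nn_integral_cong)
    fix s :: real
    have "x + (\<chi> i. if i \<in> set (j # js) then (y(j := s)) i else 0)
       = x + s *\<^sub>R axis j 1 + (\<chi> i. if i \<in> set js then y i else 0)" for y
      using Cons.prems by (auto simp: vec_eq_iff axis_def)
    then show "(\<integral>\<^sup>+y. ?f (y(j := s))
          \<partial>(\<Pi>\<^sub>M i\<in>set js. lborel)) = iter_int js f (x + s *\<^sub>R axis j 1)"
      using Cons by (simp add: add.assoc)
  qed
  finally show ?case by simp
qed

lemma iter_int_UNIV:
  fixes f :: "real ^ 'n::finite \<Rightarrow> ennreal"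
  assumes [measurable]: "f \<in> borel_measurable borel" and "distinct js" "set js = UNIV"
  shows "iter_int js f x = (\<integral>\<^sup>+x. f x \<partial>lborel)"
proof -
  have [measurable]: "(\<lambda>y. \<chi> i. y i)
      \<in> (\<Pi>\<^sub>M i\<in>UNIV. lborel :: real measure) \<rightarrow>\<^sub>M (borel :: (real ^ 'n) measure)"
    by (rule borel_measurable_vec_lambda) simp
  have "iter_int js f x = (\<integral>\<^sup>+y. f (x + (\<chi> i. y i)) \<partial>(\<Pi>\<^sub>M i\<in>UNIV. lborel))"
    using iter_int_eq_PiM[OF assms(1,2)] assms(3) by simp
  also have "\<dots> = (\<integral>\<^sup>+z. f (x + z) \<partial>lborel)"
    by (subst lborel_vec, subst nn_integral_distr) auto
  finally show ?thesis
    by (simp add: nn_integral_lborel_translate)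
qed

lemma ex_enumeration_last:
  fixes k :: "'n::finite"
  obtains js where "distinct (js @ [k])" "set js = UNIV - {k}"
  using finite_distinct_list[of "UNIV - {k}"] by auto

lemma nn_integral_iter_int_last:
  fixes f :: "real ^ 'n::finite \<Rightarrow> ennreal"
  assumes [measurable]: "f \<in> borel_measurable borel" and js: "distinct (js @ [k])" "set js = UNIV - {k}"
  shows "(\<integral>\<^sup>+x. f x \<partial>lborel) = iter_int js (\<lambda>x. \<integral>\<^sup>+s. f (x + s *\<^sub>R axis k 1) \<partial>lborel) z"
proof -
  have "(\<integral>\<^sup>+x. f x \<partial>lborel) = iter_int (js @ [k]) f z"
    by (rule iter_int_UNIV[symmetric]) (use js in auto)
  then show ?thesis by (simp add: iter_int_append)
qed

lemma nn_integral_shear: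
  fixes f :: "real ^ 'n::finite \<Rightarrow> ennreal"
  assumes [measurable]: "f \<in> borel_measurable borel" "c \<in> borel_measurable borel"
    and c: "\<And>x s. c (x + s *\<^sub>R axis k 1) = c x"
  shows "(\<integral>\<^sup>+x. f (x + c x *\<^sub>R axis k 1) \<partial>lborel) = (\<integral>\<^sup>+x. f x \<partial>lborel)"
proof -
  obtain js where js: "distinct (js @ [k])" "set js = UNIV - {k}"
    by (rule ex_enumeration_last)
  have "(\<integral>\<^sup>+s. f (x + s *\<^sub>R axis k 1 + c (x + s *\<^sub>R axis k 1) *\<^sub>R axis k 1) \<partial>lborel)
      = (\<integral>\<^sup>+s. f (x + s *\<^sub>R axis k 1) \<partial>lborel)" for x
    using nn_integral_lborel_translate[of "\<lambda>s. f (x + s *\<^sub>R axis k 1)" "c x"]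
    by (simp add: c algebra_simps)
  then show ?thesis
    by (subst (1 2) nn_integral_iter_int_last[OF _ js]) simp_all
qed

text \<open>Tonelli with coordinate \<open>k\<close> innermost, where the factor \<open>b\<close> is
  constant. It converts integrals over the hyperplane into integrals over space: \<open>w\<close>
  will be the indicator of a unit interval in Gagliardo's method and the kernel
  \<open>1 / (r + e)\<^sup>2\<close> on the half-line in Hardy's inequality.\<close>

lemma nn_integral_slab:
  fixes b :: "real ^ 'n::finite \<Rightarrow> ennreal" and w :: "real \<Rightarrow> ennreal"
  assumes [measurable]: "b \<in> borel_measurable borel" "w \<in> borel_measurable borel"
  shows "(\<integral>\<^sup>+x. w (x $ k) * b (x - (x $ k) *\<^sub>R axis k 1) \<partial>lborel)
    = (\<integral>\<^sup>+s. w s \<partial>lborel) * (\<integral>\<^sup>+x. b x \<partial>hyperplane_measure k)"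
proof -
  obtain js where js: "distinct (js @ [k])" "set js = UNIV - {k}"
    by (rule ex_enumeration_last)
  define P where "P = (\<Pi>\<^sub>M i\<in>UNIV - {k}. lborel :: real measure)"
  have P [measurable]: "(\<lambda>y. \<chi> i. if i \<in> set js then y i else 0) \<in> P \<rightarrow>\<^sub>M (borel :: (real ^ 'n) measure)"
  proof (rule borel_measurable_vec_lambda)
    show "(\<lambda>y. if i \<in> set js then y i else 0) \<in> P \<rightarrow>\<^sub>M (borel :: real measure)" for i
      by (cases "i \<in> set js") (simp_all add: js P_def)
  qed
  let ?g = "\<lambda>x. w (x $ k) * b (x - (x $ k) *\<^sub>R axis k 1)"
  have "(\<integral>\<^sup>+x. ?g x \<partial>lborel) = iter_int js (\<lambda>x. \<integral>\<^sup>+s. ?g (x + s *\<^sub>R axis k 1) \<partial>lborel) 0"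
    by (rule nn_integral_iter_int_last[OF _ js]) measurable
  also have "\<dots> = iter_int js (\<lambda>x. (\<integral>\<^sup>+s. w s \<partial>lborel) * b (x - (x $ k) *\<^sub>R axis k 1)) 0"
  proof (intro arg_cong[where f="\<lambda>f. iter_int js f 0"] ext)
    fix x :: "real ^ 'n"
    have "(\<integral>\<^sup>+s. ?g (x + s *\<^sub>R axis k 1) \<partial>lborel)
      = (\<integral>\<^sup>+s. w (x $ k + s) * b (x - (x $ k) *\<^sub>R axis k 1) \<partial>lborel)"
      by (simp add: algebra_simps)
    also have "\<dots> = (\<integral>\<^sup>+s. w (x $ k + s) \<partial>lborel) * b (x - (x $ k) *\<^sub>R axis k 1)"
      by (simp add: nn_integral_multc)
    finally show "(\<integral>\<^sup>+s. ?g (x + s *\<^sub>R axis k 1) \<partial>lborel)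
      = (\<integral>\<^sup>+s. w s \<partial>lborel) * b (x - (x $ k) *\<^sub>R axis k 1)"
      by (simp add: nn_integral_lborel_translate)
  qed
  also have "\<dots> = (\<integral>\<^sup>+y. (\<integral>\<^sup>+s. w s \<partial>lborel) * b (\<chi> i. if i \<in> set js then y i else 0) \<partial>P)"
    using js by (subst iter_int_eq_PiM) (auto simp: P_def)
  also have "\<dots> = (\<integral>\<^sup>+s. w s \<partial>lborel) * (\<integral>\<^sup>+y. b (\<chi> i. if i \<in> set js then y i else 0) \<partial>P)"
    by (rule nn_integral_cmult) measurable
  also have "(\<lambda>y. \<chi> i. if i \<in> set js then y i else 0) = (\<lambda>y. \<chi> i. if i = k then 0 else (y i :: real))"
    using js by (auto simp: fun_eq_iff vec_eq_iff)
  then have "(\<integral>\<^sup>+y. b (\<chi> i. if i \<in> set js then y i else 0) \<partial>P) = (\<integral>\<^sup>+x. b x \<partial>hyperplane_measure k)"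
    unfolding hyperplane_measure_def nn_integral_completion P_def[symmetric]
    using P by (subst nn_integral_distr) (auto simp: fun_eq_iff)
  finally show ?thesis .
qed

section \<open>The Loomis--Whitney inequality\<close>

lemma prod_le_mean_power:
  fixes y :: "'a \<Rightarrow> real"
  assumes "finite A" "A \<noteq> {}" "\<And>i. i \<in> A \<Longrightarrow> 0 \<le> y i"
  shows "(\<Prod>i\<in>A. y i) \<le> ((\<Sum>i\<in>A. y i) / card A) ^ card A"
proof -
  let ?K = "card A" and ?P = "\<Prod>i\<in>A. y i"
  have K: "0 < ?K" using assms by (simp add: card_gt_0_iff)
  have P: "0 \<le> ?P" using assms by (simp add: prod_nonneg)
  have "?P = (?P powr (1 / ?K)) ^ ?K"
    using K P by (cases "?P = 0") (simp_all add: powr_powr flip: powr_realpow)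
  also have "\<dots> \<le> ((\<Sum>i\<in>A. y i) / ?K) ^ ?K"
    using arith_geom_mean[OF assms(1,2), of y] assms(3)
    by (intro power_mono) (simp_all add: sum_divide_distrib)
  finally show ?thesis .
qed

text \<open>Hoelder's inequality with equal exponents; \<open>f\<close> plays the role of the geometric mean of the
  \<open>H i\<close>, which avoids roots of extended reals.\<close>

lemma nn_integral_power_le_prod:
  fixes H :: "'i \<Rightarrow> 'a \<Rightarrow> ennreal"
  assumes A: "finite A" "A \<noteq> {}"
    and [measurable]: "f \<in> borel_measurable M" "\<And>i. i \<in> A \<Longrightarrow> H i \<in> borel_measurable M"
    and le: "\<And>x. x \<in> space M \<Longrightarrow> f x ^ card A \<le> (\<Prod>i\<in>A. H i x)"
  shows "(\<integral>\<^sup>+x. f x \<partial>M) ^ card A \<le> (\<Prod>i\<in>A. \<integral>\<^sup>+x. H i x \<partial>M)"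
proof -
  let ?K = "card A" and ?I = "\<lambda>i. \<integral>\<^sup>+x. H i x \<partial>M"
  have K: "0 < ?K" using A by (simp add: card_gt_0_iff)
  \<comment> \<open>Since 0 times infinity is 0 in \<open>ennreal\<close>, vanishing integrals have
    to be settled before infinite ones.\<close>
  consider (zero) i where "i \<in> A" "?I i = 0" | (top) i where "i \<in> A" "?I i = \<infinity>" "\<forall>j\<in>A. ?I j \<noteq> 0"
    | (fin) "\<forall>i\<in>A. ?I i \<noteq> 0 \<and> ?I i \<noteq> \<infinity>"
    by blast
  then show ?thesis
  proof cases
    case zero
    then have "AE x in M. H i x = 0" by (simp add: nn_integral_0_iff_AE)
    then have "AE x in M. f x = 0"
    proof (rule AE_mp, intro AE_I2 impI)
      fix x assume "x \<in> space M" "H i x = 0"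
      then have "f x ^ ?K \<le> 0"
        using le[of x] zero A by (metis prod_zero)
      then show "f x = 0" by simp
    qed
    then have "(\<integral>\<^sup>+x. f x \<partial>M) = 0" by (simp add: nn_integral_0_iff_AE)
    then show ?thesis using K by (simp add: zero_power)
  next
    case top
    then have "(\<Prod>i\<in>A. ?I i) = \<infinity>"
      using A by (auto simp: ennreal_prod_eq_top)
    then show ?thesis by simp
  next
    case fin
    define c where "c i = enn2real (?I i)" for i
    have c: "?I i = ennreal (c i)" "0 < c i" if "i \<in> A" for i
      using fin that by (auto simp: c_def enn2real_positive_iff top.not_eq_extremum less_top zero_less_iff_neq_zero)
    define P where "P = (\<Prod>i\<in>A. c i) powr (1 / ?K)"
    have c_pos: "0 < (\<Prod>i\<in>A. c i)" using c by (simp add: prod_pos)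
    have P: "0 < P" "P ^ ?K = (\<Prod>i\<in>A. c i)"
      using c_pos K by (simp_all add: P_def powr_powr flip: powr_realpow)
    \<comment> \<open>\<open>?S\<close> is the arithmetic mean of the normalised functions
      \<open>H i / c i\<close>. Its integral is 1, and the arithmetic-geometric mean inequality
      gives the pointwise bound of \<open>f\<close> by \<open>P\<close> times
      \<open>?S\<close>.\<close>
    let ?S = "\<lambda>x. \<Sum>i\<in>A. ennreal (1 / (c i * ?K)) * H i x"
    have AE: "AE x in M. f x \<le> ennreal P * ?S x"
    proof (rule AE_I2)
      fix x assume x: "x \<in> space M"
      show "f x \<le> ennreal P * ?S x"
      proof (cases "\<exists>i\<in>A. H i x = \<infinity>")
        case True
        then obtain i where i: "i \<in> A" "H i x = \<infinity>" by auto
        have "ennreal (1 / (c i * ?K)) * H i x = \<infinity>"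
          using i c[of i] K by (auto simp: ennreal_mult_eq_top_iff)
        then have "?S x = \<infinity>"
          using member_le_sum[OF i(1), of "\<lambda>i. ennreal (1 / (c i * ?K)) * H i x"] A
          by (auto simp: top_unique)
        then show ?thesis using P by (auto simp: ennreal_mult_eq_top_iff)
      next
        case False
        define h where "h i = enn2real (H i x)" for i
        have h: "H i x = ennreal (h i)" "0 \<le> h i" if "i \<in> A" for i
          using False that by (auto simp: h_def less_top[symmetric])
        have "f x ^ ?K \<le> (\<Prod>i\<in>A. ennreal (h i))"
          using le[OF x] h by (simp cong: prod.cong)
        also have "\<dots> = ennreal (\<Prod>i\<in>A. h i)"
          by (rule prod_ennreal) (use h in auto)
        finally have f: "f x ^ ?K \<le> ennreal (\<Prod>i\<in>A. h i)" .
        then have "f x \<noteq> \<infinity>"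
          using K by (auto simp: top_power_ennreal top_unique split: if_splits)
        then obtain r where r: "f x = ennreal r" "0 \<le> r" by (cases "f x") auto
        have "r ^ ?K \<le> (\<Prod>i\<in>A. h i)"
          using f r h by (simp add: ennreal_power prod_nonneg)
        also have "\<dots> = P ^ ?K * (\<Prod>i\<in>A. h i / c i)"
          using c_pos P by (simp add: prod_dividef)
        also have "\<dots> \<le> P ^ ?K * ((\<Sum>i\<in>A. h i / c i) / ?K) ^ ?K"
          using c h P A c_pos by (intro mult_left_mono prod_le_mean_power) (auto simp: less_imp_le)
        also have "\<dots> = (P * ((\<Sum>i\<in>A. h i / c i) / ?K)) ^ ?K"
          by (simp add: power_mult_distrib power_divide)
        finally have "r \<le> P * ((\<Sum>i\<in>A. h i / c i) / ?K)"
          using K c h P r by (subst (asm) power_mono_iff) (auto intro!: divide_nonneg_nonneg mult_nonneg_nonneg sum_nonneg simp: less_imp_le)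
        also have "\<dots> = P * (\<Sum>i\<in>A. (1 / (c i * ?K)) * h i)"
          by (simp add: sum_divide_distrib)
        finally have "f x \<le> ennreal (P * (\<Sum>i\<in>A. (1 / (c i * ?K)) * h i))"
          using r by (simp add: ennreal_leI)
        also have "\<dots> = ennreal P * (\<Sum>i\<in>A. ennreal ((1 / (c i * ?K)) * h i))"
          using P c h K by (subst sum_ennreal) (auto simp: ennreal_mult' less_imp_le)
        also have "(\<Sum>i\<in>A. ennreal ((1 / (c i * ?K)) * h i)) = ?S x"
          using c h by (intro sum.cong refl) (auto simp: ennreal_mult'[symmetric] less_imp_le)
        finally show ?thesis .
      qed
    qed
    have "(\<integral>\<^sup>+x. f x \<partial>M) \<le> (\<integral>\<^sup>+x. ennreal P * ?S x \<partial>M)"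
      by (rule nn_integral_mono_AE[OF AE])
    also have "\<dots> = ennreal P * (\<Sum>i\<in>A. ennreal (1 / (c i * ?K)) * ?I i)"
      by (simp add: nn_integral_cmult nn_integral_sum)
    also have "(\<Sum>i\<in>A. ennreal (1 / (c i * ?K)) * ?I i) = (\<Sum>i\<in>A. ennreal (1 / ?K))"
    proof (rule sum.cong)
      fix i assume "i \<in> A"
      then have "c i \<noteq> 0" "0 \<le> c i" "?I i = ennreal (c i)" using c[of i] by auto
      then show "ennreal (1 / (c i * ?K)) * ?I i = ennreal (1 / ?K)"
        by (simp add: ennreal_mult'[symmetric])
    qed simp
    also have "\<dots> = 1"
      using K by (simp add: ennreal_of_nat_eq_real_of_nat ennreal_mult'[symmetric])
    finally have "(\<integral>\<^sup>+x. f x \<partial>M) ^ ?K \<le> ennreal P ^ ?K"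
      by (intro power_mono) auto
    also have "\<dots> = (\<Prod>i\<in>A. ennreal (c i))"
      using P c by (simp add: ennreal_power prod_ennreal less_imp_le)
    finally show ?thesis using c by (simp cong: prod.cong)
  qed
qed

text \<open>Induction over the coordinates integrated so far. For a new coordinate \<open>j\<close>,
  the factor with index \<open>j\<close> is constant in that direction, and the other
  \<open>CARD('n) - 1\<close> factors are separated by Hoelder's inequality.
  \<open>removeAll i\<close> records that \<open>f i\<close> is never integrated in direction
  \<open>i\<close>.\<close>

lemma prod_iter_int_le:
  fixes f :: "'n::finite \<Rightarrow> real ^ 'n \<Rightarrow> ennreal"
  assumes n: "2 \<le> CARD('n)"
    and [measurable]: "F \<in> borel_measurable borel" "\<And>i. f i \<in> borel_measurable borel"
    and inv: "\<And>i x s. f i (x + s *\<^sub>R axis i 1) = f i x"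
    and le: "\<And>x. F x ^ (CARD('n) - 1) \<le> (\<Prod>i\<in>UNIV. f i x)"
    and "distinct js"
  shows "iter_int js F x ^ (CARD('n) - 1) \<le> (\<Prod>i\<in>UNIV. iter_int (removeAll i js) (f i) x)"
  using \<open>distinct js\<close>
proof (induction js arbitrary: x)
  case Nil
  then show ?case using le by simp
next
  case (Cons j js)
  let ?A = "UNIV - {j} :: 'n set" and ?G = "\<lambda>i. iter_int (removeAll i js) (f i)"
  have A: "card ?A = CARD('n) - 1" "finite ?A"
    by simp_all
  then have A': "?A \<noteq> {}"
    using n by (metis card.empty diff_is_0_eq not_less_eq_eq numeral_2_eq_2 One_nat_def)
  have cj: "?G j (x + s *\<^sub>R axis j 1) = ?G j x" for x s
    by (intro iter_int_invariant inv)
  have prod_split: "(\<Prod>i\<in>UNIV. g i) = g j * (\<Prod>i\<in>?A. g i)" for g :: "'n \<Rightarrow> ennreal"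
    by (simp add: prod.remove)
  have rm: "removeAll j (j # js) = removeAll j js"
    "\<And>i. i \<in> ?A \<Longrightarrow> removeAll i (j # js) = j # removeAll i js" by auto
  \<comment> \<open>The constant factor \<open>c\<close> is attached to one arbitrary index
    \<open>a\<close>, so that Hoelder's inequality still sees exactly \<open>CARD('n) - 1\<close>
    factors.\<close>
  obtain a where a: "a \<in> ?A" using A' by blast
  define c where "c = ?G j x"
  let ?H = "\<lambda>i s. (if i = a then c else 1) * ?G i (x + s *\<^sub>R axis j 1)"
  have m[measurable]: "(\<lambda>s. ?G i (x + s *\<^sub>R axis j 1)) \<in> borel_measurable lborel" for i
    by (intro measurable_compose[OF _ iter_int_measurable]) auto
  have m'[measurable]: "(\<lambda>s. iter_int js F (x + s *\<^sub>R axis j 1)) \<in> borel_measurable lborel"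
    by (intro measurable_compose[OF _ iter_int_measurable]) auto
  have "iter_int (j # js) F x ^ card ?A = (\<integral>\<^sup>+s. iter_int js F (x + s *\<^sub>R axis j 1) \<partial>lborel) ^ card ?A"
    by simp
  also have "\<dots> \<le> (\<Prod>i\<in>?A. \<integral>\<^sup>+s. ?H i s \<partial>lborel)"
  proof (rule nn_integral_power_le_prod)
    fix s :: real
    have "iter_int js F (x + s *\<^sub>R axis j 1) ^ card ?A \<le> c * (\<Prod>i\<in>?A. ?G i (x + s *\<^sub>R axis j 1))"
      using Cons.IH[of "x + s *\<^sub>R axis j 1"] Cons.prems unfolding prod_split A cj c_def by simp
    also have "\<dots> = (\<Prod>i\<in>?A. ?H i s)"
      using a by (simp add: prod.distrib)
    finally show "iter_int js F (x + s *\<^sub>R axis j 1) ^ card ?A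
      \<le> (\<Prod>i\<in>?A. ?H i s)" .
  qed (use A A' in auto)
  also have "\<dots> = (\<Prod>i\<in>?A. (if i = a then c else 1) * iter_int (j # removeAll i js) (f i) x)"
    by (intro prod.cong refl) (simp add: nn_integral_cmult)
  also have "\<dots> = c * (\<Prod>i\<in>?A. iter_int (j # removeAll i js) (f i) x)"
    using a by (simp add: prod.distrib)
  also have "\<dots> = (\<Prod>i\<in>UNIV. iter_int (removeAll i (j # js)) (f i) x)"
    unfolding prod_split c_def rm(1) by (intro arg_cong2[where f="(*)"] refl prod.cong) auto
  finally show ?case using A by simp
qed

text \<open>The inner integrals do not depend on the \<open>i\<close>-th coordinate of \<open>x\<close>.\<close>

lemma Loomis_Whitney:
  fixes Q :: "'n::finite \<Rightarrow> real ^ 'n \<Rightarrow> ennreal"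
  assumes n: "2 \<le> CARD('n)"
    and [measurable]: "F \<in> borel_measurable borel" "\<And>i. Q i \<in> borel_measurable borel"
    and le: "\<And>x. F x ^ (CARD('n) - 1) \<le> (\<Prod>i\<in>UNIV. \<integral>\<^sup>+s. Q i (x + s *\<^sub>R axis i 1) \<partial>lborel)"
  shows "(\<integral>\<^sup>+x. F x \<partial>lborel) ^ (CARD('n) - 1) \<le> (\<Prod>i\<in>UNIV. \<integral>\<^sup>+x. Q i x \<partial>lborel)"
proof -
  obtain js :: "'n list" where js: "distinct js" "set js = UNIV"
    using finite_distinct_list[of "UNIV :: 'n set"] by auto
  define f where "f i = (\<lambda>x. \<integral>\<^sup>+s. Q i (x + s *\<^sub>R axis i 1) \<partial>lborel)" for i
  have fm [measurable]: "f i \<in> borel_measurable borel" for i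
    unfolding f_def by measurable
  have inv: "f i (x + s *\<^sub>R axis i 1) = f i x" for i x s
    using nn_integral_lborel_translate[of "\<lambda>r. Q i (x + r *\<^sub>R axis i 1)" s]
    by (simp add: f_def algebra_simps)
  have "iter_int js F 0 ^ (CARD('n) - 1) \<le> (\<Prod>i\<in>UNIV. iter_int (removeAll i js) (f i) 0)"
    by (rule prod_iter_int_le) (use n js inv le in \<open>auto simp: f_def\<close>)
  also have "(\<Prod>i\<in>UNIV. iter_int (removeAll i js) (f i) 0) = (\<Prod>i\<in>UNIV. \<integral>\<^sup>+x. Q i x \<partial>lborel)"
    (is "prod ?l _ = prod ?r _")
  proof (rule prod.cong)
    show "?l i = ?r i" for i
    unfolding f_def by (rule nn_integral_iter_int_last[symmetric]) (use js in \<open>auto simp: distinct_removeAll\<close>)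
  qed simp
  finally show ?thesis using iter_int_UNIV[of F js 0] js by simp
qed

text \<open>The shear \<open>L\<close> preserves Lebesgue measure and maps \<open>axis i 1\<close>
  to \<open>d i\<close>; the inequality along coordinate lines, applied to \<open>F\<close> and
  \<open>Q i\<close> composed with \<open>L\<close>, is the claim.\<close>

lemma Loomis_Whitney_sheared:
  fixes Q :: "'n::finite \<Rightarrow> real ^ 'n \<Rightarrow> ennreal" and \<sigma> :: "'n \<Rightarrow> real"
  assumes n: "2 \<le> CARD('n)"
    and [measurable]: "F \<in> borel_measurable borel" "\<And>i. Q i \<in> borel_measurable borel"
    and le: "\<And>x. F x ^ (CARD('n) - 1) \<le> (\<Prod>i\<in>UNIV. \<integral>\<^sup>+s. Q i (x + s *\<^sub>R d i) \<partial>lborel)"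
    and d: "d k = axis k 1" "\<And>i. i \<noteq> k \<Longrightarrow> d i = axis i 1 + \<sigma> i *\<^sub>R axis k 1"
  shows "(\<integral>\<^sup>+x. F x \<partial>lborel) ^ (CARD('n) - 1) \<le> (\<Prod>i\<in>UNIV. \<integral>\<^sup>+x. Q i x \<partial>lborel)"
proof -
  define c where "c x = (\<Sum>i\<in>UNIV - {k}. \<sigma> i * x $ i)" for x :: "real ^ 'n"
  define L where "L x = x + c x *\<^sub>R axis k 1" for x :: "real ^ 'n"
  have cm [measurable]: "c \<in> borel_measurable borel"
    unfolding c_def by measurable
  have Lm [measurable]: "L \<in> borel_measurable borel"
    unfolding L_def by measurable
  have c_axis: "c (x + s *\<^sub>R axis i 1) = c x + (if i = k then 0 else s * \<sigma> i)" for x s i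
  proof -
    have "c (x + s *\<^sub>R axis i 1) = c x + (\<Sum>j\<in>UNIV - {k}. if j = i then s * \<sigma> i else 0)"
      unfolding c_def sum.distrib[symmetric]
      by (intro sum.cong refl) (auto simp: axis_def algebra_simps)
    then show ?thesis by (simp add: sum.delta)
  qed
  have L_axis: "L (x + s *\<^sub>R axis i 1) = L x + s *\<^sub>R d i" for x s i
    by (cases "i = k") (auto simp: L_def c_axis d algebra_simps)
  have L_int: "(\<integral>\<^sup>+x. g (L x) \<partial>lborel) = (\<integral>\<^sup>+x. g x \<partial>lborel)" if "g \<in> borel_measurable borel"
    for g :: "real ^ 'n \<Rightarrow> ennreal"
    unfolding L_def by (rule nn_integral_shear) (use that c_axis in auto)
  have "(\<integral>\<^sup>+x. F (L x) \<partial>lborel) ^ (CARD('n) - 1) \<le> (\<Prod>i\<in>UNIV. \<integral>\<^sup>+x. Q i (L x) \<partial>lborel)"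
    by (rule Loomis_Whitney) (use n le in \<open>auto simp: L_axis\<close>)
  then show ?thesis by (simp add: L_int)
qed

section \<open>Gagliardo's estimate for smooth functions\<close>

lemma ennreal_power_le_imp_le:
  fixes x y :: ennreal
  assumes "x ^ n \<le> y ^ n" "0 < n"
  shows "x \<le> y"
proof (cases y)
  case (real b)
  show ?thesis
  proof (cases x)
    case (real a)
    then show ?thesis
      using assms \<open>y = ennreal b\<close> \<open>0 \<le> b\<close> by (simp add: ennreal_power ennreal_leI)
  next
    case top
    then show ?thesis
      using assms real by (simp add: ennreal_power top_power_ennreal top_unique)
  qed
qed simp

lemma prod_mono_ennreal:
  fixes f g :: "'i \<Rightarrow> ennreal"
  shows "(\<And>i. i \<in> A \<Longrightarrow> f i \<le> g i) \<Longrightarrow> prod f A \<le> prod g A"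
  by (induction A rule: infinite_finite_induct) (auto intro: mult_mono)

lemma powr_conjugate_power:
  fixes a :: real
  assumes "0 \<le> a" "2 \<le> n"
  shows "(a powr (real n / (real n - 1))) ^ (n - 1) = a ^ n"
proof (cases "a = 0")
  case False
  with assms have a: "0 < a" by simp
  have "(a powr (real n / (real n - 1))) ^ (n - 1) = (a powr (real n / (real n - 1))) powr real (n - 1)"
    using a by (subst powr_realpow) simp_all
  also have "\<dots> = a powr real n"
    using assms by (simp add: powr_powr of_nat_diff)
  finally show ?thesis using a by (simp add: powr_realpow)
qed (use assms in \<open>simp add: zero_power\<close>)

lemma grad_eqI:
  assumes "(f has_derivative (\<lambda>h. \<Sum>i\<in>UNIV. d i * h $ i)) (at x)"
  shows "grad f x = (\<chi> i. d i)"
  unfolding grad_def frechet_derivative_at[OF assms, symmetric]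
  by (auto simp: vec_eq_iff axis_def if_distrib cong: if_cong)

lemma smooth_fun_has_derivative: "smooth_fun v \<Longrightarrow> (v has_derivative (\<lambda>h. grad v x \<bullet> h)) (at x)"
  and smooth_fun_grad_continuous: "smooth_fun v \<Longrightarrow> continuous_on UNIV (grad v)"
proof -
  assume "smooth_fun v"
  then obtain D where D: "D [] = v"
    "\<And>is x. (D is has_derivative (\<lambda>h. \<Sum>i\<in>UNIV. D (i # is) x * h $ i)) (at x)"
    unfolding smooth_fun_def by blast
  have d: "(v has_derivative (\<lambda>h. \<Sum>i\<in>UNIV. D [i] x * h $ i)) (at x)" for x
    using D(2)[of "[]"] D(1) by simp
  have grad: "grad v = (\<lambda>x. \<chi> i. D [i] x)"
    using grad_eqI[OF d] by (rule ext)
  show "(v has_derivative (\<lambda>h. grad v x \<bullet> h)) (at x)"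
    using d[of x] by (simp add: grad inner_vec_def)
  have "continuous_on UNIV (D [i])" for i
    using D(2) by (meson has_derivative_continuous continuous_at_imp_continuous_on)
  then show "continuous_on UNIV (grad v)"
    by (simp add: grad continuous_on_vec_lambda)
qed

lemma smooth_fun_continuous: "smooth_fun v \<Longrightarrow> continuous_on UNIV v"
  by (meson smooth_fun_has_derivative has_derivative_continuous continuous_at_imp_continuous_on)

lemma smooth_fun_borel:
  assumes "smooth_fun v"
  shows "v \<in> borel_measurable borel" and "grad v \<in> borel_measurable borel"
  using smooth_fun_continuous[OF assms] smooth_fun_grad_continuous[OF assms]
  by (auto intro: borel_measurable_continuous_onI)

text \<open>Fundamental theorem of calculus on the segment from \<open>x - b *\<^sub>R d\<close> to
  \<open>x\<close>, with the chain rule and the Cauchy--Schwarz inequality for the directional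
  derivative.\<close>

lemma line_increment_le:
  fixes \<Phi> \<phi> :: "real \<Rightarrow> real"
  assumes v: "smooth_fun v" and \<Phi>: "\<And>s. (\<Phi> has_real_derivative \<phi> s) (at s)"
    and \<phi>: "continuous_on UNIV \<phi>" and b: "0 \<le> b"
  shows "ennreal \<bar>\<Phi> (v x) - \<Phi> (v (x - b *\<^sub>R d))\<bar>
    \<le> (\<integral>\<^sup>+s. ennreal (\<bar>\<phi> (v (x + s *\<^sub>R d))\<bar> * norm (grad v (x + s *\<^sub>R d)) * norm d) * indicator {- b<..0} s \<partial>lborel)"
proof -
  let ?z = "\<lambda>s. x + s *\<^sub>R d"
  let ?f = "\<lambda>s. \<phi> (v (?z s)) * (grad v (?z s) \<bullet> d)"
  let ?F = "\<lambda>s. \<Phi> (v (?z s))"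
  let ?N = "\<lambda>s. ennreal (\<bar>\<phi> (v (?z s))\<bar> * norm (grad v (?z s)) * norm d) * indicator {- b<..0} s"
  have der: "DERIV ?F s :> ?f s" for s
  proof -
    have "((\<lambda>s. v (?z s)) has_derivative (\<lambda>h. grad v (?z s) \<bullet> (h *\<^sub>R d))) (at s)"
      by (rule has_derivative_compose[OF _ smooth_fun_has_derivative[OF v]])
        (auto intro!: derivative_eq_intros)
    then have "DERIV (\<lambda>s. v (?z s)) s :> grad v (?z s) \<bullet> d"
      by (simp add: has_field_derivative_def mult.commute[of _ "grad v (?z s) \<bullet> d"] fun_eq_iff
          del: has_derivative_inner_right)
    then show ?thesis by (rule DERIV_chain2[OF \<Phi>])
  qed
  have cont: "continuous_on UNIV ?f"
    by (intro continuous_intros continuous_on_compose2[OF \<phi>] continuous_on_compose2[OF smooth_fun_continuous[OF v]]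
        continuous_on_compose2[OF smooth_fun_grad_continuous[OF v]]) auto
  have hb: "has_bochner_integral lborel (\<lambda>s. ?f s * indicator {- b..0} s) (?F 0 - ?F (- b))"
    by (rule has_bochner_integral_FTC_Icc_real) (use b der cont in \<open>auto simp: continuous_on_eq_continuous_at\<close>)
  then have "ennreal \<bar>?F 0 - ?F (- b)\<bar> = ennreal (norm (\<integral>s. ?f s * indicator {- b..0} s \<partial>lborel))"
    by (simp add: has_bochner_integral_integral_eq)
  also have "\<dots> \<le> (\<integral>\<^sup>+s. norm (?f s * indicator {- b..0} s) \<partial>lborel)"
    by (rule integral_norm_bound_ennreal) (use hb in \<open>simp add: has_bochner_integral_iff\<close>)
  also have "\<dots> \<le> (\<integral>\<^sup>+s. ?N s \<partial>lborel)"
  proof (rule nn_integral_mono_AE)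
    \<comment> \<open>The endpoint \<open>- b\<close> is dropped, because in the applications it
      lies on the flat part and hence outside the half ball.\<close>
    show "AE s in lborel. ennreal (norm (?f s * indicator {- b..0} s))
      \<le> ?N s"
      using AE_lborel_singleton[of "- b"]
    proof eventually_elim
      case (elim s)
      have "\<bar>?f s\<bar> \<le> \<bar>\<phi> (v (?z s))\<bar> * (norm (grad v (?z s)) * norm d)"
        unfolding abs_mult by (intro mult_left_mono Cauchy_Schwarz_ineq2) auto
      then show ?case
        using elim by (auto simp: mult.assoc abs_mult intro!: ennreal_leI split: split_indicator)
    qed
  qed
  finally show ?thesis by simp
qed

text \<open>Every direction has \<open>k\<close>-th coordinate 1, so whatever \<open>i\<close> is,
  the hyperplane is reached from \<open>x\<close> at the same parameter
  \<open>x $ k\<close>.\<close>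

definition tilt :: "'n::finite \<Rightarrow> ('n \<Rightarrow> real) \<Rightarrow> 'n \<Rightarrow> real ^ 'n" where
  "tilt k \<tau> i = axis k 1 + (if i = k then 0 else \<tau> i *\<^sub>R axis i 1)"

lemma tilt_nth [simp]: "tilt k \<tau> i $ k = 1"
  by (auto simp: tilt_def axis_def)

lemma norm_tilt_le:
  assumes "\<bar>\<tau> i\<bar> = 1"
  shows "norm (tilt k \<tau> i) \<le> 2"
  using norm_triangle_ineq[of "axis k 1" "if i = k then 0 else \<tau> i *\<^sub>R axis i (1::real)"] assms
  unfolding tilt_def by (auto simp: norm_axis_1)

text \<open>Going down from a point of the half ball in one of the directions \<open>axis k 1\<close> and
  \<open>axis k 1 + sgn (x $ i) *\<^sub>R axis i 1\<close>, one reaches the flat part before leaving the ball.\<close>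

lemma norm_minus_tilt_le:
  fixes x :: "real ^ 'n::finite"
  assumes "\<bar>\<tau> i\<bar> = 1" "i \<noteq> k \<Longrightarrow> 0 \<le> \<tau> i * x $ i" "0 \<le> s" "s \<le> x $ k"
  shows "norm (x - s *\<^sub>R tilt k \<tau> i) \<le> norm x"
proof -
  have t: "\<tau> i * \<tau> i = 1" using assms(1) by (metis abs_mult_self_eq mult.right_neutral)
  have dd: "tilt k \<tau> i \<bullet> tilt k \<tau> i = (if i = k then 1 else 2)"
    using t by (auto simp: tilt_def inner_add_left inner_add_right inner_axis_axis)
  have xd: "x \<bullet> tilt k \<tau> i = x $ k + (if i = k then 0 else \<tau> i * x $ i)"
    by (auto simp: tilt_def inner_add_right inner_axis)
  have "0 \<le> s * (x $ k - s)" "0 \<le> s * s" using assms by auto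
  moreover have "0 \<le> s * (if i = k then 0 else \<tau> i * x $ i)" using assms by auto
  \<comment> \<open>This is the claim with the squared norms expanded: the direction has squared
    length at most 2, and its inner product with \<open>x\<close> is at least \<open>x $ k\<close>,
    hence at least \<open>s\<close>.\<close>
  ultimately have "s * s * (tilt k \<tau> i \<bullet> tilt k \<tau> i) \<le> 2 * s * (x \<bullet> tilt k \<tau> i)"
    unfolding dd xd using mult_nonneg_nonneg[OF \<open>0 \<le> s\<close> order_trans[OF assms(3,4)]]
    by (auto simp: algebra_simps)
  then have "(norm (x - s *\<^sub>R tilt k \<tau> i))\<^sup>2 \<le> (norm x)\<^sup>2"
    by (simp add: power2_norm_eq_inner inner_diff_left inner_diff_right inner_commute algebra_simps)
  then show ?thesis by (rule power2_le_imp_le) simp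
qed

lemma half_ball_borel [measurable]: "half_ball k R \<in> sets borel"
proof -
  have "open (half_ball k R)"
    unfolding half_ball_def by (intro open_Int open_ball open_halfspace_component_gt_cart)
  then show ?thesis by simp
qed

lemma flat_part_borel [measurable]: "flat_part k R \<in> sets borel"
proof -
  have "closed {x :: real ^ 'a. x $ k = 0}"
    by (intro closed_Collect_eq continuous_intros)
  then show ?thesis
    unfolding flat_part_def by (intro sets.Int) auto
qed

text \<open>As the inequalities are weak, the sectors of all sign patterns cover the half ball;
  overlaps do no harm to an upper bound.\<close>

definition sector :: "'n::finite \<Rightarrow> real \<Rightarrow> ('n \<Rightarrow> real) \<Rightarrow> (real ^ 'n) set" where
  "sector k R \<tau> = half_ball k R \<inter> {x. \<forall>i. i \<noteq> k \<longrightarrow> 0 \<le> \<tau> i * x $ i}"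

lemma sector_borel [measurable]: "sector k R \<tau> \<in> sets borel"
proof -
  have "closed {x :: real ^ 'a. \<forall>i. i \<noteq> k \<longrightarrow> 0 \<le> \<tau> i * x $ i}"
    by (intro closed_Collect_all closed_Collect_imp closed_Collect_le continuous_intros) simp
  then show ?thesis unfolding sector_def by (intro sets.Int) auto
qed

text \<open>The second summand spreads the values on the flat part over lines crossing the slab of
  width 1, so that all contributions take the form of a line integral.\<close>

definition line_density ::
    "'n::finite \<Rightarrow> real \<Rightarrow> (real \<Rightarrow> real) \<Rightarrow> (real \<Rightarrow> real) \<Rightarrow> (real \<Rightarrow> real) \<Rightarrow> (real ^ 'n \<Rightarrow> real) \<Rightarrow>
      real ^ 'n \<Rightarrow> real ^ 'n \<Rightarrow> ennreal" where
  "line_density k R \<Phi> \<phi> \<omega> v d z =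
     ennreal (2 * \<bar>\<phi> (v z)\<bar> * norm (grad v z) * \<omega> (z $ k)) * indicator (half_ball k R) z +
     indicator {0<..<1} (z $ k) *
       (ennreal (\<omega> 0 * \<Phi> (v (z - (z $ k) *\<^sub>R d))) * indicator (flat_part k R) (z - (z $ k) *\<^sub>R d))"

text \<open>The quantity to be estimated is \<open>\<Phi> (v x) * \<omega> (x $ k)\<close>. Lines
  are followed downwards, so a nonincreasing weight at the top of a line is dominated by its values
  further down and can be moved under the line integral. The instances are squares and truncated
  powers for \<open>\<Phi>\<close>, and 1 or a shifted power for \<open>\<omega>\<close>.\<close>

locale gagliardo_data =
  fixes k :: "'n::finite" and R :: real and \<Phi> \<phi> \<omega> :: "real \<Rightarrow> real"
  assumes \<Phi>_deriv: "\<And>s. (\<Phi> has_real_derivative \<phi> s) (at s)"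
    and \<phi>_cont: "continuous_on UNIV \<phi>"
    and \<Phi>_nonneg: "\<And>s. 0 \<le> \<Phi> s"
    and \<omega>_nonneg: "\<And>s. 0 \<le> \<omega> s"
    and \<omega>_antimono: "\<And>s t. 0 \<le> s \<Longrightarrow> s \<le> t \<Longrightarrow> \<omega> t \<le> \<omega> s"
    and \<omega>_borel [measurable]: "\<omega> \<in> borel_measurable borel"
begin

lemma \<phi>_borel [measurable]: "\<phi> \<in> borel_measurable borel"
  using \<phi>_cont by (rule borel_measurable_continuous_onI)

lemma \<Phi>_borel [measurable]: "\<Phi> \<in> borel_measurable borel"
  using \<Phi>_deriv by (meson DERIV_isCont borel_measurable_continuous_onI continuous_at_imp_continuous_on)

text \<open>The factor 2 bounds the length of the directions \<open>tilt\<close>. The second summand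
  is the boundary error, which disappears only in the limit.\<close>

definition total :: "(real ^ 'n \<Rightarrow> real) \<Rightarrow> ennreal" where
  "total v = (\<integral>\<^sup>+x\<in>half_ball k R. ennreal (2 * \<bar>\<phi> (v x)\<bar> * norm (grad v x) * \<omega> (x $ k)) \<partial>lborel) +
     (\<integral>\<^sup>+x\<in>flat_part k R. ennreal (\<omega> 0 * \<Phi> (v x)) \<partial>hyperplane_measure k)"

lemma line_density_borel [measurable]:
  assumes "smooth_fun v"
  shows "line_density k R \<Phi> \<phi> \<omega> v d \<in> borel_measurable borel"
proof -
  note [measurable] = smooth_fun_borel[OF assms]
  show ?thesis unfolding line_density_def by measurable
qed

text \<open>The value at \<open>x\<close> is compared with that at the foot \<open>?y\<close> of the
  line on the flat part: the increment gives the gradient part of \<open>line_density\<close>, the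
  value at the foot gives the other part.\<close>

lemma le_line_integral:
  assumes v: "smooth_fun v" and x: "x \<in> half_ball k R"
    and \<tau>: "\<bar>\<tau> i\<bar> = 1" "i \<noteq> k \<Longrightarrow> 0 \<le> \<tau> i * x $ i"
  shows "ennreal (\<Phi> (v x) * \<omega> (x $ k))
    \<le> (\<integral>\<^sup>+s. line_density k R \<Phi> \<phi> \<omega> v (tilt k \<tau> i) (x + s *\<^sub>R tilt k \<tau> i) \<partial>lborel)"
proof -
  note [measurable] = smooth_fun_borel[OF v] line_density_borel[OF v]
  let ?d = "tilt k \<tau> i"
  let ?y = "x - (x $ k) *\<^sub>R ?d"
  let ?g = "\<lambda>z. ennreal (2 * \<bar>\<phi> (v z)\<bar> * norm (grad v z) * \<omega> (z $ k)) * indicator (half_ball k R) z"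
  let ?N = "\<lambda>s. ennreal (\<bar>\<phi> (v (x + s *\<^sub>R ?d))\<bar> * norm (grad v (x + s *\<^sub>R ?d)) * norm ?d) * indicator {- (x $ k)<..0} s"
  have xk: "0 < x $ k" and xR: "norm x < R"
    using x by (auto simp: half_ball_def)
  have mem: "x + s *\<^sub>R ?d \<in> half_ball k R" if "- (x $ k) < s" "s \<le> 0" for s
    using norm_minus_tilt_le[of \<tau> i k x "- s"] \<tau> that xR by (auto simp: half_ball_def)
  have y: "?y \<in> flat_part k R"
    using norm_minus_tilt_le[of \<tau> i k x "x $ k"] \<tau> xk xR by (auto simp: flat_part_def)
  have "\<Phi> (v x) * \<omega> (x $ k) \<le> \<omega> 0 * \<Phi> (v ?y) + \<bar>\<Phi> (v x) - \<Phi> (v ?y)\<bar> * \<omega> (x $ k)"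
  proof -
    have "\<Phi> (v x) * \<omega> (x $ k) \<le> (\<Phi> (v ?y) + \<bar>\<Phi> (v x) - \<Phi> (v ?y)\<bar>) * \<omega> (x $ k)"
      by (intro mult_right_mono \<omega>_nonneg) auto
    moreover have "\<Phi> (v ?y) * \<omega> (x $ k) \<le> \<Phi> (v ?y) * \<omega> 0"
      using xk by (intro mult_left_mono \<omega>_antimono \<Phi>_nonneg) auto
    ultimately show ?thesis by (simp add: algebra_simps)
  qed
  then have "ennreal (\<Phi> (v x) * \<omega> (x $ k))
     \<le> ennreal (\<omega> 0 * \<Phi> (v ?y)) + ennreal \<bar>\<Phi> (v x) - \<Phi> (v ?y)\<bar> * ennreal (\<omega> (x $ k))"
    using \<omega>_nonneg \<Phi>_nonneg by (simp flip: ennreal_plus ennreal_mult')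
  also have "ennreal \<bar>\<Phi> (v x) - \<Phi> (v ?y)\<bar> * ennreal (\<omega> (x $ k))
    \<le> (\<integral>\<^sup>+s. ?N s \<partial>lborel) * ennreal (\<omega> (x $ k))"
    using xk by (intro mult_right_mono line_increment_le v \<Phi>_deriv \<phi>_cont) auto
  also have "\<dots> = (\<integral>\<^sup>+s. ?N s * ennreal (\<omega> (x $ k)) \<partial>lborel)"
    by (rule nn_integral_multc[symmetric]) measurable
  also have "\<dots> \<le> (\<integral>\<^sup>+s. ?g (x + s *\<^sub>R ?d) \<partial>lborel)"
  proof (rule nn_integral_mono)
    fix s :: real
    show "?N s * ennreal (\<omega> (x $ k)) \<le> ?g (x + s *\<^sub>R ?d)"
    proof (cases "s \<in> {- (x $ k)<..0}")
      case True
      let ?P = "\<bar>\<phi> (v (x + s *\<^sub>R ?d))\<bar> * norm (grad v (x + s *\<^sub>R ?d))"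
      \<comment> \<open>Monotonicity carries the weight from \<open>x\<close> to the lower point of
        the line.\<close>
      have "?P * norm ?d * \<omega> (x $ k) \<le> ?P * 2 * \<omega> ((x + s *\<^sub>R ?d) $ k)"
        using True norm_tilt_le[of \<tau> i k] \<tau> \<omega>_nonneg by (intro mult_mono \<omega>_antimono) auto
      then show ?thesis
        using True mem[of s] \<omega>_nonneg by (auto simp: ac_simps simp flip: ennreal_mult' intro!: ennreal_leI)
    qed simp
  qed
  also have "ennreal (\<omega> 0 * \<Phi> (v ?y)) = (\<integral>\<^sup>+s. indicator {0<..<1} (x $ k + s) * ennreal (\<omega> 0 * \<Phi> (v ?y)) \<partial>lborel)"
  proof -
    have "(\<integral>\<^sup>+s. indicator {0<..<1} (x $ k + s) \<partial>lborel) = (\<integral>\<^sup>+s. indicator {0<..<1::real} s \<partial>lborel)"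
      by (rule nn_integral_lborel_translate) simp
    also have "\<dots> = 1" by simp
    finally show ?thesis by (simp add: nn_integral_multc)
  qed
  also have "\<dots> = (\<integral>\<^sup>+s. indicator {0<..<1} ((x + s *\<^sub>R ?d) $ k) * (ennreal (\<omega> 0 * \<Phi> (v (x + s *\<^sub>R ?d - ((x + s *\<^sub>R ?d) $ k) *\<^sub>R ?d)))
       * indicator (flat_part k R) (x + s *\<^sub>R ?d - ((x + s *\<^sub>R ?d) $ k) *\<^sub>R ?d)) \<partial>lborel)"
    using y by (intro nn_integral_cong) (simp add: algebra_simps)
  finally show ?thesis
    unfolding line_density_def by (subst nn_integral_add) (auto simp: add_mono add.commute)
qed

text \<open>The integral is the same for all directions: a shear along \<open>axis i 1\<close> turns
  the oblique projection onto the hyperplane into the orthogonal one, to which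
  \<open>nn_integral_slab\<close> applies.\<close>

lemma nn_integral_line_density:
  assumes v: "smooth_fun v" and \<tau>: "\<bar>\<tau> i\<bar> = 1"
  shows "(\<integral>\<^sup>+z. line_density k R \<Phi> \<phi> \<omega> v (tilt k \<tau> i) z \<partial>lborel) = total v"
proof -
  note [measurable] = smooth_fun_borel[OF v] line_density_borel[OF v]
  let ?b = "\<lambda>y. ennreal (\<omega> 0 * \<Phi> (v y)) * indicator (flat_part k R) y"
  let ?f = "\<lambda>d z. indicator {0<..<1} (z $ k) * ?b (z - (z $ k) *\<^sub>R d)"
  have "(\<integral>\<^sup>+z. ?f (tilt k \<tau> i) z \<partial>lborel) = (\<integral>\<^sup>+z. ?f (axis k 1) z \<partial>lborel)"
  proof (cases "i = k")
    case False
    let ?c = "\<lambda>z :: real ^ 'n. \<tau> i * z $ k"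
    have "(\<integral>\<^sup>+z. ?f (tilt k \<tau> i) z \<partial>lborel) = (\<integral>\<^sup>+z. ?f (tilt k \<tau> i) (z + ?c z *\<^sub>R axis i 1) \<partial>lborel)"
      by (rule nn_integral_shear[symmetric]) (use False in \<open>auto simp: axis_def\<close>)
    also have "\<dots> = (\<integral>\<^sup>+z. ?f (axis k 1) z \<partial>lborel)"
    proof (rule nn_integral_cong)
      fix z :: "real ^ 'n"
      have "(z + ?c z *\<^sub>R axis i 1) $ k = z $ k" using False by (simp add: axis_def)
      moreover have "z + ?c z *\<^sub>R axis i 1 - (z $ k) *\<^sub>R tilt k \<tau> i = z - (z $ k) *\<^sub>R axis k 1"
        using False by (simp add: tilt_def algebra_simps)
      ultimately show "?f (tilt k \<tau> i) (z + ?c z *\<^sub>R axis i 1) = ?f (axis k 1) z"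
        by (simp only:)
    qed
    finally show ?thesis .
  qed (simp add: tilt_def)
  also have "\<dots> = (\<integral>\<^sup>+s. indicator {0<..<1::real} s \<partial>lborel) * (\<integral>\<^sup>+y. ?b y \<partial>hyperplane_measure k)"
    by (rule nn_integral_slab) measurable
  finally have "(\<integral>\<^sup>+z. ?f (tilt k \<tau> i) z \<partial>lborel) = (\<integral>\<^sup>+y. ?b y \<partial>hyperplane_measure k)"
    by simp
  then show ?thesis
    unfolding line_density_def total_def by (subst nn_integral_add) auto
qed

text \<open>Inside a sector every direction \<open>tilt k \<tau> i\<close> may be followed down, so
  the same value is bounded by a line integral for each \<open>i\<close>. Loomis--Whitney multiplies
  these bounds, and each factor integrates to \<open>total v\<close>.\<close>

lemma sector_estimate:
  assumes n: "2 \<le> CARD('n)" and v: "smooth_fun v" and \<tau>: "\<And>i. \<bar>\<tau> i\<bar> = 1"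
  shows "(\<integral>\<^sup>+x\<in>sector k R \<tau>.
      ennreal ((\<Phi> (v x) * \<omega> (x $ k)) powr (real CARD('n) / (real CARD('n) - 1))) \<partial>lborel) ^ (CARD('n) - 1)
    \<le> total v ^ CARD('n)"
proof -
  note [measurable] = smooth_fun_borel[OF v] line_density_borel[OF v]
  let ?n = "CARD('n)"
  let ?Q = "\<lambda>i. line_density k R \<Phi> \<phi> \<omega> v (tilt k \<tau> i)"
  let ?S = "sector k R \<tau>"
  let ?F = "\<lambda>x. ennreal ((\<Phi> (v x) * \<omega> (x $ k)) powr (real ?n / (real ?n - 1))) * indicator ?S x"
  define d :: "'n \<Rightarrow> real ^ 'n" where "d i = (if i = k then axis k 1 else axis i 1 + \<tau> i *\<^sub>R axis k 1)" for i
  have tt: "\<tau> i * \<tau> i = 1" for i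
    using \<tau>[of i] by (metis abs_mult_self_eq mult.right_neutral)
  \<comment> \<open>\<open>d i\<close> and \<open>tilt k \<tau> i\<close> agree up to the sign
    \<open>\<tau> i\<close>, which only reverses the parametrisation of the line.\<close>
  have refl: "(\<integral>\<^sup>+s. ?Q i (x + s *\<^sub>R d i) \<partial>lborel)
      = (\<integral>\<^sup>+s. ?Q i (x + s *\<^sub>R tilt k \<tau> i) \<partial>lborel)" for i x
  proof (cases "i = k")
    case False
    have "d i = \<tau> i *\<^sub>R tilt k \<tau> i"
      using False tt[of i] by (simp add: d_def tilt_def algebra_simps)
    then have "(\<integral>\<^sup>+s. ?Q i (x + s *\<^sub>R d i) \<partial>lborel)
      = (\<integral>\<^sup>+s. ?Q i (x + (0 + \<tau> i * s) *\<^sub>R tilt k \<tau> i) \<partial>lborel)"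
      by (simp add: mult.commute)
    also have "\<dots> = (\<integral>\<^sup>+s. ?Q i (x + s *\<^sub>R tilt k \<tau> i) \<partial>lborel)"
      using \<tau>[of i] by (subst (2) nn_integral_real_affine[where c="\<tau> i" and t=0]) auto
    finally show ?thesis .
  qed (simp add: d_def tilt_def)
  have "(\<integral>\<^sup>+x. ?F x \<partial>lborel) ^ (?n - 1) \<le> (\<Prod>i\<in>UNIV. \<integral>\<^sup>+z. ?Q i z \<partial>lborel)"
  proof (rule Loomis_Whitney_sheared[where d=d and k=k and \<sigma>=\<tau>])
    fix x :: "real ^ 'n"
    show "?F x ^ (?n - 1) \<le> (\<Prod>i\<in>UNIV. \<integral>\<^sup>+s. ?Q i (x + s *\<^sub>R d i) \<partial>lborel)"
    proof (cases "x \<in> ?S")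
      case True
      have P: "0 \<le> \<Phi> (v x) * \<omega> (x $ k)" by (simp add: \<Phi>_nonneg \<omega>_nonneg)
      have "((\<Phi> (v x) * \<omega> (x $ k)) powr (real ?n / (real ?n - 1))) ^ (?n - 1) = (\<Phi> (v x) * \<omega> (x $ k)) ^ ?n"
        using P n by (rule powr_conjugate_power)
      then have "?F x ^ (?n - 1) = (\<Prod>i\<in>(UNIV::'n set). ennreal (\<Phi> (v x) * \<omega> (x $ k)))"
        using True P by (simp add: ennreal_power)
      also have "\<dots> \<le> (\<Prod>i\<in>UNIV. \<integral>\<^sup>+s. ?Q i (x + s *\<^sub>R d i) \<partial>lborel)"
        unfolding refl by (intro prod_mono_ennreal le_line_integral v) (use True \<tau> in \<open>auto simp: sector_def\<close>)
      finally show ?thesis .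
    qed (use n in \<open>simp add: zero_power\<close>)
  qed (use n in \<open>auto simp: d_def\<close>)
  also have "\<dots> = total v ^ ?n"
    using v \<tau> by (simp add: nn_integral_line_density)
  finally show ?thesis by simp
qed

text \<open>The factor \<open>2 ^ CARD('n)\<close> counts the sign patterns whose sectors cover the
  half ball.\<close>

lemma gagliardo_smooth:
  assumes n: "2 \<le> CARD('n)" and v: "smooth_fun v" and r: "total v \<le> ennreal r" "0 \<le> r"
  shows "(\<integral>\<^sup>+x\<in>half_ball k R.
      ennreal ((\<Phi> (v x) * \<omega> (x $ k)) powr (real CARD('n) / (real CARD('n) - 1))) \<partial>lborel)
    \<le> ennreal (2 ^ CARD('n) * r powr (real CARD('n) / (real CARD('n) - 1)))"
proof -
  note [measurable] = smooth_fun_borel[OF v] line_density_borel[OF v]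
  let ?n = "CARD('n)"
  let ?T = "UNIV \<rightarrow>\<^sub>E {-1, 1} :: ('n \<Rightarrow> real) set"
  let ?S = "sector k R"
  let ?f = "\<lambda>x. ennreal ((\<Phi> (v x) * \<omega> (x $ k)) powr (real ?n / (real ?n - 1)))"
  let ?q = "real ?n / (real ?n - 1)"
  have fin: "finite ?T" by (intro finite_PiE) auto
  have "(\<integral>\<^sup>+x\<in>half_ball k R. ?f x \<partial>lborel) \<le> (\<integral>\<^sup>+x. (\<Sum>\<tau>\<in>?T. ?f x * indicator (?S \<tau>) x) \<partial>lborel)"
  proof (rule nn_integral_mono)
    fix x :: "real ^ 'n"
    define \<tau> :: "'n \<Rightarrow> real" where "\<tau> i = (if 0 \<le> x $ i then 1 else -1)" for i
    have \<tau>: "\<tau> \<in> ?T" by (auto simp: \<tau>_def split: if_splits)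
    have "?f x * indicator (half_ball k R) x = ?f x * indicator (?S \<tau>) x"
      by (auto simp: \<tau>_def sector_def split: split_indicator)
    also have "\<dots> \<le> (\<Sum>\<tau>\<in>?T. ?f x * indicator (?S \<tau>) x)"
      by (rule member_le_sum[OF \<tau>]) (use fin in auto)
    finally show "?f x * indicator (half_ball k R) x \<le> (\<Sum>\<tau>\<in>?T. ?f x * indicator (?S \<tau>) x)" .
  qed
  also have "\<dots> = (\<Sum>\<tau>\<in>?T. \<integral>\<^sup>+x\<in>?S \<tau>. ?f x \<partial>lborel)"
    by (rule nn_integral_sum) measurable
  also have "\<dots> \<le> (\<Sum>\<tau>\<in>?T. ennreal (r powr ?q))"
  proof (rule sum_mono)
    fix \<tau> assume "\<tau> \<in> ?T"
    then have "\<bar>\<tau> i\<bar> = 1" for i by (auto simp: PiE_def Pi_def) (metis abs_1 abs_minus_cancel)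
    then have "(\<integral>\<^sup>+x\<in>?S \<tau>. ?f x \<partial>lborel) ^ (?n - 1) \<le> total v ^ ?n"
      by (intro sector_estimate n v)
    also have "\<dots> \<le> ennreal r ^ ?n" by (intro power_mono r) simp
    also have "\<dots> = ennreal (r powr ?q) ^ (?n - 1)"
      using n r by (simp only: ennreal_power powr_ge_zero powr_conjugate_power)
    finally show "(\<integral>\<^sup>+x\<in>?S \<tau>. ?f x \<partial>lborel) \<le> ennreal (r powr ?q)"
      by (rule ennreal_power_le_imp_le) (use n in auto)
  qed
  also have "\<dots> = ennreal (2 ^ ?n * r powr ?q)"
    by (simp add: card_PiE ennreal_of_nat_eq_real_of_nat ennreal_mult' of_nat_power)
  finally show ?thesis .
qed

text \<open>In dimension 1 the line integral is already the integral over the whole space, so the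
  estimate is pointwise and replaces Loomis--Whitney.\<close>

lemma one_dim_smooth:
  assumes n: "CARD('n) = 1" and v: "smooth_fun v" and x: "x \<in> half_ball k R"
  shows "ennreal (\<Phi> (v x) * \<omega> (x $ k)) \<le> total v"
proof -
  note [measurable] = smooth_fun_borel[OF v] line_density_borel[OF v]
  let ?Q = "line_density k R \<Phi> \<phi> \<omega> v (tilt k (\<lambda>_. 1) k)"
  have k: "set [k] = UNIV" using n card_1_singletonE[of "UNIV :: 'n set"] by (metis UNIV_I empty_set list.simps(15) singletonD)
  have "ennreal (\<Phi> (v x) * \<omega> (x $ k)) \<le> (\<integral>\<^sup>+s. ?Q (x + s *\<^sub>R tilt k (\<lambda>_. 1) k) \<partial>lborel)"
    by (rule le_line_integral) (use v x in auto)
  also have "\<dots> = iter_int [k] ?Q x" by (simp add: tilt_def)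
  also have "\<dots> = (\<integral>\<^sup>+x. ?Q x \<partial>lborel)"
    by (rule iter_int_UNIV) (use k in auto)
  also have "\<dots> = total v" by (rule nn_integral_line_density) (use v in auto)
  finally show ?thesis .
qed

end

section \<open>Hardy's inequality for smooth functions\<close>

lemma borel_measurable_vec_nth_comp [measurable (raw)]:
  fixes f :: "'a \<Rightarrow> real ^ 'n::finite"
  assumes [measurable]: "f \<in> borel_measurable M"
  shows "(\<lambda>x. f x $ k) \<in> borel_measurable M"
proof -
  have "(\<lambda>x. f x \<bullet> axis k 1) \<in> borel_measurable M" by measurable
  then show ?thesis by (simp add: inner_axis)
qed

lemma nn_integral_linear3:
  fixes c1 c2 c3 :: ennreal
  assumes [measurable]: "f1 \<in> borel_measurable M" "f2 \<in> borel_measurable M" "f3 \<in> borel_measurable M"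
  shows "(\<integral>\<^sup>+x. c1 * f1 x + c2 * f2 x + c3 * f3 x \<partial>M)
    = c1 * (\<integral>\<^sup>+x. f1 x \<partial>M) + c2 * (\<integral>\<^sup>+x. f2 x \<partial>M) + c3 * (\<integral>\<^sup>+x. f3 x \<partial>M)"
proof -
  have "(\<integral>\<^sup>+x. (c1 * f1 x + c2 * f2 x) + c3 * f3 x \<partial>M) = (\<integral>\<^sup>+x. c1 * f1 x + c2 * f2 x \<partial>M) + (\<integral>\<^sup>+x. c3 * f3 x \<partial>M)"
    by (rule nn_integral_add) measurable
  also have "(\<integral>\<^sup>+x. c1 * f1 x + c2 * f2 x \<partial>M) = (\<integral>\<^sup>+x. c1 * f1 x \<partial>M) + (\<integral>\<^sup>+x. c2 * f2 x \<partial>M)"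
    by (rule nn_integral_add) measurable
  finally show ?thesis by (simp add: nn_integral_cmult)
qed

lemma set_nn_integral_le_cmult:
  assumes "\<And>x. x \<in> S \<Longrightarrow> f x \<le> c * g x" "0 \<le> c"
    and "(\<lambda>x. ennreal (g x) * indicator S x) \<in> borel_measurable M"
  shows "(\<integral>\<^sup>+x\<in>S. ennreal (f x) \<partial>M) \<le> ennreal c * (\<integral>\<^sup>+x\<in>S. ennreal (g x) \<partial>M)"
proof -
  have "(\<integral>\<^sup>+x\<in>S. ennreal (f x) \<partial>M) \<le> (\<integral>\<^sup>+x. ennreal c * (ennreal (g x) * indicator S x) \<partial>M)"
    using assms(1,2) by (intro nn_integral_mono) (auto intro: ennreal_leI split: split_indicator simp flip: ennreal_mult')
  also have "\<dots> = ennreal c * (\<integral>\<^sup>+x\<in>S. ennreal (g x) \<partial>M)"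
    by (rule nn_integral_cmult[OF assms(3)])
  finally show ?thesis .
qed

lemma set_nn_integral_real_mono:
  assumes "\<And>x. x \<in> S \<Longrightarrow> f x \<le> g x"
  shows "(\<integral>\<^sup>+x\<in>S. ennreal (f x) \<partial>M) \<le> (\<integral>\<^sup>+x\<in>S. ennreal (g x) \<partial>M)"
  using assms by (intro nn_integral_mono) (auto intro: ennreal_leI split: split_indicator)

lemma ennreal_indicator_square: "ennreal ((a * indicator S x)\<^sup>2) = ennreal (a\<^sup>2) * indicator S x"
  by (auto split: split_indicator)

lemma nn_integral_inverse_square:
  fixes a e :: real
  assumes "0 \<le> a" "0 < e"
  shows "(\<integral>\<^sup>+r. ennreal (1 / (r + e)\<^sup>2) * indicator {a..} r \<partial>lborel) = ennreal (1 / (a + e))"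
proof -
  have "(\<integral>\<^sup>+r. ennreal (1 / (r + e)\<^sup>2) * indicator {a..} r \<partial>lborel) = ennreal (0 - (- (1 / (a + e))))"
  proof (rule nn_integral_FTC_atLeast)
    show "DERIV (\<lambda>r. - (1 / (r + e))) r :> 1 / (r + e)\<^sup>2" if "a \<le> r" for r
      using that assms by (auto intro!: derivative_eq_intros simp: power2_eq_square)
    show "((\<lambda>r. - (1 / (r + e))) \<longlongrightarrow> 0) at_top"
      by real_asymp
  qed auto
  then show ?thesis by simp
qed

lemma ennreal_absorb_half:
  fixes X a :: ennreal
  assumes "X \<le> a + X / 2" "X < \<infinity>"
  shows "X \<le> 2 * a"
proof (cases a)
  case (real r)
  obtain y where y: "X = ennreal y" "0 \<le> y" using assms by (cases X) auto
  have "X / 2 = ennreal (y / 2)"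
    using y by (simp add: divide_ennreal flip: ennreal_numeral)
  then have "y \<le> r + y / 2" using assms(1) y real by (simp flip: ennreal_plus)
  then have "y \<le> 2 * r" by simp
  then show ?thesis using y real
    by (simp add: ennreal_leI flip: ennreal_numeral ennreal_mult')
qed (simp add: ennreal_mult_top)

text \<open>The increment of the square of \<open>v\<close> along vertical lines is multiplied by
  the kernel and integrated by Fubini. This produces the product of
  \<open>\<bar>v\<bar> / (x $ k + e)\<close> and the gradient, half of whose bound is absorbed on
  the left. The shift \<open>e\<close> makes both the left-hand side and the boundary term finite in
  total kernel mass.\<close>

lemma hardy_smooth:
  fixes v :: "real ^ 'n::finite \<Rightarrow> real"
  assumes v: "smooth_fun v" and e: "0 < e"
  shows "(\<integral>\<^sup>+x\<in>half_ball k R. ennreal ((v x)\<^sup>2 / (x $ k + e)\<^sup>2) \<partial>lborel)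
    \<le> ennreal (2 / e) * (\<integral>\<^sup>+x\<in>flat_part k R. ennreal ((v x)\<^sup>2) \<partial>hyperplane_measure k) +
      4 * (\<integral>\<^sup>+x\<in>half_ball k R. ennreal ((norm (grad v x))\<^sup>2) \<partial>lborel)"
    (is "?X \<le> ennreal (2 / e) * ?b + 4 * ?D")
proof -
  note [measurable] = smooth_fun_borel[OF v]
  let ?B = "half_ball k R"
  let ?e = "axis k 1 :: real ^ 'n"
  let ?Y = "\<lambda>x. ennreal ((v x)\<^sup>2 / (x $ k + e)\<^sup>2) * indicator ?B x"
  let ?D2 = "\<lambda>x. ennreal ((norm (grad v x))\<^sup>2) * indicator ?B x"
  let ?w = "\<lambda>r. ennreal (1 / (r + e)\<^sup>2) * indicator {0..} r"
  let ?h = "\<lambda>z. ennreal (2 * \<bar>v z\<bar> * norm (grad v z)) * indicator ?B z"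
  let ?\<beta> = "\<lambda>y. ennreal ((v y)\<^sup>2) * indicator (flat_part k R) y"
  have pw: "?Y x
     \<le> ?w (x $ k) * ?\<beta> (x - (x $ k) *\<^sub>R ?e) + (\<integral>\<^sup>+s. ?w (x $ k) * ?h (x + s *\<^sub>R ?e) * indicator {..0} s \<partial>lborel)" for x
  proof (cases "x \<in> ?B")
    case True
    let ?y = "x - (x $ k) *\<^sub>R ?e"
    have xk: "0 < x $ k" and xR: "norm x < R"
      using True by (auto simp: half_ball_def)
    have t: "tilt k (\<lambda>_. 1) k = ?e" by (simp add: tilt_def)
    have mem: "x + s *\<^sub>R ?e \<in> ?B" if "- (x $ k) < s" "s \<le> 0" for s
      using norm_minus_tilt_le[of "\<lambda>_. 1" k k x "- s"] that xR by (auto simp: half_ball_def t)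
    have y: "?y \<in> flat_part k R"
      using norm_minus_tilt_le[of "\<lambda>_. 1" k k x "x $ k"] xk xR by (auto simp: flat_part_def t)
    have "ennreal ((v x)\<^sup>2) \<le> ennreal ((v ?y)\<^sup>2) + ennreal \<bar>(v x)\<^sup>2 - (v ?y)\<^sup>2\<bar>"
      by (simp flip: ennreal_plus add: ennreal_leI)
    also have "ennreal \<bar>(v x)\<^sup>2 - (v ?y)\<^sup>2\<bar> \<le> (\<integral>\<^sup>+s. ennreal (\<bar>2 * v (x + s *\<^sub>R ?e)\<bar> * norm (grad v (x + s *\<^sub>R ?e)) * norm ?e) * indicator {- (x $ k)<..0} s \<partial>lborel)"
      using xk by (intro line_increment_le[where \<Phi>="\<lambda>s. s\<^sup>2" and \<phi>="\<lambda>s. 2 * s"] v)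
        (auto intro!: derivative_eq_intros continuous_intros)
    also have "\<dots> \<le> (\<integral>\<^sup>+s. ?h (x + s *\<^sub>R ?e) * indicator {..0} s \<partial>lborel)"
      using mem by (intro nn_integral_mono) (auto simp: abs_mult split: split_indicator)
    finally have "ennreal ((v x)\<^sup>2) \<le> ?\<beta> ?y + (\<integral>\<^sup>+s. ?h (x + s *\<^sub>R ?e) * indicator {..0} s \<partial>lborel)"
      using y by (simp add: add_left_mono)
    then have "?w (x $ k) * ennreal ((v x)\<^sup>2) \<le> ?w (x $ k) * (?\<beta> ?y + (\<integral>\<^sup>+s. ?h (x + s *\<^sub>R ?e) * indicator {..0} s \<partial>lborel))"
      by (rule mult_left_mono) simp
    also have "\<dots> = ?w (x $ k) * ?\<beta> ?y + (\<integral>\<^sup>+s. ?w (x $ k) * (?h (x + s *\<^sub>R ?e) * indicator {..0} s) \<partial>lborel)"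
      by (subst nn_integral_cmult) (auto simp: distrib_left)
    finally show ?thesis
      using True xk by (simp add: mult.assoc flip: ennreal_mult')
  qed simp
  have "?X \<le> (\<integral>\<^sup>+x. ?w (x $ k) * ?\<beta> (x - (x $ k) *\<^sub>R ?e) +
      (\<integral>\<^sup>+s. ?w (x $ k) * ?h (x + s *\<^sub>R ?e) * indicator {..0} s \<partial>lborel) \<partial>lborel)"
    by (intro nn_integral_mono pw)
  also have "\<dots> = (\<integral>\<^sup>+x. ?w (x $ k) * ?\<beta> (x - (x $ k) *\<^sub>R ?e) \<partial>lborel) +
      (\<integral>\<^sup>+x. (\<integral>\<^sup>+s. ?w (x $ k) * ?h (x + s *\<^sub>R ?e) * indicator {..0} s \<partial>lborel) \<partial>lborel)"
    by (rule nn_integral_add) measurable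
  also have "(\<integral>\<^sup>+x. ?w (x $ k) * ?\<beta> (x - (x $ k) *\<^sub>R ?e) \<partial>lborel) = ennreal (1 / e) * ?b"
    using nn_integral_slab[of ?\<beta> ?w k] nn_integral_inverse_square[of 0 e] e by simp
  also have "(\<integral>\<^sup>+x. (\<integral>\<^sup>+s. ?w (x $ k) * ?h (x + s *\<^sub>R ?e) * indicator {..0} s \<partial>lborel) \<partial>lborel)
    = (\<integral>\<^sup>+s. (\<integral>\<^sup>+x. ?w (x $ k) * ?h (x + s *\<^sub>R ?e) * indicator {..0} s \<partial>lborel) \<partial>lborel)"
    by (rule lborel_pair.Fubini') measurable
  \<comment> \<open>After translating by \<open>s\<close> the gradient factor sits at a fixed point,
    and integrating the kernel over all heights above that point gives
    \<open>1 / (x $ k + e)\<close>.\<close>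
  also have "\<dots> = (\<integral>\<^sup>+s. (\<integral>\<^sup>+x. ?w (x $ k - s) * ?h x * indicator {..0} s \<partial>lborel) \<partial>lborel)"
  proof (rule nn_integral_cong)
    fix s :: real
    show "(\<integral>\<^sup>+x. ?w (x $ k) * ?h (x + s *\<^sub>R ?e) * indicator {..0} s \<partial>lborel) =
        (\<integral>\<^sup>+x. ?w (x $ k - s) * ?h x * indicator {..0} s \<partial>lborel)"
      using nn_integral_lborel_translate[of "\<lambda>x. ?w (x $ k - s) * ?h x * indicator {..0} s" "s *\<^sub>R ?e"]
      by (simp add: add.commute)
  qed
  also have "\<dots> = (\<integral>\<^sup>+x. (\<integral>\<^sup>+s. ?w (x $ k - s) * ?h x * indicator {..0} s \<partial>lborel) \<partial>lborel)"
    by (rule lborel_pair.Fubini'[symmetric]) measurable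
  also have "\<dots> = (\<integral>\<^sup>+x. ennreal (1 / (x $ k + e)) * ?h x \<partial>lborel)"
  proof (rule nn_integral_cong)
    fix x :: "real ^ 'n"
    show "(\<integral>\<^sup>+s. ?w (x $ k - s) * ?h x * indicator {..0} s \<partial>lborel) = ennreal (1 / (x $ k + e)) * ?h x"
    proof (cases "x \<in> ?B")
      case True
      then have xk: "0 < x $ k" by (simp add: half_ball_def)
      let ?f = "\<lambda>r. ennreal (1 / (r + e)\<^sup>2) * indicator {x $ k..} r"
      have "(\<integral>\<^sup>+s. ?w (x $ k - s) * ?h x * indicator {..0} s \<partial>lborel)
          = (\<integral>\<^sup>+s. ?f (x $ k + - 1 * s) * ?h x \<partial>lborel)"
        using xk by (intro nn_integral_cong) (auto split: split_indicator)
      also have "\<dots> = (\<integral>\<^sup>+s. ?f (x $ k + - 1 * s) \<partial>lborel) * ?h x"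
        by (rule nn_integral_multc) measurable
      also have "(\<integral>\<^sup>+s. ?f (x $ k + - 1 * s) \<partial>lborel) = (\<integral>\<^sup>+r. ?f r \<partial>lborel)"
        by (subst (2) nn_integral_real_affine[where c="- 1" and t="x $ k"]) auto
      also have "\<dots> = ennreal (1 / (x $ k + e))"
        using xk e by (intro nn_integral_inverse_square) auto
      finally show ?thesis .
    qed simp
  qed
  also have "\<dots> \<le> (\<integral>\<^sup>+x. ?Y x / 2 + 2 * ?D2 x \<partial>lborel)"
  proof (rule nn_integral_mono)
    fix x :: "real ^ 'n"
    show "ennreal (1 / (x $ k + e)) * ?h x
      \<le> ?Y x / 2 + 2 * ?D2 x"
    proof (cases "x \<in> ?B")
      case True
      then have xk: "0 < x $ k + e" using e by (simp add: half_ball_def)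
      let ?a = "\<bar>v x\<bar> / (x $ k + e)" and ?g = "norm (grad v x)"
      \<comment> \<open>The weights in Young's inequality make the first term exactly half of the
        left-hand side of Hardy's inequality; after absorption the 2 becomes the 4 of the
        claim.\<close>
      have "2 * a * g \<le> a\<^sup>2 / 2 + 2 * g\<^sup>2" for a g :: real
        using zero_le_power2[of "a - 2 * g"] by (simp add: power2_eq_square algebra_simps)
      from this[of ?a ?g] have "2 * ?a * ?g \<le> ?a\<^sup>2 / 2 + 2 * ?g\<^sup>2" .
      then have "(1 / (x $ k + e)) * (2 * \<bar>v x\<bar> * ?g) \<le> ((v x)\<^sup>2 / (x $ k + e)\<^sup>2) / 2 + 2 * ?g\<^sup>2"
        by (simp add: power_divide)
      then show ?thesis using True xk
        by (simp add: divide_ennreal ennreal_leI flip: ennreal_mult' ennreal_numeral ennreal_plus)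
    qed simp
  qed
  also have "\<dots> = ?X / 2 + 2 * ?D"
    by (subst nn_integral_add) (auto simp: nn_integral_cmult nn_integral_divide)
  finally have "?X \<le> (ennreal (1 / e) * ?b + 2 * ?D) + ?X / 2"
    by (simp add: ac_simps add_left_mono)
  \<comment> \<open>Absorption needs a finite left-hand side. Here \<open>v\<close> is bounded on
    the closed ball and the denominator is at least the square of \<open>e\<close>.\<close>
  moreover have "?X < \<infinity>"
  proof -
    have "compact (v ` cball 0 R)"
      by (intro compact_continuous_image continuous_on_subset[OF smooth_fun_continuous[OF v]]) auto
    then obtain M where M: "\<And>x. x \<in> cball 0 R \<Longrightarrow> \<bar>v x\<bar> \<le> M"
      using compact_imp_bounded bounded_iff by (metis imageI real_norm_def)
    have "?X \<le> (\<integral>\<^sup>+x\<in>?B. ennreal (M\<^sup>2 / e\<^sup>2) \<partial>lborel)"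
    proof (rule set_nn_integral_real_mono)
      fix x assume "x \<in> ?B"
      then have x: "x \<in> ball 0 R" "0 < x $ k" by (auto simp: half_ball_def)
      have "(v x)\<^sup>2 \<le> M\<^sup>2" using M[of x] x by (auto simp: abs_le_square_iff[symmetric])
      then show "(v x)\<^sup>2 / (x $ k + e)\<^sup>2 \<le> M\<^sup>2 / e\<^sup>2"
        using x e by (intro frac_le) (auto intro: power_mono)
    qed
    also have "\<dots> < \<infinity>"
      using emeasure_bounded_finite[of ?B] bounded_subset[OF bounded_ball, of ?B 0 R]
      by (subst nn_integral_cmult_indicator) (auto simp: ennreal_mult_less_top half_ball_def)
    finally show ?thesis .
  qed
  ultimately have "?X \<le> 2 * (ennreal (1 / e) * ?b + 2 * ?D)"
    by (rule ennreal_absorb_half)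
  also have "\<dots> = ennreal (2 / e) * ?b + 4 * ?D"
    using e by (simp add: distrib_left mult.assoc[symmetric] flip: ennreal_numeral ennreal_mult')
  finally show ?thesis .
qed

section \<open>Limit theorems for nonnegative integrals\<close>

lemma nn_integral_fatou_le:
  assumes [measurable]: "\<And>j::nat. f j \<in> borel_measurable M"
    and lim: "AE x in M. (\<lambda>j. f j x) \<longlonglongrightarrow> g x"
    and le: "eventually (\<lambda>j. (\<integral>\<^sup>+x. f j x \<partial>M) \<le> c j) sequentially" and c: "c \<longlonglongrightarrow> C"
  shows "(\<integral>\<^sup>+x. g x \<partial>M) \<le> (C :: ennreal)"
proof -
  have "(\<integral>\<^sup>+x. g x \<partial>M) = (\<integral>\<^sup>+x. liminf (\<lambda>j. f j x) \<partial>M)"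
    by (rule nn_integral_cong_AE, use lim in eventually_elim) (simp add: lim_imp_Liminf)
  also have "\<dots> \<le> liminf (\<lambda>j. \<integral>\<^sup>+x. f j x \<partial>M)"
    by (rule nn_integral_liminf) simp
  also have "\<dots> \<le> liminf c" by (rule Liminf_mono) (use le in simp)
  also have "\<dots> = C" using c by (simp add: lim_imp_Liminf)
  finally show ?thesis .
qed

lemma tendsto_zero_of_square:
  fixes y :: "nat \<Rightarrow> ennreal"
  assumes "(\<lambda>j. (y j)\<^sup>2) \<longlonglongrightarrow> 0"
  shows "y \<longlonglongrightarrow> 0"
proof (rule order_tendstoI)
  fix a :: ennreal assume a: "0 < a"
  define b where "b = min a 1"
  have b: "0 < b" "b \<le> a" "b < \<infinity>" using a by (auto simp: b_def min_def intro: le_less_trans)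
  have "eventually (\<lambda>j. (y j)\<^sup>2 < b\<^sup>2) sequentially"
    using b by (intro order_tendstoD[OF assms]) (simp add: zero_less_iff_neq_zero)
  then show "eventually (\<lambda>j. y j < a) sequentially"
  proof eventually_elim
    case (elim j)
    then have "\<not> b \<le> y j" by (metis not_less power_mono zero_le)
    then show ?case using b by simp
  qed
qed simp

lemma Cauchy_Schwarz_ennreal:
  fixes f g :: "'a \<Rightarrow> real"
  assumes [measurable]: "f \<in> borel_measurable M" "g \<in> borel_measurable M"
    and nonneg: "\<And>x. 0 \<le> f x" "\<And>x. 0 \<le> g x"
  shows "(\<integral>\<^sup>+x. ennreal (f x * g x) \<partial>M)\<^sup>2 \<le> (\<integral>\<^sup>+x. ennreal ((f x)\<^sup>2) \<partial>M) * (\<integral>\<^sup>+x. ennreal ((g x)\<^sup>2) \<partial>M)"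
  using Cauchy_Schwarz_nn_integral[of "\<lambda>x. ennreal (f x)" M "\<lambda>x. ennreal (g x)"] nonneg
  by (simp add: ennreal_mult' ennreal_power)

lemma nn_integral_mult_tendsto_zero:
  fixes f g :: "nat \<Rightarrow> 'a \<Rightarrow> real"
  assumes [measurable]: "\<And>j. f j \<in> borel_measurable M" "\<And>j. g j \<in> borel_measurable M"
    and "\<And>j x. 0 \<le> f j x" "\<And>j x. 0 \<le> g j x"
    and f: "(\<lambda>j. \<integral>\<^sup>+x. ennreal ((f j x)\<^sup>2) \<partial>M) \<longlonglongrightarrow> 0"
    and g: "(\<lambda>j. \<integral>\<^sup>+x. ennreal ((g j x)\<^sup>2) \<partial>M) \<longlonglongrightarrow> c" "c < \<infinity>"
  shows "(\<lambda>j. \<integral>\<^sup>+x. ennreal (f j x * g j x) \<partial>M) \<longlonglongrightarrow> 0"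
proof (rule tendsto_zero_of_square, rule tendsto_sandwich)
  show "eventually (\<lambda>j. 0 \<le> (\<integral>\<^sup>+x. ennreal (f j x * g j x) \<partial>M)\<^sup>2) sequentially" by simp
  show "eventually (\<lambda>j. (\<integral>\<^sup>+x. ennreal (f j x * g j x) \<partial>M)\<^sup>2 \<le> (\<integral>\<^sup>+x. ennreal ((f j x)\<^sup>2) \<partial>M) * (\<integral>\<^sup>+x. ennreal ((g j x)\<^sup>2) \<partial>M)) sequentially"
    by (intro always_eventually allI Cauchy_Schwarz_ennreal assms)
  show "(\<lambda>j. (\<integral>\<^sup>+x. ennreal ((f j x)\<^sup>2) \<partial>M) * (\<integral>\<^sup>+x. ennreal ((g j x)\<^sup>2) \<partial>M)) \<longlonglongrightarrow> 0"
    using tendsto_mult_ennreal[OF f g(1)] g(2) by simp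
qed simp

section \<open>Passage to functions with zero trace\<close>

lemma half_ball_lebesgue [measurable]: "half_ball k R \<in> sets lebesgue"
  using half_ball_borel by auto

lemma nn_integral_lebesgue_eq_lborel: "integral\<^sup>N lebesgue f = integral\<^sup>N lborel f"
  by (rule nn_integral_completion)

lemma borel_imp_lebesgue_measurable:
  "f \<in> borel_measurable borel \<Longrightarrow> f \<in> borel_measurable lebesgue"
  by (rule measurable_completion) (simp only: measurable_lborel2)

lemma tendsto_mult_indicator_ennreal:
  fixes f :: "nat \<Rightarrow> real"
  assumes "x \<in> S \<Longrightarrow> f \<longlonglongrightarrow> l"
  shows "(\<lambda>j. ennreal (f j) * indicator S x) \<longlonglongrightarrow> ennreal l * indicator S x"
  using assms by (cases "x \<in> S") (auto intro: tendsto_ennrealI)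

abbreviation half_ball_int :: "'n::finite \<Rightarrow> real \<Rightarrow> (real ^ 'n \<Rightarrow> real) \<Rightarrow> ennreal" where
  "half_ball_int k R f \<equiv> \<integral>\<^sup>+x\<in>half_ball k R. ennreal (f x) \<partial>lebesgue"

text \<open>\<open>u\<close> and \<open>G\<close> are thought of as extended by \<open>0\<close> outside the half ball, which makes them globally
  measurable.\<close>

locale trace_approx =
  fixes k :: "'n::finite" and R :: real and u :: "real ^ 'n \<Rightarrow> real" and G :: "real ^ 'n \<Rightarrow> real ^ 'n"
    and v :: "nat \<Rightarrow> real ^ 'n \<Rightarrow> real"
  assumes u_meas [measurable]: "u \<in> borel_measurable lebesgue"
    and G_meas [measurable]: "G \<in> borel_measurable lebesgue"
    and u_L2: "half_ball_int k R (\<lambda>x. (u x)\<^sup>2) < \<infinity>"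
    and G_L2: "half_ball_int k R (\<lambda>x. (norm (G x))\<^sup>2) < \<infinity>"
    and smooth: "\<And>j. smooth_fun (v j)"
    and v_L2: "(\<lambda>j. half_ball_int k R (\<lambda>x. (v j x - u x)\<^sup>2)) \<longlonglongrightarrow> 0"
    and grad_L2: "(\<lambda>j. half_ball_int k R (\<lambda>x. (norm (grad (v j) x - G x))\<^sup>2)) \<longlonglongrightarrow> 0"
    and flat_L2: "(\<lambda>j. \<integral>\<^sup>+x\<in>flat_part k R. ennreal ((v j x)\<^sup>2) \<partial>hyperplane_measure k) \<longlonglongrightarrow> 0"
    and v_AE: "AE x in lebesgue. x \<in> half_ball k R \<longrightarrow> (\<lambda>j. v j x) \<longlonglongrightarrow> u x"
begin

abbreviation "B \<equiv> half_ball k R"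

abbreviation "B_int \<equiv> half_ball_int k R"

definition energy :: ennreal where
  "energy = B_int (\<lambda>x. (norm (G x))\<^sup>2)"

lemma v_lebesgue [measurable]: "v j \<in> borel_measurable lebesgue"
  and grad_lebesgue [measurable]: "grad (v j) \<in> borel_measurable lebesgue"
  using smooth_fun_borel[OF smooth] by (auto intro: borel_imp_lebesgue_measurable)

lemma nth_lebesgue [measurable]: "(\<lambda>x. x $ k) \<in> borel_measurable (lebesgue :: (real ^ 'n) measure)"
  by (intro borel_imp_lebesgue_measurable) measurable

text \<open>Along the approximating sequence only the value changes and the height
  \<open>x $ k\<close> stays fixed, so continuity in the first argument suffices. This allows
  weights that are singular at height 0.\<close>

lemma fatou_half_ball:
  assumes [measurable]: "F \<in> borel_measurable borel"
    and F: "\<And>y. 0 < y \<Longrightarrow> continuous_on UNIV (\<lambda>s. F (s, y))"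
    and le: "eventually (\<lambda>j. (\<integral>\<^sup>+x\<in>B. ennreal (F (v j x, x $ k)) \<partial>lborel) \<le> c j) sequentially"
    and c: "c \<longlonglongrightarrow> C"
  shows "B_int (\<lambda>x. F (u x, x $ k)) \<le> C"
proof (rule nn_integral_fatou_le[OF _ _ _ c])
  have [measurable]: "(\<lambda>x. F (v j x, x $ k)) \<in> borel_measurable lebesgue" for j
  proof (rule measurable_compose[OF _ assms(1)])
    show "(\<lambda>x. (v j x, x $ k)) \<in> lebesgue \<rightarrow>\<^sub>M borel"
      by (subst borel_prod[symmetric]) measurable
  qed
  show "(\<lambda>x. ennreal (F (v j x, x $ k)) * indicator B x) \<in> borel_measurable lebesgue" for j
    by measurable
  show "AE x in lebesgue. (\<lambda>j. ennreal (F (v j x, x $ k)) * indicator B x)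
      \<longlonglongrightarrow> ennreal (F (u x, x $ k)) * indicator B x"
    using v_AE
  proof eventually_elim
    case (elim x)
    show ?case
    proof (rule tendsto_mult_indicator_ennreal)
      assume x: "x \<in> B"
      then have "isCont (\<lambda>s. F (s, x $ k)) (u x)"
        using F by (simp add: continuous_on_eq_continuous_at half_ball_def)
      then show "(\<lambda>j. F (v j x, x $ k)) \<longlonglongrightarrow> F (u x, x $ k)"
        using isCont_tendsto_compose elim x by fastforce
    qed
  qed
  show "eventually (\<lambda>j. B_int (\<lambda>x. F (v j x, x $ k)) \<le> c j) sequentially"
    using le by (simp add: nn_integral_lebesgue_eq_lborel)
qed

text \<open>A crude bound, without convergence of norms; its factor 2 turns the 4 of Hardy's
  inequality for smooth functions into 8.\<close>

lemma energy_v_le: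
  "(\<integral>\<^sup>+x\<in>B. ennreal ((norm (grad (v j) x))\<^sup>2) \<partial>lborel)
    \<le> 2 * energy + 2 * B_int (\<lambda>x. (norm (grad (v j) x - G x))\<^sup>2)"
proof -
  have pw: "(norm a)\<^sup>2 \<le> 2 * (norm b)\<^sup>2 + 2 * (norm (a - b))\<^sup>2" for a b :: "real ^ 'n"
  proof -
    have "norm a \<le> norm b + norm (a - b)" using norm_triangle_ineq[of b "a - b"] by simp
    then have "(norm a)\<^sup>2 \<le> (norm b + norm (a - b))\<^sup>2" by (intro power_mono) auto
    also have "\<dots> \<le> 2 * (norm b)\<^sup>2 + 2 * (norm (a - b))\<^sup>2"
      using zero_le_power2[of "norm b - norm (a - b)"] by (simp add: power2_eq_square algebra_simps)
    finally show ?thesis .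
  qed
  have "B_int (\<lambda>x. (norm (grad (v j) x))\<^sup>2)
    \<le> (\<integral>\<^sup>+x. 2 * (ennreal ((norm (G x))\<^sup>2) * indicator B x)
        + 2 * (ennreal ((norm (grad (v j) x - G x))\<^sup>2) * indicator B x) \<partial>lebesgue)"
    (is "(\<integral>\<^sup>+x. ?l x \<partial>_) \<le> (\<integral>\<^sup>+x. ?r x \<partial>_)")
  proof (rule nn_integral_mono)
    fix x :: "real ^ 'n"
    show "?l x \<le> ?r x"
      using ennreal_leI[OF pw[of "grad (v j) x" "G x"]]
      by (auto split: split_indicator simp: ennreal_mult')
  qed
  also have "\<dots> = 2 * energy + 2 * B_int (\<lambda>x. (norm (grad (v j) x - G x))\<^sup>2)"
    unfolding energy_def by (subst nn_integral_add) (auto simp: nn_integral_cmult)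
  finally show ?thesis by (simp add: nn_integral_lebesgue_eq_lborel)
qed

text \<open>For fixed \<open>e\<close> the boundary term, although multiplied by
  \<open>2 / e\<close>, tends to 0 along the sequence; hence this limit is taken before
  \<open>e\<close> tends to 0.\<close>

lemma hardy_shifted:
  assumes e: "0 < e"
  shows "B_int (\<lambda>x. (u x)\<^sup>2 / (x $ k + e)\<^sup>2) \<le> 8 * energy"
proof -
  let ?b = "\<lambda>j. \<integral>\<^sup>+x\<in>flat_part k R. ennreal ((v j x)\<^sup>2) \<partial>hyperplane_measure k"
  let ?d = "\<lambda>j. B_int (\<lambda>x. (norm (grad (v j) x - G x))\<^sup>2)"
  let ?F = "\<lambda>(s, y). s\<^sup>2 / (y + e)\<^sup>2 :: real"
  have "B_int (\<lambda>x. ?F (u x, x $ k)) \<le> ennreal (2 / e) * 0 + 4 * (2 * energy + 2 * 0)"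
  proof (rule fatou_half_ball)
    show "?F \<in> borel_measurable borel"
      unfolding borel_prod[symmetric] case_prod_beta by measurable
    show "continuous_on UNIV (\<lambda>s. ?F (s, y))" if "0 < y" for y
      using that e by (auto intro!: continuous_intros)
    show "(\<lambda>j. ennreal (2 / e) * ?b j + 4 * (2 * energy + 2 * ?d j))
        \<longlonglongrightarrow> ennreal (2 / e) * 0 + 4 * (2 * energy + 2 * 0)"
      by (intro tendsto_add ennreal_tendsto_cmult tendsto_const flat_L2 grad_L2) auto
    show "\<forall>\<^sub>F j in sequentially. (\<integral>\<^sup>+x\<in>B. ennreal (?F (v j x, x $ k)) \<partial>lborel)
        \<le> ennreal (2 / e) * ?b j + 4 * (2 * energy + 2 * ?d j)"
    proof (rule always_eventually, rule allI)
      fix j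
      have "(\<integral>\<^sup>+x\<in>B. ennreal (?F (v j x, x $ k)) \<partial>lborel) \<le> ennreal (2 / e) * ?b j +
        4 * (\<integral>\<^sup>+x\<in>B. ennreal ((norm (grad (v j) x))\<^sup>2) \<partial>lborel)"
        using hardy_smooth[OF smooth e] by simp
      also have "\<dots> \<le> ennreal (2 / e) * ?b j + 4 * (2 * energy + 2 * ?d j)"
        by (intro add_left_mono mult_left_mono energy_v_le) simp
      finally show "(\<integral>\<^sup>+x\<in>B. ennreal (?F (v j x, x $ k)) \<partial>lborel) \<le> ennreal (2 / e) * ?b j + 4 * (2 * energy + 2 * ?d j)" .
    qed
  qed
  also have "\<dots> = 8 * energy" by (simp add: mult.assoc[symmetric])
  finally show ?thesis by simp
qed

text \<open>The second limit, with shifts \<open>1 / (j + 1)\<close>. Points of the half ball have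
  positive height, so no continuity of the weight at 0 is required.\<close>

lemma shift_limit:
  assumes le: "\<And>e. 0 < e \<Longrightarrow> B_int (\<lambda>x. h x (x $ k + e)) \<le> C"
    and meas: "\<And>e. (\<lambda>x. h x (x $ k + e)) \<in> borel_measurable lebesgue"
    and cont: "\<And>x y. 0 < y \<Longrightarrow> isCont (h x) y"
  shows "B_int (\<lambda>x. h x (x $ k)) \<le> C"
proof (rule nn_integral_fatou_le)
  let ?e = "\<lambda>j. inverse (real (Suc j))"
  note [measurable] = meas
  show "(\<lambda>x. ennreal (h x (x $ k + ?e j)) * indicator B x) \<in> borel_measurable lebesgue" for j
    by measurable
  show "AE x in lebesgue. (\<lambda>j. ennreal (h x (x $ k + ?e j)) * indicator B x) \<longlonglongrightarrow> ennreal (h x (x $ k)) * indicator B x"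
  proof (intro AE_I2 tendsto_mult_indicator_ennreal)
    fix x assume "x \<in> B"
    then have "isCont (h x) (x $ k + 0)" using cont by (simp add: half_ball_def)
    moreover have "(\<lambda>j. x $ k + ?e j) \<longlonglongrightarrow> x $ k + 0"
      by (intro tendsto_intros LIMSEQ_inverse_real_of_nat)
    ultimately have "(\<lambda>j. h x (x $ k + ?e j)) \<longlonglongrightarrow> h x (x $ k + 0)"
      by (rule isCont_tendsto_compose)
    then show "(\<lambda>j. h x (x $ k + ?e j)) \<longlonglongrightarrow> h x (x $ k)" by simp
  qed
  show "\<forall>\<^sub>F j in sequentially. B_int (\<lambda>x. h x (x $ k + ?e j)) \<le> C"
    by (intro always_eventually allI le) simp
qed simp

lemma hardy: "B_int (\<lambda>x. (u x)\<^sup>2 / (x $ k)\<^sup>2) \<le> 8 * energy"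
  by (rule shift_limit[where h="\<lambda>x y. (u x)\<^sup>2 / y\<^sup>2"]) (auto intro: hardy_shifted)

end

text \<open>The Lipschitz bound on \<open>\<phi>\<close> and the quadratic bound on
  \<open>\<Phi>\<close> are what mean square convergence in the half ball and on the flat part can
  control.\<close>

locale gagliardo_limit = trace_approx k R u G v + gagliardo_data k R \<Phi> \<phi> \<omega>
  for k :: "'n::finite" and R u G v \<Phi> \<phi> \<omega> +
  fixes L :: real
  assumes \<phi>_lip: "\<And>a b. \<bar>\<phi> a - \<phi> b\<bar> \<le> L * \<bar>a - b\<bar>"
    and \<phi>_zero: "\<phi> 0 = 0" and \<Phi>_le: "\<And>s. \<Phi> s \<le> L * s\<^sup>2"
begin

text \<open>The counterpart of \<open>total\<close> for the limit function; the boundary summand is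
  absent because the trace is zero.\<close>

definition limit_total :: ennreal where
  "limit_total = B_int (\<lambda>x. 2 * \<bar>\<phi> (u x)\<bar> * norm (G x) * \<omega> (x $ k))"

lemma L_nonneg: "0 \<le> L"
  using \<phi>_lip[of 1 0] by simp

lemma \<phi>_le: "\<bar>\<phi> s\<bar> \<le> L * \<bar>s\<bar>"
  using \<phi>_lip[of s 0] by (simp add: \<phi>_zero)

lemma \<omega>_le: "0 \<le> s \<Longrightarrow> \<omega> s \<le> \<omega> 0"
  by (rule \<omega>_antimono) auto

lemma limit_total_finite: "limit_total < \<infinity>"
proof -
  have "limit_total \<le> (\<integral>\<^sup>+x. ennreal (L * \<omega> 0) * (ennreal ((u x)\<^sup>2) * indicator B x) +
      ennreal (L * \<omega> 0) * (ennreal ((norm (G x))\<^sup>2) * indicator B x) \<partial>lebesgue)"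
    unfolding limit_total_def
  proof (rule nn_integral_mono)
    fix x :: "real ^ 'n"
    show "ennreal (2 * \<bar>\<phi> (u x)\<bar> * norm (G x) * \<omega> (x $ k)) * indicator B x
      \<le> ennreal (L * \<omega> 0) * (ennreal ((u x)\<^sup>2) * indicator B x) +
      ennreal (L * \<omega> 0) * (ennreal ((norm (G x))\<^sup>2) * indicator B x)"
    proof (cases "x \<in> B")
      case True
      then have "0 \<le> x $ k" by (simp add: half_ball_def)
      then have "(2 * \<bar>\<phi> (u x)\<bar> * norm (G x)) * \<omega> (x $ k) \<le> (2 * (L * \<bar>u x\<bar>) * norm (G x)) * \<omega> 0"
        using \<phi>_le \<omega>_le \<omega>_nonneg L_nonneg by (intro mult_mono mult_nonneg_nonneg) auto
      also have "\<dots> = (L * \<omega> 0) * (2 * \<bar>u x\<bar> * norm (G x))" by simp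
      also have "\<dots> \<le> (L * \<omega> 0) * ((u x)\<^sup>2 + (norm (G x))\<^sup>2)"
        using sum_squares_bound[of "\<bar>u x\<bar>" "norm (G x)"] L_nonneg \<omega>_nonneg by (intro mult_left_mono) auto
      finally show ?thesis
        using True L_nonneg \<omega>_nonneg by (simp add: distrib_left ennreal_leI flip: ennreal_mult' ennreal_plus)
    qed simp
  qed
  also have "\<dots> < \<infinity>"
    using u_L2 G_L2 by (subst nn_integral_add) (auto simp: nn_integral_cmult ennreal_mult_less_top)
  finally show ?thesis .
qed

lemma total_le_limit:
  obtains e where "e \<longlonglongrightarrow> 0" "\<And>j. total (v j) \<le> limit_total + e j"
proof
  let ?dv = "\<lambda>j x. \<bar>v j x - u x\<bar> * indicator B x" and ?dg = "\<lambda>j x. norm (grad (v j) x - G x) * indicator B x"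
  let ?u = "\<lambda>j x. \<bar>u x\<bar> * indicator B x" and ?G = "\<lambda>j x. norm (G x) * indicator B x"
  let ?W = "2 * L * \<omega> 0"
  \<comment> \<open>The product of
    \<open>\<bar>\<phi> (u x)\<bar> + L * \<bar>v j x - u x\<bar>\<close> with
    \<open>norm (G x) + norm (grad (v j) x - G x)\<close> has a main term and three mixed terms. The
    latter are \<open>e1\<close>, \<open>e2\<close>, \<open>e3\<close>, and each contains a factor
    tending to 0 in mean square.\<close>
  define e1 where "e1 j = (\<integral>\<^sup>+x. ennreal (?dv j x * ?G j x) \<partial>lebesgue)" for j
  define e2 where "e2 j = (\<integral>\<^sup>+x. ennreal (?dv j x * ?dg j x) \<partial>lebesgue)" for j
  define e3 where "e3 j = (\<integral>\<^sup>+x. ennreal (?dg j x * ?u j x) \<partial>lebesgue)" for j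
  define b where "b j = (\<integral>\<^sup>+x\<in>flat_part k R. ennreal ((v j x)\<^sup>2) \<partial>hyperplane_measure k)" for j
  let ?e = "\<lambda>j. ennreal ?W * (e1 j + e2 j + e3 j) + ennreal (L * \<omega> 0) * b j"
  have dv: "(\<lambda>j. \<integral>\<^sup>+x. ennreal ((?dv j x)\<^sup>2) \<partial>lebesgue) \<longlonglongrightarrow> 0" using v_L2 by (simp add: ennreal_indicator_square)
  have dg: "(\<lambda>j. \<integral>\<^sup>+x. ennreal ((?dg j x)\<^sup>2) \<partial>lebesgue) \<longlonglongrightarrow> 0" using grad_L2 by (simp add: ennreal_indicator_square)
  have uu: "(\<lambda>j. \<integral>\<^sup>+x. ennreal ((?u j x)\<^sup>2) \<partial>lebesgue) \<longlonglongrightarrow> B_int (\<lambda>x. (u x)\<^sup>2)"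
    by (simp add: ennreal_indicator_square)
  have GG: "(\<lambda>j. \<integral>\<^sup>+x. ennreal ((?G j x)\<^sup>2) \<partial>lebesgue) \<longlonglongrightarrow> B_int (\<lambda>x. (norm (G x))\<^sup>2)"
    by (simp add: ennreal_indicator_square)
  have "e1 \<longlonglongrightarrow> 0" unfolding e1_def
    by (rule nn_integral_mult_tendsto_zero[OF _ _ _ _ dv GG G_L2]) auto
  moreover have "e2 \<longlonglongrightarrow> 0" unfolding e2_def
    by (rule nn_integral_mult_tendsto_zero[OF _ _ _ _ dv dg]) auto
  moreover have "e3 \<longlonglongrightarrow> 0" unfolding e3_def
    by (rule nn_integral_mult_tendsto_zero[OF _ _ _ _ dg uu u_L2]) auto
  moreover have "b \<longlonglongrightarrow> 0" unfolding b_def by (rule flat_L2)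
  ultimately have "?e \<longlonglongrightarrow> ennreal ?W * (0 + 0 + 0) + ennreal (L * \<omega> 0) * 0"
    by (intro tendsto_add ennreal_tendsto_cmult) auto
  then show "?e \<longlonglongrightarrow> 0" by simp
  fix j
  note [measurable] = smooth_fun_borel[OF smooth]
  have flat: "(\<integral>\<^sup>+x\<in>flat_part k R. ennreal (\<omega> 0 * \<Phi> (v j x)) \<partial>hyperplane_measure k) \<le> ennreal (L * \<omega> 0) * b j"
  proof -
    have "(\<lambda>x. ennreal ((v j x)\<^sup>2) * indicator (flat_part k R) x) \<in> borel_measurable (hyperplane_measure k)"
      unfolding hyperplane_measure_def by (intro measurable_completion) measurable
    moreover have "\<omega> 0 * \<Phi> (v j x) \<le> (L * \<omega> 0) * (v j x)\<^sup>2" for x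
      using mult_left_mono[OF \<Phi>_le[of "v j x"] \<omega>_nonneg[of 0]] by (simp add: ac_simps)
    ultimately show ?thesis
      unfolding b_def using L_nonneg \<omega>_nonneg by (intro set_nn_integral_le_cmult) auto
  qed
  have "B_int (\<lambda>x. 2 * \<bar>\<phi> (v j x)\<bar> * norm (grad (v j) x) * \<omega> (x $ k))
    \<le> (\<integral>\<^sup>+x. ennreal (2 * \<bar>\<phi> (u x)\<bar> * norm (G x) * \<omega> (x $ k)) * indicator B x +
         ennreal ?W * (ennreal (?dv j x * ?G j x) + ennreal (?dv j x * ?dg j x) + ennreal (?dg j x * ?u j x)) \<partial>lebesgue)"
    (is "(\<integral>\<^sup>+x. ?l x \<partial>_) \<le> (\<integral>\<^sup>+x. ?r x \<partial>_)")
  proof (rule nn_integral_mono)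
    fix x :: "real ^ 'n"
    show "?l x \<le> ?r x"
    proof (cases "x \<in> B")
      case True
      then have xk: "0 \<le> x $ k" by (simp add: half_ball_def)
      define a b g h d where "a = \<bar>\<phi> (v j x)\<bar>" and "b = \<bar>\<phi> (u x)\<bar>" and "g = norm (grad (v j) x)"
        and "h = norm (G x)" and "d = norm (grad (v j) x - G x)"
      define r where "r = \<bar>v j x - u x\<bar>"
      have a: "a \<le> b + L * r" using \<phi>_lip[of "v j x" "u x"] by (simp add: a_def b_def r_def)
      have g: "g \<le> h + d" using norm_triangle_ineq[of "G x" "grad (v j) x - G x"] by (simp add: g_def h_def d_def)
      have bu: "b \<le> L * \<bar>u x\<bar>" using \<phi>_le by (simp add: b_def)
      have pos: "0 \<le> a" "0 \<le> b" "0 \<le> g" "0 \<le> h" "0 \<le> d" "0 \<le> r"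
        by (simp_all add: a_def b_def g_def h_def d_def r_def)
      have "a * g \<le> (b + L * r) * (h + d)"
        using a g pos L_nonneg by (intro mult_mono) auto
      also have "\<dots> \<le> b * h + L * (r * h + r * d + d * \<bar>u x\<bar>)"
        using mult_right_mono[OF bu, of d] pos by (simp add: algebra_simps)
      finally have "2 * (a * g) * \<omega> (x $ k) \<le> 2 * (b * h + L * (r * h + r * d + d * \<bar>u x\<bar>)) * \<omega> (x $ k)"
        by (intro mult_right_mono \<omega>_nonneg) auto
      also have "\<dots> = 2 * b * h * \<omega> (x $ k) + (2 * L * (r * h + r * d + d * \<bar>u x\<bar>)) * \<omega> (x $ k)"
        by (simp add: algebra_simps)
      also have "\<dots> \<le> 2 * b * h * \<omega> (x $ k) + (2 * L * (r * h + r * d + d * \<bar>u x\<bar>)) * \<omega> 0"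
        using pos L_nonneg xk \<omega>_le by (intro add_left_mono mult_left_mono) auto
      finally have "2 * a * g * \<omega> (x $ k) \<le> 2 * b * h * \<omega> (x $ k) + ?W * (r * h + r * d + d * \<bar>u x\<bar>)"
        by (simp add: ac_simps)
      then have "ennreal (2 * a * g * \<omega> (x $ k)) \<le> ennreal (2 * b * h * \<omega> (x $ k)) +
         ennreal ?W * (ennreal (r * h) + ennreal (r * d) + ennreal (d * \<bar>u x\<bar>))"
        using pos L_nonneg \<omega>_nonneg by (simp add: ennreal_leI flip: ennreal_mult' ennreal_plus)
      then show ?thesis using True by (simp add: a_def b_def g_def h_def d_def r_def)
    qed simp
  qed
  also have "\<dots> = limit_total + ennreal ?W * (e1 j + e2 j + e3 j)"
  proof -
    have "(\<integral>\<^sup>+x. f x + c * (f1 x + f2 x + f3 x) \<partial>lebesgue)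
      = (\<integral>\<^sup>+x. f x \<partial>lebesgue) + c * ((\<integral>\<^sup>+x. f1 x \<partial>lebesgue) + (\<integral>\<^sup>+x. f2 x \<partial>lebesgue) + (\<integral>\<^sup>+x. f3 x \<partial>lebesgue))"
      if [measurable]: "f \<in> borel_measurable lebesgue" "f1 \<in> borel_measurable lebesgue"
        "f2 \<in> borel_measurable lebesgue" "f3 \<in> borel_measurable lebesgue"
      for f f1 f2 f3 :: "real ^ 'n \<Rightarrow> ennreal" and c
    proof -
      have "(\<integral>\<^sup>+x. f x + c * (f1 x + f2 x + f3 x) \<partial>lebesgue)
        = (\<integral>\<^sup>+x. f x \<partial>lebesgue) + (\<integral>\<^sup>+x. c * (f1 x + f2 x + f3 x) \<partial>lebesgue)"
        by (rule nn_integral_add) measurable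
      then show ?thesis
        using nn_integral_linear3[of f1 lebesgue f2 f3 c c c] that by (simp add: distrib_left)
    qed
    then show ?thesis
      unfolding limit_total_def e1_def e2_def e3_def by this measurable
  qed
  finally have "(\<integral>\<^sup>+x\<in>B. ennreal (2 * \<bar>\<phi> (v j x)\<bar> * norm (grad (v j) x) * \<omega> (x $ k)) \<partial>lborel)
    \<le> limit_total + ennreal ?W * (e1 j + e2 j + e3 j)"
    by (simp add: nn_integral_lebesgue_eq_lborel)
  with flat show "total (v j) \<le> limit_total + ?e j"
    unfolding total_def by (simp add: add.assoc[symmetric] add_mono)
qed

lemma \<omega>_nth_lebesgue [measurable]: "(\<lambda>x. \<omega> (x $ k)) \<in> borel_measurable (lebesgue :: (real ^ 'n) measure)"
  by (intro measurable_compose[OF nth_lebesgue \<omega>_borel])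

lemma gagliardo:
  assumes n: "2 \<le> CARD('n)"
  shows "B_int (\<lambda>x. (\<Phi> (u x) * \<omega> (x $ k)) powr (real CARD('n) / (real CARD('n) - 1)))
    \<le> ennreal (2 ^ CARD('n) * enn2real limit_total powr (real CARD('n) / (real CARD('n) - 1)))"
proof -
  let ?q = "real CARD('n) / (real CARD('n) - 1)"
  have q: "0 < ?q" using n by simp
  let ?F = "\<lambda>(s, y). (\<Phi> s * \<omega> y) powr ?q"
  obtain e where e: "e \<longlonglongrightarrow> 0" "\<And>j. total (v j) \<le> limit_total + e j"
    using total_le_limit by blast
  have lim: "(\<lambda>j. limit_total + e j) \<longlonglongrightarrow> limit_total + 0"
    by (intro tendsto_intros e)
  \<comment> \<open>Only eventually is the bound finite, and only then does \<open>enn2real\<close>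
    lose nothing.\<close>
  have fin: "eventually (\<lambda>j. limit_total + e j < \<infinity>) sequentially"
    using order_tendstoD(2)[OF lim, of \<infinity>] limit_total_finite by simp
  have "B_int (\<lambda>x. ?F (u x, x $ k)) \<le> ennreal (2 ^ CARD('n) * enn2real limit_total powr ?q)"
  proof (rule fatou_half_ball)
    show "?F \<in> borel_measurable borel"
      unfolding borel_prod[symmetric] case_prod_beta by measurable
    show "continuous_on UNIV (\<lambda>s. ?F (s, y))" if "0 < y" for y
    proof -
      have "continuous_on UNIV \<Phi>"
        using \<Phi>_deriv by (meson DERIV_isCont continuous_at_imp_continuous_on)
      then have "continuous_on UNIV (\<lambda>s. \<Phi> s * \<omega> y)" by (intro continuous_intros)
      then have "continuous_on UNIV (\<lambda>s. (\<Phi> s * \<omega> y) powr ?q)"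
        by (rule continuous_on_powr') (use q in \<open>auto simp: \<Phi>_nonneg \<omega>_nonneg\<close>)
      then show ?thesis by simp
    qed
    show "\<forall>\<^sub>F j in sequentially. (\<integral>\<^sup>+x\<in>B. ennreal (?F (v j x, x $ k)) \<partial>lborel)
      \<le> ennreal (2 ^ CARD('n) * enn2real (limit_total + e j) powr ?q)"
      using fin
    proof eventually_elim
      case (elim j)
      then have "total (v j) \<le> ennreal (enn2real (limit_total + e j))" using e(2) by simp
      then show ?case using gagliardo_smooth[OF n smooth] by simp
    qed
    show "(\<lambda>j. ennreal (2 ^ CARD('n) * enn2real (limit_total + e j) powr ?q))
      \<longlonglongrightarrow> ennreal (2 ^ CARD('n) * enn2real limit_total powr ?q)"
    proof -
      have "(\<lambda>j. enn2real (limit_total + e j)) \<longlonglongrightarrow> enn2real limit_total"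
        using lim limit_total_finite by (intro tendsto_enn2real) auto
      then show ?thesis
        using q by (intro tendsto_ennrealI tendsto_mult tendsto_const tendsto_powr') auto
    qed
  qed
  then show ?thesis by simp
qed

lemma one_dim:
  assumes n: "CARD('n) = 1"
  shows "AE x in lebesgue. x \<in> B \<longrightarrow> ennreal (\<Phi> (u x) * \<omega> (x $ k)) \<le> limit_total"
  using v_AE
proof eventually_elim
  case (elim x)
  obtain e where e: "e \<longlonglongrightarrow> 0" "\<And>j. total (v j) \<le> limit_total + e j"
    using total_le_limit by blast
  have lim: "(\<lambda>j. limit_total + e j) \<longlonglongrightarrow> limit_total + 0"
    by (intro tendsto_intros e)
  show ?case
  proof
    assume x: "x \<in> B"
    have "isCont \<Phi> (u x)" using \<Phi>_deriv DERIV_isCont by blast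
    then have "(\<lambda>j. ennreal (\<Phi> (v j x) * \<omega> (x $ k))) \<longlonglongrightarrow> ennreal (\<Phi> (u x) * \<omega> (x $ k))"
      using elim x by (intro tendsto_ennrealI tendsto_mult tendsto_const) (auto intro: isCont_tendsto_compose)
    then have "ennreal (\<Phi> (u x) * \<omega> (x $ k)) \<le> limit_total + 0"
      by (rule LIMSEQ_le[OF _ lim]) (use one_dim_smooth[OF n smooth x] e(2) order_trans in blast)
    then show "ennreal (\<Phi> (u x) * \<omega> (x $ k)) \<le> limit_total" by simp
  qed
qed

end

section \<open>Estimates on time slices\<close>

lemma powr_tangent_le:
  fixes x y e :: real
  assumes "1 \<le> e" "0 \<le> x" "0 \<le> y"
  shows "y powr e + e * y powr (e - 1) * (x - y) \<le> x powr e"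
proof (cases "y = 0 \<or> x = 0")
  case True
  show ?thesis
  proof (cases "y = 0")
    case False
    then have y: "0 < y" "x = 0" using True assms by auto
    then have "y powr (e - 1) * y = y powr e" by (simp add: powr_diff)
    then have "y powr e + e * y powr (e - 1) * (x - y) = (1 - e) * y powr e"
      using y by (simp add: algebra_simps)
    also have "\<dots> \<le> 0" using assms by (intro mult_nonpos_nonneg) auto
    finally show ?thesis using y by simp
  qed simp
next
  case False
  then have pos: "0 < x" "0 < y" using assms by auto
  have "x powr e - y powr e \<ge> e * y powr (e - 1) * (x - y)"
    by (rule convex_on_imp_above_tangent[where A="{0<..}"])
      (use pos assms in \<open>auto intro!: powr_convex derivative_eq_intros simp: interior_open\<close>)
  then show ?thesis by simp
qed

text \<open>With \<open>m\<close> the weighted mean, the bound of \<open>ln t\<close> by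
  \<open>t - 1\<close> is applied to the ratios of \<open>x\<close>, \<open>y\<close>,
  \<open>z\<close> to \<open>m\<close>; the weighted right-hand sides add up to 0.\<close>

lemma weighted_arith_geom_mean3:
  fixes x y z a b c :: real
  assumes "0 \<le> x" "0 \<le> y" "0 \<le> z" "0 < a" "0 < b" "0 < c" "a + b + c = 1"
  shows "x powr a * y powr b * z powr c \<le> a * x + b * y + c * z"
proof (cases "x = 0 \<or> y = 0 \<or> z = 0")
  case True
  then show ?thesis using assms by auto
next
  case False
  then have pos: "0 < x" "0 < y" "0 < z" using assms by auto
  define m where "m = a * x + b * y + c * z"
  have m: "0 < m" using pos assms by (simp add: m_def add_pos_pos)
  have "a * ln (x / m) + b * ln (y / m) + c * ln (z / m) \<le> a * (x / m - 1) + b * (y / m - 1) + c * (z / m - 1)"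
    using pos m assms by (intro add_mono mult_left_mono ln_le_minus_one) auto
  also have "\<dots> = (a * x + b * y + c * z) / m - (a + b + c)"
    by (simp add: add_divide_distrib algebra_simps)
  also have "\<dots> = 0" using m assms by (simp add: m_def[symmetric])
  finally have "a * ln x + b * ln y + c * ln z \<le> (a + b + c) * ln m"
    using pos m by (simp add: ln_div algebra_simps)
  then have "a * ln x + b * ln y + c * ln z \<le> ln m"
    using assms(7) by simp
  then have "exp (a * ln x + b * ln y + c * ln z) \<le> exp (ln m)"
    by (simp only: exp_le_cancel_iff)
  then have "exp (a * ln x + b * ln y + c * ln z) \<le> m"
    using m by simp
  then show ?thesis using pos by (simp add: powr_def exp_add m_def)
qed

text \<open>The weighted mean inequality is applied to \<open>f / A\<close>, \<open>g / B\<close>,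
  \<open>h / C\<close>. Upper bounds stand in place of the integrals themselves; if one of them is
  0, a factor vanishes almost everywhere and so does the left-hand side.\<close>

lemma hoelder3:
  fixes f g h F :: "'a \<Rightarrow> real" and A B C :: real
  assumes [measurable]: "f \<in> borel_measurable M" "g \<in> borel_measurable M" "h \<in> borel_measurable M"
    and nonneg: "\<And>x. 0 \<le> f x" "\<And>x. 0 \<le> g x" "\<And>x. 0 \<le> h x"
    and F: "\<And>x. F x \<le> f x powr a * g x powr b * h x powr c"
    and abc: "0 < a" "0 < b" "0 < c" "a + b + c = 1"
    and A: "(\<integral>\<^sup>+x. ennreal (f x) \<partial>M) \<le> ennreal A" "0 \<le> A"
    and B: "(\<integral>\<^sup>+x. ennreal (g x) \<partial>M) \<le> ennreal B" "0 \<le> B"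
    and C: "(\<integral>\<^sup>+x. ennreal (h x) \<partial>M) \<le> ennreal C" "0 \<le> C"
  shows "(\<integral>\<^sup>+x. ennreal (F x) \<partial>M) \<le> ennreal (A powr a * B powr b * C powr c)"
proof (cases "A = 0 \<or> B = 0 \<or> C = 0")
  case True
  have zero: "AE x in M. y x = 0" if "(\<integral>\<^sup>+x. ennreal (y x) \<partial>M) \<le> ennreal 0" "\<And>x. 0 \<le> y x"
    "y \<in> borel_measurable M" for y :: "'a \<Rightarrow> real"
  proof -
    have "AE x in M. ennreal (y x) = 0"
      using that by (subst nn_integral_0_iff_AE[symmetric]) auto
    then show ?thesis by eventually_elim (use that(2) in \<open>auto simp: ennreal_eq_0_iff antisym\<close>)
  qed
  have "(AE x in M. f x = 0) \<or> (AE x in M. g x = 0) \<or> (AE x in M. h x = 0)"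
    using True zero[of f] zero[of g] zero[of h] A B C nonneg assms(1-3) by auto
  then have "AE x in M. f x = 0 \<or> g x = 0 \<or> h x = 0" by (auto elim: eventually_mono)
  then have "AE x in M. ennreal (F x) \<le> 0"
  proof eventually_elim
    case (elim x)
    then have "F x \<le> 0" using F[of x] by auto
    then show ?case by (simp add: ennreal_neg)
  qed
  then have "(\<integral>\<^sup>+x. ennreal (F x) \<partial>M) \<le> (\<integral>\<^sup>+x. 0 \<partial>M)" by (rule nn_integral_mono_AE)
  then show ?thesis by simp
next
  case False
  then have pos: "0 < A" "0 < B" "0 < C" using A B C by auto
  define P where "P = A powr a * B powr b * C powr c"
  have P: "0 < P" using pos by (simp add: P_def)
  have "(\<integral>\<^sup>+x. ennreal (F x) \<partial>M) \<le> (\<integral>\<^sup>+x. ennreal (P * a / A) * ennreal (f x) + ennreal (P * b / B) * ennreal (g x) + ennreal (P * c / C) * ennreal (h x) \<partial>M)"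
    (is "_ \<le> (\<integral>\<^sup>+x. ?r x \<partial>_)")
  proof (rule nn_integral_mono)
    fix x
    have "f x powr a * g x powr b * h x powr c = P * ((f x / A) powr a * (g x / B) powr b * (h x / C) powr c)"
      using pos nonneg by (simp add: P_def powr_divide)
    also have "\<dots> \<le> P * (a * (f x / A) + b * (g x / B) + c * (h x / C))"
      using pos nonneg abc P by (intro mult_left_mono weighted_arith_geom_mean3) auto
    also have "\<dots> = P * a / A * f x + P * b / B * g x + P * c / C * h x"
      by (simp add: algebra_simps)
    finally have "F x \<le> P * a / A * f x + P * b / B * g x + P * c / C * h x"
      using F[of x] by simp
    then show "ennreal (F x) \<le> ?r x"
      using pos nonneg abc P by (simp add: ennreal_leI flip: ennreal_mult ennreal_plus)
  qed
  also have "\<dots> = ennreal (P * a / A) * (\<integral>\<^sup>+x. ennreal (f x) \<partial>M) + ennreal (P * b / B) * (\<integral>\<^sup>+x. ennreal (g x) \<partial>M)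
      + ennreal (P * c / C) * (\<integral>\<^sup>+x. ennreal (h x) \<partial>M)"
    by (rule nn_integral_linear3) measurable
  also have "\<dots> \<le> ennreal (P * a / A) * ennreal A + ennreal (P * b / B) * ennreal B + ennreal (P * c / C) * ennreal C"
    by (intro add_mono mult_left_mono A B C) auto
  also have "\<dots> = ennreal (P * a + P * b + P * c)"
    using pos P abc by (simp flip: ennreal_mult ennreal_plus)
  also have "P * a + P * b + P * c = P"
    using abc by (metis distrib_left mult.right_neutral)
  finally show ?thesis by (simp add: P_def)
qed

lemma cauchy_schwarz_bound:
  fixes f g :: "'a \<Rightarrow> real"
  assumes [measurable]: "f \<in> borel_measurable M" "g \<in> borel_measurable M"
    and nonneg: "\<And>x. 0 \<le> f x" "\<And>x. 0 \<le> g x"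
    and A: "(\<integral>\<^sup>+x. ennreal ((f x)\<^sup>2) \<partial>M) \<le> ennreal A" "0 \<le> A"
    and B: "(\<integral>\<^sup>+x. ennreal ((g x)\<^sup>2) \<partial>M) \<le> ennreal B" "0 \<le> B"
  shows "(\<integral>\<^sup>+x. ennreal (f x * g x) \<partial>M) \<le> ennreal (sqrt (A * B))"
proof (rule ennreal_power_le_imp_le)
  have "(\<integral>\<^sup>+x. ennreal (f x * g x) \<partial>M)\<^sup>2 \<le> (\<integral>\<^sup>+x. ennreal ((f x)\<^sup>2) \<partial>M) * (\<integral>\<^sup>+x. ennreal ((g x)\<^sup>2) \<partial>M)"
    by (intro Cauchy_Schwarz_ennreal assms)
  also have "\<dots> \<le> ennreal A * ennreal B"
    by (intro mult_mono A B) auto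
  finally show "(\<integral>\<^sup>+x. ennreal (f x * g x) \<partial>M)\<^sup>2 \<le> (ennreal (sqrt (A * B)))\<^sup>2"
    using A B by (simp add: ennreal_power flip: ennreal_mult)
qed simp

text \<open>The function \<open>\<Phi>\<close> below is \<open>\<bar>s\<bar> powr g\<close> continued by its tangents outside \<open>[- M, M]\<close>. It lies above
  its tangents, whose slope \<open>\<phi>\<close> is Lipschitz; this gives differentiability without a case
  distinction at \<open>0\<close> and at \<open>\<plusminus> M\<close>.\<close>

locale truncated_power =
  fixes g M :: real
  assumes g: "2 \<le> g" and M: "0 < M"
begin

definition clamp :: "real \<Rightarrow> real" where "clamp s = max (- M) (min M s)"

text \<open>The odd power: \<open>g * spow\<close> is the derivative of
  \<open>\<bar>s\<bar> powr g\<close>.\<close>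

definition spow :: "real \<Rightarrow> real" where "spow r = sgn r * \<bar>r\<bar> powr (g - 1)"

definition \<phi> :: "real \<Rightarrow> real" where "\<phi> s = g * spow (clamp s)"

definition \<Phi> :: "real \<Rightarrow> real" where "\<Phi> s = \<bar>clamp s\<bar> powr g + \<phi> s * (s - clamp s)"

text \<open>The maximum of the second derivative of \<open>\<bar>s\<bar> powr g\<close> on the
  interval from \<open>- M\<close> to \<open>M\<close>.\<close>

definition L :: real where "L = g * ((g - 1) * M powr (g - 2))"

lemma abs_clamp: "\<bar>clamp s\<bar> \<le> M" and clamp_eq: "\<bar>s\<bar> \<le> M \<Longrightarrow> clamp s = s"
  using M by (auto simp: clamp_def)

lemma clamp_lip: "\<bar>clamp a - clamp b\<bar> \<le> \<bar>a - b\<bar>"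
  by (auto simp: clamp_def max_def min_def)

lemma spow_nonneg_lip:
  assumes "0 \<le> b" "b \<le> a" "a \<le> M"
  shows "a powr (g - 1) - b powr (g - 1) \<le> (g - 1) * M powr (g - 2) * (a - b)"
proof -
  have "g - 1 - 1 = g - 2" by simp
  then have "a powr (g - 1) - b powr (g - 1) \<le> (g - 1) * a powr (g - 2) * (a - b)"
    using powr_tangent_le[of "g - 1" b a] assms g by (simp add: algebra_simps)
  also have "\<dots> \<le> (g - 1) * M powr (g - 2) * (a - b)"
    using assms g by (intro mult_right_mono mult_left_mono powr_mono2) auto
  finally show ?thesis .
qed

lemma spow_lip_aux:
  assumes "\<bar>a\<bar> \<le> M" "\<bar>b\<bar> \<le> M" "b \<le> a"
  shows "0 \<le> spow a - spow b \<and> spow a - spow b \<le> (g - 1) * M powr (g - 2) * (a - b)"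
proof -
  consider "0 \<le> b" | "a \<le> 0" | "b < 0" "0 < a" by linarith
  then show ?thesis
  proof cases
    case 1
    have "spow r = r powr (g - 1)" if "0 \<le> r" for r
      using that by (cases "r = 0") (auto simp: spow_def)
    then show ?thesis
      using 1 assms spow_nonneg_lip[of b a] g by (auto intro: powr_mono2)
  next
    case 2
    have "spow r = - ((- r) powr (g - 1))" if "r \<le> 0" for r
      using that by (cases "r = 0") (auto simp: spow_def)
    then show ?thesis
      using 2 assms spow_nonneg_lip[of "- a" "- b"] g by (auto intro: powr_mono2)
  next
    case 3
    have "a powr (g - 1) \<le> (g - 1) * M powr (g - 2) * a" "(- b) powr (g - 1) \<le> (g - 1) * M powr (g - 2) * (- b)"
      using spow_nonneg_lip[of 0 a] spow_nonneg_lip[of 0 "- b"] 3 assms by auto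
    then show ?thesis using 3 by (simp add: spow_def algebra_simps)
  qed
qed

lemma \<phi>_lip: "\<bar>\<phi> a - \<phi> b\<bar> \<le> L * \<bar>a - b\<bar>"
proof -
  have "\<bar>spow (clamp a) - spow (clamp b)\<bar> \<le> (g - 1) * M powr (g - 2) * \<bar>clamp a - clamp b\<bar>"
    using spow_lip_aux[OF abs_clamp abs_clamp, of a b] spow_lip_aux[OF abs_clamp abs_clamp, of b a]
    by (cases "clamp b \<le> clamp a") auto
  also have "\<dots> \<le> (g - 1) * M powr (g - 2) * \<bar>a - b\<bar>"
    using clamp_lip g by (intro mult_left_mono) auto
  finally have "g * \<bar>spow (clamp a) - spow (clamp b)\<bar> \<le> g * ((g - 1) * M powr (g - 2) * \<bar>a - b\<bar>)"
    using g by (intro mult_left_mono) auto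
  then show ?thesis
    using g by (simp add: \<phi>_def L_def abs_mult ac_simps flip: right_diff_distrib)
qed

lemma abs_powr_tangent: "\<bar>r\<bar> powr g + g * spow r * (s - r) \<le> \<bar>s\<bar> powr g"
proof -
  have "\<bar>r\<bar> powr g + g * \<bar>r\<bar> powr (g - 1) * (\<bar>s\<bar> - \<bar>r\<bar>) \<le> \<bar>s\<bar> powr g"
    using g by (intro powr_tangent_le) auto
  moreover have "g * (\<bar>r\<bar> powr (g - 1) * (sgn r * (s - r))) \<le> g * (\<bar>r\<bar> powr (g - 1) * (\<bar>s\<bar> - \<bar>r\<bar>))"
    using g by (intro mult_left_mono) (auto simp: sgn_if)
  ultimately show ?thesis by (simp add: spow_def ac_simps)
qed

lemma tangent: "\<Phi> s + \<phi> s * (t - s) \<le> \<Phi> t"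
proof -
  \<comment> \<open>Beyond the truncation level \<open>clamp t\<close> is an endpoint of the
    interval, so by monotonicity of \<open>spow\<close> the first factor has the sign of
    \<open>t - clamp t\<close>; within the interval the second factor is 0.\<close>
  have "0 \<le> (spow (clamp t) - spow (clamp s)) * (t - clamp t)"
  proof -
    consider "M < t" | "t < - M" | "\<bar>t\<bar> \<le> M" by linarith
    then show ?thesis
    proof cases
      case 1
      then have "clamp t = M" using M by (simp add: clamp_def)
      then show ?thesis
        using 1 M spow_lip_aux[of M "clamp s"] abs_clamp[of s] by (intro mult_nonneg_nonneg) auto
    next
      case 2
      then have "clamp t = - M" using M by (simp add: clamp_def)
      then show ?thesis
        using 2 M spow_lip_aux[of "clamp s" "- M"] abs_clamp[of s] by (intro mult_nonpos_nonpos) auto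
    qed (simp add: clamp_eq)
  qed
  then have "0 \<le> g * ((spow (clamp t) - spow (clamp s)) * (t - clamp t))" using g by simp
  then show ?thesis
    using abs_powr_tangent[of "clamp s" "clamp t"] by (simp add: \<Phi>_def \<phi>_def algebra_simps)
qed

text \<open>The tangents at \<open>s\<close> and at \<open>t\<close> confine the error of the linear
  approximation between 0 and \<open>(\<phi> t - \<phi> s) * (t - s)\<close>, which is quadratic in
  \<open>t - s\<close> by the Lipschitz bound.\<close>

lemma \<Phi>_deriv: "(\<Phi> has_real_derivative \<phi> s) (at s)"
  unfolding has_field_derivative_iff
proof (rule LIM_zero_cancel, rule Lim_null_comparison)
  show "\<forall>\<^sub>F t in at s. norm ((\<Phi> t - \<Phi> s) / (t - s) - \<phi> s) \<le> L * \<bar>t - s\<bar>"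
    unfolding eventually_at_filter
  proof (rule always_eventually, intro allI impI)
    fix t assume ts: "t \<noteq> s"
    have "0 \<le> \<Phi> t - \<Phi> s - \<phi> s * (t - s)" using tangent[of s t] by simp
    moreover have "\<Phi> t - \<Phi> s - \<phi> s * (t - s) \<le> (\<phi> t - \<phi> s) * (t - s)"
      using tangent[of t s] by (simp add: algebra_simps)
    moreover have "(\<phi> t - \<phi> s) * (t - s) \<le> L * \<bar>t - s\<bar> * \<bar>t - s\<bar>"
      using mult_right_mono[OF \<phi>_lip[of t s], of "\<bar>t - s\<bar>"] by (auto simp flip: abs_mult)
    ultimately have "\<bar>\<Phi> t - \<Phi> s - \<phi> s * (t - s)\<bar> \<le> L * \<bar>t - s\<bar> * \<bar>t - s\<bar>" by simp
    then have "\<bar>\<Phi> t - \<Phi> s - \<phi> s * (t - s)\<bar> / \<bar>t - s\<bar> \<le> L * \<bar>t - s\<bar>"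
      using ts by (simp add: pos_divide_le_eq)
    moreover have "(\<Phi> t - \<Phi> s) / (t - s) - \<phi> s = (\<Phi> t - \<Phi> s - \<phi> s * (t - s)) / (t - s)"
      using ts by (simp add: field_simps)
    ultimately show "norm ((\<Phi> t - \<Phi> s) / (t - s) - \<phi> s) \<le> L * \<bar>t - s\<bar>"
      by (simp add: abs_divide)
  qed
  show "((\<lambda>t. L * \<bar>t - s\<bar>) \<longlongrightarrow> 0) (at s)"
    by (auto intro!: tendsto_eq_intros)
qed

lemma \<phi>_cont: "continuous_on UNIV \<phi>"
proof -
  have "L \<ge> 0" using g by (simp add: L_def)
  then have "L-lipschitz_on UNIV \<phi>"
    using \<phi>_lip by (auto simp: lipschitz_on_def dist_real_def)
  then show ?thesis by (rule lipschitz_on_continuous_on)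
qed

lemma \<phi>_zero: "\<phi> 0 = 0" and \<Phi>_zero: "\<Phi> 0 = 0"
  using M by (simp_all add: \<phi>_def \<Phi>_def spow_def clamp_eq)

lemma \<Phi>_nonneg: "0 \<le> \<Phi> s"
  using tangent[of 0 s] by (simp add: \<phi>_zero \<Phi>_zero)

lemma \<Phi>_le: "\<Phi> s \<le> L * s\<^sup>2"
proof -
  have "\<Phi> s \<le> \<phi> s * s" using tangent[of s 0] by (simp add: \<Phi>_zero)
  also have "\<dots> \<le> \<bar>\<phi> s\<bar> * \<bar>s\<bar>" by (simp flip: abs_mult)
  also have "\<dots> \<le> (L * \<bar>s\<bar>) * \<bar>s\<bar>"
    using \<phi>_lip[of s 0] by (intro mult_right_mono) (auto simp: \<phi>_zero)
  finally show ?thesis by (simp add: power2_eq_square)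
qed

lemma \<Phi>_eq: "\<bar>s\<bar> \<le> M \<Longrightarrow> \<Phi> s = \<bar>s\<bar> powr g"
  by (simp add: \<Phi>_def clamp_eq)

text \<open>For the untruncated power this is an equality. Beyond the level \<open>M\<close> the
  slope stays constant while \<open>\<Phi>\<close> still grows, so the inequality survives
  truncation; it brings the integral being estimated back on the right-hand side of Gagliardo's
  estimate.\<close>

lemma \<phi>_square_le:
  assumes "2 * (g - 1) = g * q"
  shows "(\<phi> s)\<^sup>2 \<le> g\<^sup>2 * \<Phi> s powr q"
proof -
  have q: "0 \<le> q" using assms g by (metis diff_ge_0_iff_ge mult_nonneg_nonneg one_le_numeral order_trans zero_le_mult_iff zero_le_numeral linorder_not_le mult_pos_neg less_le_trans zero_less_numeral)
  have "0 \<le> \<phi> s * (s - clamp s)"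
  proof -
    have "0 \<le> spow (clamp s) * (s - clamp s)"
      using M by (auto simp: spow_def clamp_def sgn_if max_def min_def mult_nonneg_nonneg mult_nonpos_nonpos mult_nonneg_nonpos)
    then have "0 \<le> g * (spow (clamp s) * (s - clamp s))" using g by simp
    then show ?thesis by (simp add: \<phi>_def mult.assoc)
  qed
  then have "\<bar>clamp s\<bar> powr g \<le> \<Phi> s" by (simp add: \<Phi>_def)
  then have "(\<bar>clamp s\<bar> powr g) powr q \<le> \<Phi> s powr q"
    using q by (intro powr_mono2) auto
  moreover have "(\<phi> s)\<^sup>2 \<le> g\<^sup>2 * (\<bar>clamp s\<bar> powr g) powr q"
  proof (cases "clamp s = 0")
    case False
    have "(\<phi> s)\<^sup>2 = g\<^sup>2 * (\<bar>clamp s\<bar> powr (g - 1))\<^sup>2"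
      using False by (simp add: \<phi>_def spow_def power_mult_distrib sgn_if)
    also have "(\<bar>clamp s\<bar> powr (g - 1))\<^sup>2 = \<bar>clamp s\<bar> powr (2 * (g - 1))"
      using False by (simp add: powr_powr mult.commute flip: powr_realpow)
    finally show ?thesis using assms by (simp add: powr_powr)
  qed (simp add: \<phi>_def spow_def)
  ultimately show ?thesis
    by (smt (verit) mult_left_mono zero_le_power2)
qed

end

section \<open>Weighted estimates by dimension\<close>

context trace_approx
begin

text \<open>The weight is Hardy's weight times \<open>(x $ k) powr (p + 2)\<close>, and this factor
  is at most \<open>R powr (p + 2)\<close> because its exponent is positive.\<close>

lemma weighted_L2_le:
  assumes p: "- 2 < p" and d: "energy \<le> ennreal d" "0 \<le> d"
  shows "B_int (\<lambda>x. (u x)\<^sup>2 * (x $ k) powr p) \<le> ennreal (8 * R powr (p + 2) * d)"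
proof -
  have "B_int (\<lambda>x. (u x)\<^sup>2 * (x $ k) powr p)
    \<le> ennreal (R powr (p + 2)) * B_int (\<lambda>x. (u x)\<^sup>2 / (x $ k)\<^sup>2)"
  proof (rule set_nn_integral_le_cmult)
    fix x assume "x \<in> B"
    then have x: "0 < x $ k" "x $ k \<le> R"
      using component_le_norm_cart[of x k] by (auto simp: half_ball_def)
    have "(x $ k) powr p = (x $ k) powr (p + 2) / (x $ k)\<^sup>2"
      using x by (simp add: powr_add)
    also have "\<dots> \<le> R powr (p + 2) / (x $ k)\<^sup>2"
      using x p by (intro divide_right_mono powr_mono2) auto
    finally have "(u x)\<^sup>2 * (x $ k) powr p \<le> (u x)\<^sup>2 * (R powr (p + 2) / (x $ k)\<^sup>2)"
      by (intro mult_left_mono) auto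
    then show "(u x)\<^sup>2 * (x $ k) powr p \<le> R powr (p + 2) * ((u x)\<^sup>2 / (x $ k)\<^sup>2)"
      by (simp add: mult.commute)
  qed (simp, measurable)
  also have "\<dots> \<le> ennreal (R powr (p + 2)) * (8 * ennreal d)"
    using hardy mult_left_mono[OF d(1), of 8] by (intro mult_left_mono) (auto intro: order_trans)
  also have "\<dots> = ennreal (8 * R powr (p + 2) * d)"
    using d by (simp add: ac_simps flip: ennreal_mult ennreal_numeral)
  finally show ?thesis .
qed

lemma energy_cauchy_schwarz:
  assumes [measurable]: "f \<in> borel_measurable lebesgue" and f: "\<And>x. 0 \<le> f x"
    and A: "B_int (\<lambda>x. (f x)\<^sup>2) \<le> ennreal A" "0 \<le> A"
    and d: "energy \<le> ennreal d" "0 \<le> d"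
  shows "B_int (\<lambda>x. f x * norm (G x)) \<le> ennreal (sqrt (A * d))"
proof -
  have "(\<integral>\<^sup>+x. ennreal ((f x * indicator B x) * (norm (G x) * indicator B x)) \<partial>lebesgue) \<le> ennreal (sqrt (A * d))"
  proof (rule cauchy_schwarz_bound)
    show "(\<integral>\<^sup>+x. ennreal ((f x * indicator B x)\<^sup>2) \<partial>lebesgue) \<le> ennreal A"
      using A by (simp add: ennreal_indicator_square)
    show "(\<integral>\<^sup>+x. ennreal ((norm (G x) * indicator B x)\<^sup>2) \<partial>lebesgue) \<le> ennreal d"
      using d by (simp add: ennreal_indicator_square energy_def)
  qed (use f A d in auto)
  also have "(\<lambda>x. ennreal ((f x * indicator B x) * (norm (G x) * indicator B x)))
      = (\<lambda>x. ennreal (f x * norm (G x)) * indicator B x)"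
    by (auto simp: fun_eq_iff split: split_indicator)
  finally show ?thesis .
qed

text \<open>The derivative of the square is Lipschitz with constant 2, so the quadratic quantities
  of dimensions 1 and 2 require no truncation.\<close>

lemma square_limit:
  assumes "\<And>s. 0 \<le> \<omega> s" "\<And>s t. 0 \<le> s \<Longrightarrow> s \<le> t \<Longrightarrow> \<omega> t \<le> \<omega> s" "\<omega> \<in> borel_measurable borel"
  shows "gagliardo_limit k R u G v (\<lambda>s. s\<^sup>2) (\<lambda>s. 2 * s) \<omega> 2"
proof -
  have "gagliardo_data (\<lambda>s. s\<^sup>2) (\<lambda>s. 2 * s) \<omega>"
    by unfold_locales (use assms in \<open>auto intro!: derivative_eq_intros continuous_intros\<close>)
  moreover have "\<bar>2 * a - 2 * b\<bar> \<le> 2 * \<bar>a - b\<bar>" for a b :: real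
    using abs_mult[of 2 "a - b"] by (simp add: algebra_simps)
  ultimately show ?thesis
    by (intro gagliardo_limit.intro gagliardo_limit_axioms.intro trace_approx_axioms) auto
qed

end

lemma (in gagliardo_limit) limit_total_le:
  assumes A: "B_int (\<lambda>x. (\<phi> (u x) * \<omega> (x $ k))\<^sup>2) \<le> ennreal A" "0 \<le> A"
    and d: "energy \<le> ennreal d" "0 \<le> d"
  shows "limit_total \<le> ennreal (2 * sqrt (A * d))"
proof -
  have "limit_total \<le> ennreal 2 * B_int (\<lambda>x. \<bar>\<phi> (u x) * \<omega> (x $ k)\<bar> * norm (G x))"
    unfolding limit_total_def
    by (rule set_nn_integral_le_cmult, simp add: abs_mult abs_of_nonneg[OF \<omega>_nonneg], simp, measurable)
  also have "\<dots> \<le> ennreal 2 * ennreal (sqrt (A * d))"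
    using A by (intro mult_left_mono energy_cauchy_schwarz d) auto
  also have "\<dots> = ennreal (2 * sqrt (A * d))"
    by (rule ennreal_mult[symmetric]) (use A d in auto)
  finally show ?thesis .
qed

context trace_approx
begin

text \<open>The geometric mean of the given bound and of the one from Hardy's inequality.\<close>

lemma weighted_L2_le_geometric_mean:
  assumes p: "- 2 < p" and R: "0 < R" and d: "energy \<le> ennreal d" "0 \<le> d"
    and a: "B_int (\<lambda>x. (u x)\<^sup>2 * (x $ k) powr p) \<le> ennreal a" "0 \<le> a"
  obtains A where "B_int (\<lambda>x. (u x)\<^sup>2 * (x $ k) powr p) \<le> ennreal A" "0 \<le> A"
    "A \<le> 3 * R powr ((p + 2) / 2) * sqrt a * sqrt d"
proof
  let ?A = "min a (8 * R powr (p + 2) * d)"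
  show "B_int (\<lambda>x. (u x)\<^sup>2 * (x $ k) powr p) \<le> ennreal ?A" and A: "0 \<le> ?A"
    using a d weighted_L2_le[OF p d] by (auto simp: min_def)
  have rr: "R powr (p + 2) = (R powr ((p + 2) / 2))\<^sup>2"
    using R by (simp add: power2_eq_square flip: powr_add)
  \<comment> \<open>The minimum of two numbers is at most their geometric mean; afterwards
    \<open>sqrt 8\<close> is rounded up to 3.\<close>
  have "?A = sqrt ?A * sqrt ?A" using A by simp
  also have "\<dots> \<le> sqrt a * sqrt (8 * R powr (p + 2) * d)"
    using A a by (intro mult_mono) auto
  also have "\<dots> = sqrt 8 * (R powr ((p + 2) / 2) * sqrt a * sqrt d)"
    unfolding rr by (simp add: real_sqrt_mult)
  also have "\<dots> \<le> 3 * (R powr ((p + 2) / 2) * sqrt a * sqrt d)"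
    using a d by (intro mult_right_mono real_le_lsqrt) auto
  finally show "?A \<le> 3 * R powr ((p + 2) / 2) * sqrt a * sqrt d" by (simp add: mult.assoc)
qed

text \<open>The pointwise bound of dimension 1 contributes one factor \<open>sqrt d\<close> and the
  geometric mean \<open>A\<close> another, so the product is linear in the energy.\<close>

lemma slice_dim1:
  assumes n: "CARD('n) = 1" and p: "- 2 < p" and R: "0 < R"
    and d: "energy \<le> ennreal d" "0 \<le> d"
    and a: "B_int (\<lambda>x. (u x)\<^sup>2 * (x $ k) powr p) \<le> ennreal a" "0 \<le> a"
  shows "B_int (\<lambda>x. \<bar>u x\<bar> powr 3 * (x $ k) powr p)
    \<le> ennreal (24 * R powr ((p + 3) / 2) * sqrt a * d)"
proof -
  interpret gagliardo_limit k R u G v "\<lambda>s. s\<^sup>2" "\<lambda>s. 2 * s" "\<lambda>_. 1" 2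
    by (rule square_limit) auto
  have lt: "limit_total \<le> ennreal (16 * R * d)"
  proof -
    \<comment> \<open>\<open>weighted_L2_le\<close> at exponent 0 is Poincare's inequality with
      constant \<open>8 * R\<^sup>2\<close>.\<close>
    have "B_int (\<lambda>x. (2 * u x * 1)\<^sup>2)
      \<le> ennreal 4 * B_int (\<lambda>x. (u x)\<^sup>2 * (x $ k) powr 0)"
      by (rule set_nn_integral_le_cmult, simp add: half_ball_def power_mult_distrib, simp, measurable)
    also have "\<dots> \<le> ennreal 4 * ennreal (8 * R powr (0 + 2) * d)"
      by (intro mult_left_mono weighted_L2_le) (use d in auto)
    also have "\<dots> = ennreal (4 * (8 * R powr (0 + 2) * d))"
      by (rule ennreal_mult[symmetric]) (use d in auto)
    also have "4 * (8 * R powr (0 + 2) * d) = 32 * R\<^sup>2 * d" using R by simp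
    finally have "limit_total \<le> ennreal (2 * sqrt (32 * R\<^sup>2 * d * d))"
      by (rule limit_total_le[OF _ _ d]) (use d in simp)
    also have "2 * sqrt (32 * R\<^sup>2 * d * d) = (2 * sqrt 32) * (R * d)"
      using R d by (simp add: real_sqrt_mult)
    also have "sqrt 32 \<le> 8" by (rule real_le_lsqrt) auto
    then have "(2 * sqrt 32) * (R * d) \<le> 16 * (R * d)"
      using R d by (intro mult_right_mono) auto
    finally show ?thesis by (simp add: ennreal_leI mult.assoc)
  qed
  let ?s = "sqrt (16 * R * d)"
  have pos: "0 \<le> 16 * R * d" using R d by simp
  have ub: "AE x in lebesgue. x \<in> B \<longrightarrow> \<bar>u x\<bar> \<le> ?s"
    using one_dim[OF n]
  proof eventually_elim
    case (elim x)
    show ?case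
    proof
      assume "x \<in> B"
      then have "ennreal ((u x)\<^sup>2) \<le> ennreal (16 * R * d)"
        using elim lt by (auto intro: order_trans)
      then have "\<bar>u x\<bar>\<^sup>2 \<le> 16 * R * d" using pos by simp
      then show "\<bar>u x\<bar> \<le> ?s" by (rule real_le_rsqrt)
    qed
  qed
  obtain A where A: "B_int (\<lambda>x. (u x)\<^sup>2 * (x $ k) powr p) \<le> ennreal A" "0 \<le> A"
    "A \<le> 3 * R powr ((p + 2) / 2) * sqrt a * sqrt d"
    using weighted_L2_le_geometric_mean[OF p R d a] by blast
  have "B_int (\<lambda>x. \<bar>u x\<bar> powr 3 * (x $ k) powr p)
    \<le> B_int (\<lambda>x. ?s * ((u x)\<^sup>2 * (x $ k) powr p))"
  proof (rule nn_integral_mono_AE, use ub in eventually_elim)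
    case (elim x)
    have "\<bar>u x\<bar> powr 3 * (x $ k) powr p = \<bar>u x\<bar> * ((u x)\<^sup>2 * (x $ k) powr p)"
      by (cases "u x = 0") (simp_all add: power3_eq_cube power2_eq_square abs_mult_self_eq ac_simps)
    also have "\<dots> \<le> ?s * ((u x)\<^sup>2 * (x $ k) powr p)" if "x \<in> B"
      using elim that by (intro mult_right_mono) auto
    finally show ?case by (auto simp: ennreal_leI split: split_indicator)
  qed
  also have "\<dots> \<le> ennreal ?s * B_int (\<lambda>x. (u x)\<^sup>2 * (x $ k) powr p)"
    by (rule set_nn_integral_le_cmult, simp, use pos in simp, measurable)
  also have "\<dots> \<le> ennreal ?s * ennreal A" by (intro mult_left_mono A) simp
  also have "\<dots> = ennreal (?s * A)" using A pos by (simp add: ennreal_mult)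
  also have "?s * A \<le> 24 * R powr ((p + 3) / 2) * sqrt a * d"
  proof -
    have "(p + 3) / 2 = 1 / 2 + (p + 2) / 2" by (simp add: field_simps)
    then have RR: "R powr ((p + 3) / 2) = sqrt R * R powr ((p + 2) / 2)"
      using R by (simp only: powr_add powr_half_sqrt less_imp_le)
    have "?s * A \<le> ?s * (3 * R powr ((p + 2) / 2) * sqrt a * sqrt d)"
      using pos A by (intro mult_left_mono) auto
    also have "\<dots> = 12 * R powr ((p + 3) / 2) * sqrt a * (sqrt d * sqrt d)"
      unfolding RR by (simp add: real_sqrt_mult)
    \<comment> \<open>Weakened from 12 in order to share the constant with dimension 2.\<close>
    also have "\<dots> \<le> 24 * R powr ((p + 3) / 2) * sqrt a * (sqrt d * sqrt d)"
      using a d by (intro mult_right_mono) auto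
    finally show ?thesis using d by simp
  qed
  finally show ?thesis by (simp add: ennreal_leI)
qed

text \<open>The integrand splits into \<open>\<bar>u\<bar>\<close> and \<open>u\<^sup>2\<close>,
  each with half the exponent of the weight. The first is bounded in mean square by
  \<open>A\<close>, the second by Gagliardo's estimate, whose exponent \<open>n / (n - 1)\<close> is
  2 here. The result \<open>8 * A * sqrt d\<close> becomes linear in \<open>d\<close> because
  \<open>A\<close> carries a factor \<open>sqrt d\<close>.\<close>

lemma slice_dim2:
  assumes n: "CARD('n) = 2" and p: "- 2 < p" "p < 0" and R: "0 < R"
    and d: "energy \<le> ennreal d" "0 \<le> d"
    and a: "B_int (\<lambda>x. (u x)\<^sup>2 * (x $ k) powr p) \<le> ennreal a" "0 \<le> a"
  shows "B_int (\<lambda>x. \<bar>u x\<bar> powr 3 * (x $ k) powr p)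
    \<le> ennreal (24 * R powr ((p + 2) / 2) * sqrt a * d)"
proof -
  obtain A where A: "B_int (\<lambda>x. (u x)\<^sup>2 * (x $ k) powr p) \<le> ennreal A" "0 \<le> A"
    "A \<le> 3 * R powr ((p + 2) / 2) * sqrt a * sqrt d"
    using weighted_L2_le_geometric_mean[OF p(1) R d a] by blast
  have shifted: "B_int (\<lambda>x. ((u x)\<^sup>2 * (x $ k + e) powr (p / 2))\<^sup>2) \<le> ennreal (64 * A * d)"
    if e: "0 < e" for e
  proof -
    \<comment> \<open>Without the shift the weight would not be nonincreasing from height 0 on, as
      \<open>0 powr (p / 2)\<close> is 0.\<close>
    let ?\<omega> = "\<lambda>y. (y + e) powr (p / 2)"
    interpret gagliardo_limit k R u G v "\<lambda>s. s\<^sup>2" "\<lambda>s. 2 * s" ?\<omega> 2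
      by (rule square_limit) (use e p in \<open>auto intro!: powr_mono2'\<close>)
    have "B_int (\<lambda>x. (2 * u x * ?\<omega> (x $ k))\<^sup>2)
      \<le> ennreal 4 * B_int (\<lambda>x. (u x)\<^sup>2 * (x $ k) powr p)"
    proof (rule set_nn_integral_le_cmult)
      fix x assume "x \<in> B"
      then have x: "0 < x $ k" by (simp add: half_ball_def)
      have "(?\<omega> (x $ k))\<^sup>2 = (x $ k + e) powr p"
        by (simp add: power2_eq_square flip: powr_add)
      also have "\<dots> \<le> (x $ k) powr p"
        using x e p by (intro powr_mono2') auto
      finally show "(2 * u x * ?\<omega> (x $ k))\<^sup>2 \<le> 4 * ((u x)\<^sup>2 * (x $ k) powr p)"
        by (simp add: power_mult_distrib mult_left_mono)
    qed (simp, measurable)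
    also have "\<dots> \<le> ennreal 4 * ennreal A" by (intro mult_left_mono A) simp
    also have "\<dots> = ennreal (4 * A)" by (rule ennreal_mult[symmetric]) (use A in auto)
    finally have "limit_total \<le> ennreal (2 * sqrt (4 * A * d))"
      by (rule limit_total_le[OF _ _ d]) (use A in simp)
    then have "enn2real limit_total \<le> 2 * sqrt (4 * A * d)"
      using A d by (simp add: enn2real_leI)
    then have "(enn2real limit_total)\<^sup>2 \<le> (2 * sqrt (4 * A * d))\<^sup>2" by (intro power_mono) auto
    also have "\<dots> = 16 * (A * d)" using A d by (simp add: power_mult_distrib)
    finally have lt: "4 * (enn2real limit_total)\<^sup>2 \<le> 64 * A * d" by simp
    have "B_int (\<lambda>x. ((u x)\<^sup>2 * ?\<omega> (x $ k))\<^sup>2) \<le> ennreal (4 * (enn2real limit_total)\<^sup>2)"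
      using gagliardo n by (simp add: powr_numeral)
    also have "\<dots> \<le> ennreal (64 * A * d)" using lt by (rule ennreal_leI)
    finally show ?thesis .
  qed
  have fourth: "B_int (\<lambda>x. ((u x)\<^sup>2 * (x $ k) powr (p / 2))\<^sup>2) \<le> ennreal (64 * A * d)"
    by (rule shift_limit[where h="\<lambda>x y. ((u x)\<^sup>2 * y powr (p / 2))\<^sup>2"])
      (auto intro!: shifted continuous_intros)
  let ?f = "\<lambda>x. \<bar>u x\<bar> * (x $ k) powr (p / 2) * indicator B x" and ?h = "\<lambda>x. (u x)\<^sup>2 * (x $ k) powr (p / 2) * indicator B x"
  have pp: "(x $ k) powr p = (x $ k) powr (p / 2) * (x $ k) powr (p / 2)" for x :: "real ^ 'n"
    by (simp flip: powr_add)
  have "B_int (\<lambda>x. \<bar>u x\<bar> powr 3 * (x $ k) powr p) = (\<integral>\<^sup>+x. ennreal (?f x * ?h x) \<partial>lebesgue)"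
  proof (rule nn_integral_cong)
    fix x :: "real ^ 'n"
    have "\<bar>u x\<bar> powr 3 = \<bar>u x\<bar> * (u x)\<^sup>2"
      by (cases "u x = 0") (simp_all add: power3_eq_cube power2_eq_square abs_mult_self_eq)
    then show "ennreal (\<bar>u x\<bar> powr 3 * (x $ k) powr p) * indicator B x = ennreal (?f x * ?h x)"
      unfolding pp by (auto split: split_indicator simp: ac_simps)
  qed
  also have "\<dots> \<le> ennreal (sqrt (A * (64 * A * d)))"
  proof (rule cauchy_schwarz_bound)
    show "(\<integral>\<^sup>+x. ennreal ((?f x)\<^sup>2) \<partial>lebesgue) \<le> ennreal A"
      using A(1) unfolding ennreal_indicator_square pp by (simp add: power_mult_distrib flip: power2_eq_square)
    show "(\<integral>\<^sup>+x. ennreal ((?h x)\<^sup>2) \<partial>lebesgue) \<le> ennreal (64 * A * d)"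
      using fourth unfolding ennreal_indicator_square .
  qed (use A d in auto)
  also have "sqrt (A * (64 * A * d)) \<le> 24 * R powr ((p + 2) / 2) * sqrt a * d"
  proof -
    have "sqrt (A * (64 * A * d)) = sqrt ((8 * A)\<^sup>2 * d)" by (simp add: power2_eq_square ac_simps)
    also have "\<dots> = 8 * A * sqrt d" using A by (simp add: real_sqrt_mult)
    also have "\<dots> \<le> 8 * (3 * R powr ((p + 2) / 2) * sqrt a * sqrt d) * sqrt d"
      by (intro mult_right_mono mult_left_mono A(3)) (use d in auto)
    also have "\<dots> = 24 * R powr ((p + 2) / 2) * sqrt a * (sqrt d * sqrt d)" by simp
    finally show ?thesis using d by simp
  qed
  finally show ?thesis by (simp add: ennreal_leI)
qed

text \<open>The truncation makes the left-hand side finite, so that its power on the right-hand side of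
  Gagliardo's estimate can be absorbed.\<close>

lemma sobolev:
  assumes n: "3 \<le> CARD('n)" and d: "energy \<le> ennreal d" "0 \<le> d"
  defines "N \<equiv> real CARD('n)"
  shows "B_int (\<lambda>x. \<bar>u x\<bar> powr (2 * N / (N - 2)))
    \<le> ennreal ((2 powr N * (4 * (N - 1) / (N - 2)) powr (N / (N - 1))) powr (2 * (N - 1) / (N - 2)) * d powr (N / (N - 2)))"
proof -
  have N: "3 \<le> N" using n by (simp add: N_def)
  \<comment> \<open>The exponent is chosen to satisfy \<open>g * q = 2 * (g - 1)\<close>. Then the
    square of the derivative of \<open>\<bar>s\<bar> powr g\<close> and the \<open>q\<close>-th
    power of that function are both of Sobolev order \<open>2 * N / (N - 2)\<close>, so the two
    sides of Gagliardo's estimate contain the same integral.\<close>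
  define g where "g = 2 * (N - 1) / (N - 2)"
  define q where "q = N / (N - 1)"
  have g: "2 \<le> g" using N by (simp add: g_def field_simps)
  have q: "0 < q" using N by (simp add: q_def)
  have nz: "N - 1 \<noteq> 0" "N - 2 \<noteq> 0" using N by auto
  have gq1: "g * q = 2 * N / (N - 2)"
    using nz by (simp add: g_def q_def divide_simps) (simp add: algebra_simps)?
  have g1: "g = N / (N - 2) + 1"
    using nz by (simp add: g_def divide_simps)
  have gq: "2 * (g - 1) = g * q" "(1 - q / 2) * g = 1" "q / 2 * g = N / (N - 2)"
  proof -
    show "2 * (g - 1) = g * q" unfolding gq1 by (simp add: g1)
    have "q / 2 * g = (g * q) / 2" by simp
    also have "g * q = 2 * (N / (N - 2))" unfolding gq1 by simp
    also have "2 * (N / (N - 2)) / 2 = N / (N - 2)"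
      by (rule nonzero_mult_div_cancel_left) simp
    finally show q2: "q / 2 * g = N / (N - 2)" .
    show "(1 - q / 2) * g = 1" unfolding left_diff_distrib q2 by (simp add: g1)
  qed
  define C where "C = 2 powr N * (2 * g) powr q"
  have C: "0 < C" using g by (simp add: C_def)
  have trunc: "B_int (\<lambda>x. truncated_power.\<Phi> g M (u x) powr q) \<le> ennreal (C powr g * d powr (N / (N - 2)))"
    if M: "0 < M" for M
  proof -
    interpret T: truncated_power g M by unfold_locales (use g M in auto)
    have "gagliardo_data T.\<Phi> T.\<phi> (\<lambda>_. 1)"
      by unfold_locales (auto simp: T.\<Phi>_deriv T.\<phi>_cont T.\<Phi>_nonneg)
    then interpret gagliardo_limit k R u G v T.\<Phi> T.\<phi> "\<lambda>_. 1" T.L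
      by (intro gagliardo_limit.intro gagliardo_limit_axioms.intro)
        (auto simp: trace_approx_axioms T.\<phi>_lip T.\<phi>_zero T.\<Phi>_le)
    have S1: "B_int (\<lambda>x. T.\<Phi> (u x) powr q) \<le> ennreal (2 powr N * enn2real limit_total powr q)"
      using gagliardo n by (simp add: q_def N_def powr_realpow)
    then obtain S where S: "B_int (\<lambda>x. T.\<Phi> (u x) powr q) = ennreal S" "0 \<le> S"
      by (cases "B_int (\<lambda>x. T.\<Phi> (u x) powr q)") (auto simp: top_unique)
    have "B_int (\<lambda>x. (T.\<phi> (u x) * 1)\<^sup>2)
      \<le> ennreal (g\<^sup>2) * B_int (\<lambda>x. T.\<Phi> (u x) powr q)"
      by (rule set_nn_integral_le_cmult, use T.\<phi>_square_le[OF gq(1)] in simp, simp, measurable)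
    also have "\<dots> = ennreal (g\<^sup>2 * S)"
      unfolding S(1) by (rule ennreal_mult[symmetric]) (use S in auto)
    finally have "limit_total \<le> ennreal (2 * sqrt (g\<^sup>2 * S * d))"
      by (rule limit_total_le[OF _ _ d]) (use S in simp)
    also have "2 * sqrt (g\<^sup>2 * S * d) = 2 * g * sqrt (S * d)"
      using g by (simp add: real_sqrt_mult)
    finally have "enn2real limit_total \<le> 2 * g * sqrt (S * d)"
      using g S d by (simp add: enn2real_leI)
    then have "enn2real limit_total powr q \<le> (2 * g * sqrt (S * d)) powr q"
      using q by (intro powr_mono2) auto
    also have "\<dots> = (2 * g) powr q * (S powr (q / 2) * d powr (q / 2))"
      using g S d by (simp add: powr_mult powr_powr powr_half_sqrt[symmetric] real_sqrt_mult)
    finally have "ennreal (2 powr N * enn2real limit_total powr q) \<le> ennreal (C * (S powr (q / 2) * d powr (q / 2)))"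
      by (simp add: C_def ennreal_leI mult_left_mono mult.assoc)
    with S1 have "ennreal S \<le> ennreal (C * (S powr (q / 2) * d powr (q / 2)))"
      unfolding S(1) by (rule order_trans)
    then have le: "S \<le> C * (S powr (q / 2) * d powr (q / 2))"
      using C by (subst (asm) ennreal_le_iff) auto
    have "S \<le> C powr g * d powr (N / (N - 2))"
    proof (cases "S = 0")
      case False
      with S have Sp: "0 < S" by simp
      \<comment> \<open>As \<open>q / 2 < 1\<close>, dividing by \<open>S powr (q / 2)\<close>
        leaves a positive power of \<open>S\<close>, which the power \<open>g\<close> turns into
        \<open>S\<close> itself.\<close>
      have "S powr (1 - q / 2) = S / S powr (q / 2)" using Sp by (simp add: powr_diff)
      also have "\<dots> \<le> C * d powr (q / 2)"
        using le Sp by (simp add: pos_divide_le_eq ac_simps)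
      finally have "(S powr (1 - q / 2)) powr g \<le> (C * d powr (q / 2)) powr g"
        using g by (intro powr_mono2) auto
      also have "(C * d powr (q / 2)) powr g = C powr g * d powr (q / 2 * g)"
        by (simp only: powr_mult powr_powr)
      finally have "S powr 1 \<le> C powr g * d powr (N / (N - 2))"
        by (simp only: powr_powr gq)
      then show ?thesis using Sp by simp
    qed simp
    then show ?thesis using S by (simp add: ennreal_leI)
  qed
  let ?\<Phi> = "\<lambda>j. truncated_power.\<Phi> g (real (Suc j))"
  have "B_int (\<lambda>x. \<bar>u x\<bar> powr (g * q)) \<le> ennreal (C powr g * d powr (N / (N - 2)))"
  proof (rule nn_integral_fatou_le)
    show "(\<lambda>x. ennreal (?\<Phi> j (u x) powr q) * indicator B x) \<in> borel_measurable lebesgue" for j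
    proof -
      interpret T: truncated_power g "real (Suc j)" by unfold_locales (use g in auto)
      have "continuous_on UNIV T.\<Phi>"
        using T.\<Phi>_deriv by (meson DERIV_isCont continuous_at_imp_continuous_on)
      then have [measurable]: "T.\<Phi> \<in> borel_measurable borel" by (rule borel_measurable_continuous_onI)
      show ?thesis by measurable
    qed
    show "AE x in lebesgue. (\<lambda>j. ennreal (?\<Phi> j (u x) powr q) * indicator B x)
      \<longlonglongrightarrow> ennreal (\<bar>u x\<bar> powr (g * q)) * indicator B x"
    proof (rule AE_I2, rule tendsto_eventually)
      fix x :: "real ^ 'n"
      obtain m where m: "\<bar>u x\<bar> \<le> real m" using real_arch_simple by blast
      have "eventually (\<lambda>j. m \<le> j) sequentially" by (rule eventually_ge_at_top)
      then show "\<forall>\<^sub>F j in sequentially. ennreal (?\<Phi> j (u x) powr q) * indicator B x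
        = ennreal (\<bar>u x\<bar> powr (g * q)) * indicator B x"
      proof eventually_elim
        case (elim j)
        interpret T: truncated_power g "real (Suc j)" by unfold_locales (use g in auto)
        have "\<bar>u x\<bar> \<le> real (Suc j)" using m elim by simp
        then show ?case by (simp add: T.\<Phi>_eq powr_powr del: of_nat_Suc)
      qed
    qed
    show "\<forall>\<^sub>F j in sequentially. B_int (\<lambda>x. ?\<Phi> j (u x) powr q) \<le> ennreal (C powr g * d powr (N / (N - 2)))"
      by (intro always_eventually allI trunc) simp
  qed simp
  then show ?thesis
    by (simp add: gq1) (simp add: C_def g_def q_def)
qed

text \<open>Hoelder with exponents \<alpha>, \<beta>, \<gamma> for the weighted norm, Hardy and
  Sobolev. They are the solution of three equations: the sum is 1 (\<open>abc1\<close>), the power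
  of \<open>x $ k\<close> is \<open>p\<close> (\<open>e2\<close>), and the power of \<open>d\<close>
  is 1 (\<open>e3\<close>). The power of \<open>u\<close> is then determined (\<open>e1\<close>).
  Positivity of \<beta> and \<gamma> expresses that \<open>p\<close> lies between -2 and 0.\<close>

lemma slice_high:
  assumes n: "3 \<le> CARD('n)" and p: "- 2 < p" "p < 0"
    and d: "energy \<le> ennreal d" "0 \<le> d"
    and a: "B_int (\<lambda>x. (u x)\<^sup>2 * (x $ k) powr p) \<le> ennreal a" "0 \<le> a"
  defines "N \<equiv> real CARD('n)"
  defines "Cs \<equiv> (2 powr N * (4 * (N - 1) / (N - 2)) powr (N / (N - 1))) powr (2 * (N - 1) / (N - 2))"
  defines "\<beta> \<equiv> (N - 2) / (N + p) * (- p / 2)" and "\<gamma> \<equiv> (N - 2) / (N + p) * (1 + p / 2)"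
  shows "B_int (\<lambda>x. \<bar>u x\<bar> powr (2 * ((N + 2 * p + 2) / (N + p))) * (x $ k) powr p)
    \<le> ennreal (8 powr \<beta> * Cs powr \<gamma> * a powr ((p + 2) / (N + p)) * d)"
proof -
  have N: "3 \<le> N" using n by (simp add: N_def)
  have Np: "0 < N + p" using N p by simp
  define \<alpha> where "\<alpha> = (p + 2) / (N + p)"
  have nz: "N - 2 \<noteq> 0" "N + p \<noteq> 0" using N Np by auto
  have abc: "0 < \<alpha>" "0 < \<beta>" "0 < \<gamma>"
    unfolding \<alpha>_def \<beta>_def \<gamma>_def
    by (intro mult_pos_pos divide_pos_pos; use N p Np in simp)+
  have ag: "2 * N / (N - 2) * \<gamma> = (2 * N + N * p) / (N + p)" "N / (N - 2) * \<gamma> = (2 * N + N * p) / (2 * (N + p))"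
    using nz by (simp_all add: \<gamma>_def divide_simps) (simp_all add: algebra_simps)
  have abc1: "\<alpha> + \<beta> + \<gamma> = 1"
    using nz by (simp add: \<alpha>_def \<beta>_def \<gamma>_def divide_simps) (simp add: algebra_simps)
  have e1: "2 * \<alpha> + 2 * \<beta> + 2 * N / (N - 2) * \<gamma> = 2 * ((N + 2 * p + 2) / (N + p))"
    unfolding ag using nz by (simp add: \<alpha>_def \<beta>_def divide_simps) (simp add: algebra_simps)
  have e2: "p * \<alpha> - 2 * \<beta> = p"
    using nz by (simp add: \<alpha>_def \<beta>_def divide_simps) (simp add: algebra_simps)
  have e3: "\<beta> + N / (N - 2) * \<gamma> = 1"
    unfolding ag using nz by (simp add: \<beta>_def divide_simps) (simp add: algebra_simps)
  have Cs: "0 < Cs" using N by (simp add: Cs_def)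
  let ?I = "indicator B :: _ \<Rightarrow> real"
  have ind: "ennreal (y * ?I x) = ennreal y * indicator B x" for y x
    by (auto split: split_indicator)
  have "(\<integral>\<^sup>+x. ennreal (\<bar>u x\<bar> powr (2 * ((N + 2 * p + 2) / (N + p))) * (x $ k) powr p * ?I x) \<partial>lebesgue)
    \<le> ennreal (a powr \<alpha> * (8 * d) powr \<beta> * (Cs * d powr (N / (N - 2))) powr \<gamma>)"
  proof (rule hoelder3)
    show "(\<integral>\<^sup>+x. ennreal ((u x)\<^sup>2 * (x $ k) powr p * ?I x) \<partial>lebesgue) \<le> ennreal a"
      using a by (simp add: ind)
    have "8 * energy \<le> ennreal (8 * d)"
      using mult_left_mono[OF d(1), of 8] d by (simp add: ennreal_mult flip: ennreal_numeral)
    then show "(\<integral>\<^sup>+x. ennreal ((u x)\<^sup>2 / (x $ k)\<^sup>2 * ?I x) \<partial>lebesgue) \<le> ennreal (8 * d)"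
      using hardy order_trans unfolding ind by blast
    show "(\<integral>\<^sup>+x. ennreal (\<bar>u x\<bar> powr (2 * N / (N - 2)) * ?I x) \<partial>lebesgue) \<le> ennreal (Cs * d powr (N / (N - 2)))"
      using sobolev[OF n d] by (simp add: ind N_def Cs_def)
    fix x :: "real ^ 'n"
    show "\<bar>u x\<bar> powr (2 * ((N + 2 * p + 2) / (N + p))) * (x $ k) powr p * ?I x
      \<le> ((u x)\<^sup>2 * (x $ k) powr p * ?I x) powr \<alpha> * ((u x)\<^sup>2 / (x $ k)\<^sup>2 * ?I x) powr \<beta> * (\<bar>u x\<bar> powr (2 * N / (N - 2)) * ?I x) powr \<gamma>"
    proof (cases "x \<in> B \<and> u x \<noteq> 0")
      case True
      then have x: "0 < x $ k" "0 < \<bar>u x\<bar>" by (auto simp: half_ball_def)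
      have u2: "(u x)\<^sup>2 = \<bar>u x\<bar> powr 2" using x by simp
      have x2: "(u x)\<^sup>2 / (x $ k)\<^sup>2 = \<bar>u x\<bar> powr 2 * (x $ k) powr (- 2)"
        using x by (simp add: powr_minus divide_inverse)
      have t1: "((u x)\<^sup>2 * (x $ k) powr p) powr \<alpha> = \<bar>u x\<bar> powr (2 * \<alpha>) * (x $ k) powr (p * \<alpha>)"
        unfolding u2 using x by (simp only: powr_mult powr_powr powr_ge_zero)
      have t2: "((u x)\<^sup>2 / (x $ k)\<^sup>2) powr \<beta> = \<bar>u x\<bar> powr (2 * \<beta>) * (x $ k) powr (- 2 * \<beta>)"
        unfolding x2 using x by (simp only: powr_mult powr_powr powr_ge_zero)
      have t3: "(\<bar>u x\<bar> powr (2 * N / (N - 2))) powr \<gamma> = \<bar>u x\<bar> powr (2 * N / (N - 2) * \<gamma>)"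
        by (simp only: powr_powr)
      have t4: "(x $ k) powr (p * \<alpha> - 2 * \<beta>) = (x $ k) powr (p * \<alpha>) * (x $ k) powr (- 2 * \<beta>)"
        by (simp flip: powr_add)
      have "((u x)\<^sup>2 * (x $ k) powr p) powr \<alpha> * ((u x)\<^sup>2 / (x $ k)\<^sup>2) powr \<beta> * (\<bar>u x\<bar> powr (2 * N / (N - 2))) powr \<gamma>
        = \<bar>u x\<bar> powr (2 * \<alpha> + 2 * \<beta> + 2 * N / (N - 2) * \<gamma>) * (x $ k) powr (p * \<alpha> - 2 * \<beta>)"
        unfolding t1 t2 t3 t4 powr_add by (simp only: ac_simps)
      also have "\<dots> = \<bar>u x\<bar> powr (2 * ((N + 2 * p + 2) / (N + p))) * (x $ k) powr p"
        unfolding e1 e2 ..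
      finally show ?thesis using True by simp
    qed auto
  qed (use abc abc1 a d Cs in auto)
  also have "a powr \<alpha> * (8 * d) powr \<beta> * (Cs * d powr (N / (N - 2))) powr \<gamma>
    = 8 powr \<beta> * Cs powr \<gamma> * a powr \<alpha> * d powr (\<beta> + N / (N - 2) * \<gamma>)"
    using d Cs by (simp add: powr_mult powr_powr powr_add ac_simps)
  also have "\<dots> = 8 powr \<beta> * Cs powr \<gamma> * a powr \<alpha> * d"
    unfolding e3 using d by simp
  finally show ?thesis by (simp add: ind \<alpha>_def)
qed

end

section \<open>Uniqueness of weak gradients\<close>

text \<open>All derivatives of \<open>exp (- (1 / s))\<close> have this form with some polynomial
  \<open>P\<close>, so one family contains the standard smooth cut-off and its derivatives.\<close>

definition exp_bump :: "real poly \<Rightarrow> real \<Rightarrow> real" where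
  "exp_bump P s = (if 0 < s then poly P (1 / s) * exp (- (1 / s)) else 0)"

lemma poly_div_exp_tendsto_0: "((\<lambda>y. poly P y / exp y) \<longlongrightarrow> 0) at_top" for P :: "real poly"
proof -
  have "((\<lambda>y. \<Sum>i\<le>degree P. coeff P i * (y ^ i / exp y)) \<longlongrightarrow> (\<Sum>i\<le>degree P. coeff P i * 0)) at_top"
    by (intro tendsto_sum tendsto_mult tendsto_const tendsto_power_div_exp_0)
  then show ?thesis
    by (simp add: poly_altdef sum_divide_distrib)
qed

text \<open>With \<open>y = 1 / s\<close>, differentiation of \<open>P y * exp (- y)\<close> in
  \<open>s\<close> gives the factor \<open>y\<^sup>2\<close> times \<open>P - pderiv P\<close>, and
  \<open>[:0, 0, 1:]\<close> is the polynomial \<open>y\<^sup>2\<close>.\<close>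

lemma exp_bump_deriv:
  "(exp_bump P has_real_derivative exp_bump ([:0, 0, 1:] * (P - pderiv P)) s) (at s)"
proof -
  consider "0 < s" | "s < 0" | "s = 0" by linarith
  then show ?thesis
  proof cases
    case 1
    have "((\<lambda>s. poly P (1 / s) * exp (- (1 / s))) has_real_derivative
        exp_bump ([:0, 0, 1:] * (P - pderiv P)) s) (at s)"
      using 1 by (auto intro!: derivative_eq_intros poly_DERIV[THEN DERIV_chain2]
          simp: exp_bump_def power2_eq_square field_simps)
    then show ?thesis
      by (rule has_field_derivative_transform_within_open[where S="{0<..}"])
        (use 1 in \<open>auto simp: exp_bump_def\<close>)
  next
    case 2
    have "((\<lambda>s. 0) has_real_derivative 0) (at s)" by simp
    then have "(exp_bump P has_real_derivative 0) (at s)"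
      by (rule has_field_derivative_transform_within_open[where S="{..<0}"])
        (use 2 in \<open>auto simp: exp_bump_def\<close>)
    then show ?thesis using 2 by (simp add: exp_bump_def)
  next
    case 3
    \<comment> \<open>In the variable \<open>y = 1 / t\<close> the difference quotient at 0 is a
      polynomial in \<open>y\<close> divided by \<open>exp y\<close>.\<close>
    have right: "((\<lambda>t. exp_bump P t / t) \<longlongrightarrow> 0) (at_right 0)"
    proof -
      have "((\<lambda>t::real. poly ([:0, 1:] * P) (inverse t) / exp (inverse t)) \<longlongrightarrow> 0) (at_right 0)"
        by (rule filterlim_compose[OF poly_div_exp_tendsto_0 filterlim_inverse_at_top_right])
      then show ?thesis
      proof (rule Lim_transform_eventually)
        show "\<forall>\<^sub>F t in at_right 0. poly ([:0, 1:] * P) (inverse t) / exp (inverse t) = exp_bump P t / t"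
          unfolding eventually_at_right_field
          by (rule exI[of _ 1]) (auto simp: exp_bump_def exp_minus divide_simps)
      qed
    qed
    have left: "((\<lambda>t. exp_bump P t / t) \<longlongrightarrow> 0) (at_left 0)"
    proof (rule tendsto_eventually)
      show "\<forall>\<^sub>F t in at_left 0. exp_bump P t / t = 0"
        unfolding eventually_at_left_field by (rule exI[of _ "-1"]) (auto simp: exp_bump_def)
    qed
    from left right have "((\<lambda>t. exp_bump P t / t) \<longlongrightarrow> 0) (at 0)"
      by (simp add: filterlim_at_split)
    then show ?thesis
      using 3 by (simp add: has_field_derivative_iff exp_bump_def)
  qed
qed

text \<open>The class is closed under partial derivatives, hence consists of smooth functions.\<close>

inductive bump_class :: "(real ^ 'n::finite \<Rightarrow> real) \<Rightarrow> bool" where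
  base: "bump_class (\<lambda>x. exp_bump P (a * x $ i + b))"
| const: "bump_class (\<lambda>x. c)"
| add: "bump_class f \<Longrightarrow> bump_class g \<Longrightarrow> bump_class (\<lambda>x. f x + g x)"
| mult: "bump_class f \<Longrightarrow> bump_class g \<Longrightarrow> bump_class (\<lambda>x. f x * g x)"

definition has_partials :: "(real ^ 'n::finite \<Rightarrow> real) \<Rightarrow> ('n \<Rightarrow> real ^ 'n \<Rightarrow> real) \<Rightarrow> bool" where
  "has_partials f D \<longleftrightarrow> (\<forall>x. (f has_derivative (\<lambda>h. \<Sum>i\<in>UNIV. D i x * h $ i)) (at x))"

lemma bump_class_partials:
  assumes "bump_class f"
  shows "\<exists>D. has_partials f D \<and> (\<forall>i. bump_class (D i))"
  using assms
proof induction
  case (base P a i b)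
  let ?E = "\<lambda>x. exp_bump ([:0, 0, 1:] * (P - pderiv P)) (a * x $ i + b)"
  let ?D = "\<lambda>j x. if j = i then a * ?E x else 0"
  have "((\<lambda>x. a * x $ i + b) has_derivative (\<lambda>h. a * h $ i)) (at x)" for x
    by (auto intro!: derivative_eq_intros bounded_linear_vec_nth[THEN bounded_linear.has_derivative])
  then have "((\<lambda>x. exp_bump P (a * x $ i + b)) has_derivative (\<lambda>h. ?E x * (a * h $ i))) (at x)" for x
    by (rule has_derivative_compose[OF _ exp_bump_deriv[unfolded has_field_derivative_def]])
  moreover have "(\<Sum>j\<in>UNIV. ?D j x * h $ j) = ?E x * (a * h $ i)" for x h
  proof -
    have "(\<Sum>j\<in>UNIV. ?D j x * h $ j) = (\<Sum>j\<in>UNIV. if j = i then a * ?E x * h $ i else 0)"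
      by (intro sum.cong) auto
    then show ?thesis by (simp add: ac_simps)
  qed
  ultimately have "has_partials (\<lambda>x. exp_bump P (a * x $ i + b)) ?D"
    by (simp add: has_partials_def)
  moreover have "bump_class (?D j)" for j
    by (cases "j = i") (auto intro: bump_class.intros)
  ultimately show ?case by blast
next
  case (const c)
  have "has_partials (\<lambda>x. c) (\<lambda>_ _. 0)" by (simp add: has_partials_def)
  then show ?case using bump_class.const by blast
next
  case (add f g)
  then obtain D E where D: "has_partials f D" "\<And>i. bump_class (D i)"
    and E: "has_partials g E" "\<And>i. bump_class (E i)" by blast
  have "has_partials (\<lambda>x. f x + g x) (\<lambda>i x. D i x + E i x)"
    using has_derivative_add D(1) E(1) unfolding has_partials_def
    by (simp add: distrib_right sum.distrib)
  moreover have "bump_class (\<lambda>x. D i x + E i x)" for i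
    by (intro bump_class.add D E)
  ultimately show ?case by blast
next
  case (mult f g)
  then obtain D E where D: "has_partials f D" "\<And>i. bump_class (D i)"
    and E: "has_partials g E" "\<And>i. bump_class (E i)" by blast
  have "has_partials (\<lambda>x. f x * g x) (\<lambda>i x. f x * E i x + D i x * g x)"
    unfolding has_partials_def
  proof
    fix x
    show "((\<lambda>x. f x * g x) has_derivative (\<lambda>h. \<Sum>i\<in>UNIV. (f x * E i x + D i x * g x) * h $ i)) (at x)"
      using has_derivative_mult[OF D(1)[unfolded has_partials_def, rule_format] E(1)[unfolded has_partials_def, rule_format], of x]
      by (simp add: sum_distrib_left sum_distrib_right algebra_simps flip: sum.distrib)
  qed
  moreover have "bump_class (\<lambda>x. f x * E i x + D i x * g x)" for i
    by (intro bump_class.add bump_class.mult D E mult.hyps)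
  ultimately show ?case by blast
qed

text \<open>A choice of partial derivatives inside the class is iterated along the index list; this
  recursion is the family required by \<open>smooth_fun\<close>.\<close>

lemma bump_class_smooth:
  fixes f :: "real ^ 'n::finite \<Rightarrow> real"
  assumes "bump_class f"
  shows "smooth_fun f"
proof -
  from bump_class_partials obtain pd where pd:
    "\<And>g :: real ^ 'n \<Rightarrow> real. bump_class g \<Longrightarrow> has_partials g (pd g)"
    "\<And>(g :: real ^ 'n \<Rightarrow> real) i. bump_class g \<Longrightarrow> bump_class (pd g i)"
    by metis
  define D where "D = rec_list f (\<lambda>i is g. pd g i)"
  have D: "D [] = f" "\<And>i is. D (i # is) = pd (D is) i" by (simp_all add: D_def)
  have "bump_class (D is)" for "is"
    by (induction "is") (simp_all add: D assms pd)
  then show ?thesis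
    using pd(1) unfolding smooth_fun_def has_partials_def by (intro exI[of _ D]) (simp add: D)
qed

text \<open>A smooth approximation of the indicator of the open box from below. \<open>Suc m\<close>
  keeps the slopes nonzero, and the affine arguments are written to match
  \<open>bump_class.base\<close>.\<close>

definition box_bump :: "real ^ 'n::finite \<Rightarrow> real ^ 'n \<Rightarrow> nat \<Rightarrow> real ^ 'n \<Rightarrow> real" where
  "box_bump a b m x = (\<Prod>i\<in>UNIV. exp_bump 1 (real (Suc m) * x $ i + - (real (Suc m) * a $ i)) *
     exp_bump 1 (- real (Suc m) * x $ i + real (Suc m) * b $ i))"

lemma box_bump_smooth:
  fixes a b :: "real ^ 'n::finite"
  shows "smooth_fun (box_bump a b m)"
proof (rule bump_class_smooth)
  have prod: "bump_class (\<lambda>x. \<Prod>i\<in>A. f i x)" if "finite A" "\<And>i. bump_class (f i)"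
    for A :: "'n set" and f :: "'n \<Rightarrow> real ^ 'n \<Rightarrow> real"
    using that by (induction A) (auto intro: bump_class.intros)
  show "bump_class (box_bump a b m)"
    unfolding box_bump_def by (intro prod bump_class.mult bump_class.base) simp
qed

lemma exp_bump_one: "exp_bump 1 s = (if 0 < s then exp (- (1 / s)) else 0)"
  by (simp add: exp_bump_def)

lemma box_bump_eq:
  "box_bump a b m x = (\<Prod>i\<in>UNIV. exp_bump 1 (real (Suc m) * (x $ i - a $ i)) * exp_bump 1 (real (Suc m) * (b $ i - x $ i)))"
  by (simp add: box_bump_def algebra_simps)

lemma box_bump_nonneg: "0 \<le> box_bump a b m x"
  and box_bump_le: "box_bump a b m x \<le> indicator (box a b) x"
proof -
  show "0 \<le> box_bump a b m x"
    unfolding box_bump_eq by (intro prod_nonneg) (auto simp: exp_bump_one)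
  show "box_bump a b m x \<le> indicator (box a b) x"
  proof (cases "x \<in> box a b")
    case True
    have "box_bump a b m x \<le> 1"
      unfolding box_bump_eq
      by (intro prod_le_1) (auto simp: exp_bump_one intro!: mult_le_one)
    then show ?thesis using True by simp
  next
    case False
    then obtain i where i: "\<not> (a $ i < x $ i \<and> x $ i < b $ i)" by (auto simp: mem_box_cart)
    then have "exp_bump 1 (real (Suc m) * (x $ i - a $ i)) * exp_bump 1 (real (Suc m) * (b $ i - x $ i)) = 0"
      by (auto simp: exp_bump_one zero_less_mult_iff)
    then have "box_bump a b m x = 0"
      unfolding box_bump_eq by (intro prod_zero) auto
    then show ?thesis by simp
  qed
qed

lemma box_bump_tendsto: "(\<lambda>m. box_bump a b m x) \<longlonglongrightarrow> indicator (box a b) x"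
proof (cases "x \<in> box a b")
  case True
  have one: "(\<lambda>m. exp_bump 1 (real (Suc m) * s)) \<longlonglongrightarrow> 1" if "0 < s" for s
  proof -
    have "(\<lambda>m. exp (- (inverse (real (Suc m)) * (1 / s)))) \<longlonglongrightarrow> exp (- (0 * (1 / s)))"
      by (intro tendsto_intros LIMSEQ_inverse_real_of_nat)
    then show ?thesis using that by (simp add: exp_bump_one divide_inverse mult.commute)
  qed
  have "(\<lambda>m. box_bump a b m x) \<longlonglongrightarrow> (\<Prod>i\<in>(UNIV::'a set). 1 * 1)"
    unfolding box_bump_eq using True by (intro tendsto_prod tendsto_mult one) (auto simp: mem_box_cart)
  then show ?thesis using True by simp
next
  case False
  have "box_bump a b m x = 0" for m
    using box_bump_nonneg[of a b m x] box_bump_le[of a b m x] False by simp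
  then show ?thesis using False by simp
qed

lemma box_bump_test_fun:
  assumes "cbox a b \<subseteq> S"
  shows "test_fun S (box_bump a b m)"
proof -
  have "{x. box_bump a b m x \<noteq> 0} \<subseteq> cbox a b"
  proof
    fix x assume "x \<in> {x. box_bump a b m x \<noteq> 0}"
    then have "x \<in> box a b"
      using box_bump_nonneg[of a b m x] box_bump_le[of a b m x] by (cases "x \<in> box a b") auto
    then show "x \<in> cbox a b" using box_subset_cbox by blast
  qed
  then have sub: "closure {x. box_bump a b m x \<noteq> 0} \<subseteq> cbox a b"
    by (rule closure_minimal) (rule closed_cbox)
  then have "compact (closure {x. box_bump a b m x \<noteq> 0})"
    using compact_cbox bounded_subset[OF bounded_cbox] compact_eq_bounded_closed closed_closure by blast
  then show ?thesis
    using sub assms by (auto simp: test_fun_def box_bump_smooth)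
qed

text \<open>Boxes are an intersection-stable generator of the Borel sets, so a Dynkin argument
  extends the vanishing of integrals to all of these. For complements the total integral is needed;
  it is a box integral because \<open>f\<close> is supported in a box.\<close>

lemma AE_zero_of_box_integrals:
  fixes f :: "'a::euclidean_space \<Rightarrow> real"
  assumes f: "integrable lborel f" and supp: "\<And>x. x \<notin> box a b \<Longrightarrow> f x = 0"
    and box: "\<And>c d. (LINT x:box c d|lborel. f x) = 0"
  shows "AE x in lborel. f x = 0"
proof (rule sigma_finite_measure.density_zero[OF sigma_finite_lborel f])
  fix A :: "'a set" assume "A \<in> sets lborel"
  then have A: "A \<in> sigma_sets UNIV (range (\<lambda>(a, b). box a b))"
    unfolding sets_lborel borel_eq_box by simp
  have "Int_stable (range (\<lambda>(a, b). box a b :: 'a set))"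
    by (auto simp: Int_stable_def box_Int_box)
  moreover have "range (\<lambda>(a, b). box a b) \<subseteq> Pow (UNIV :: 'a set)" by auto
  ultimately have "A \<in> sets borel \<and> (LINT x:A|lborel. f x) = 0"
    using A
  proof (induction rule: sigma_sets_induct_disjoint)
    case (basic A)
    then show ?case using box by auto
  next
    case (compl A)
    have "(LINT x:box a b|lborel. f x) = (LINT x|lborel. f x)"
      unfolding set_lebesgue_integral_def using supp
      by (intro Bochner_Integration.integral_cong) (auto split: split_indicator)
    then have 0: "(LINT x:UNIV|lborel. f x) = 0" using box by (simp add: set_lebesgue_integral_def)
    have i: "set_integrable lborel B f" if "B \<in> sets borel" for B
      using f that unfolding set_integrable_def by (intro integrable_mult_indicator) auto
    have "(LINT x:A \<union> (UNIV - A)|lborel. f x) = (LINT x:A|lborel. f x) + (LINT x:UNIV - A|lborel. f x)"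
      using compl by (intro set_integral_Un i) auto
    then show ?case using compl 0 by auto
  next
    case (union A)
    then have A: "\<And>i. A i \<in> sets borel" by blast
    have "set_integrable lborel (\<Union>i. A i) f"
      using f A unfolding set_integrable_def by (intro integrable_mult_indicator) auto
    then have "(LINT x:(\<Union>i. A i)|lborel. f x) = (\<Sum>i. LINT x:A i|lborel. f x)"
      using union(1) A by (intro lebesgue_integral_countable_add) (auto simp: disjoint_family_on_def)
    then show ?case using union A by auto
  qed (simp add: set_lebesgue_integral_def)
  then show "(LINT x:A|lborel. f x) = 0" by simp
qed

lemma weak_grad_component_integrable:
  assumes G: "weak_grad S u G" and sub: "cbox a b \<subseteq> S" and A: "A \<in> sets lebesgue" "A \<subseteq> cbox a b"
  shows "integrable lebesgue (\<lambda>x. indicator A x * G x $ i)"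
proof -
  have "set_integrable lebesgue (cbox a b) G"
    using G sub by (auto simp: weak_grad_def)
  then have "set_integrable lebesgue A G"
    using A by (rule set_integrable_subset)
  then have "integrable lebesgue (\<lambda>x. (indicator A x *\<^sub>R G x) \<bullet> axis i 1)"
    unfolding set_integrable_def by (rule integrable_inner_left)
  then show ?thesis by (simp add: inner_axis)
qed

text \<open>Dominated convergence for the bumps as test functions. The sequence on the left does not
  mention \<open>G\<close>, so two weak gradients of \<open>u\<close> have the same integrals over
  boxes.\<close>

lemma weak_grad_box_integral:
  assumes G: "weak_grad S u G" and sub: "cbox a b \<subseteq> S" and S: "S \<in> sets lebesgue"
  shows "(\<lambda>m. - (LINT x:S|lebesgue. u x * grad (box_bump a b m) x $ i))
    \<longlonglongrightarrow> (LINT x:box a b|lebesgue. G x $ i)"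
proof -
  let ?G = "\<lambda>x. indicator (cbox a b) x * G x $ i"
  have inti: "integrable lebesgue ?G"
    by (rule weak_grad_component_integrable[OF G sub]) auto
  have "(\<lambda>m. LINT x|lebesgue. box_bump a b m x * ?G x)
      \<longlonglongrightarrow> (LINT x|lebesgue. indicator (box a b) x * ?G x)"
  proof (rule integral_dominated_convergence[where w="\<lambda>x. \<bar>?G x\<bar>"])
    have [measurable]: "box_bump a b m \<in> borel_measurable lebesgue" for m
      using smooth_fun_borel[OF box_bump_smooth] by (intro borel_imp_lebesgue_measurable) auto
    note [measurable] = borel_measurable_integrable[OF inti]
    have [measurable]: "box a b \<in> sets lebesgue" by simp
    show "(\<lambda>x. box_bump a b m x * ?G x) \<in> borel_measurable lebesgue" for m
      by measurable
    show "(\<lambda>x. indicator (box a b) x * ?G x) \<in> borel_measurable lebesgue"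
      by measurable
    show "integrable lebesgue (\<lambda>x. \<bar>?G x\<bar>)" using inti by simp
    show "AE x in lebesgue. (\<lambda>m. box_bump a b m x * ?G x)
        \<longlonglongrightarrow> indicator (box a b) x * ?G x"
      by (intro AE_I2 tendsto_mult box_bump_tendsto tendsto_const)
    show "AE x in lebesgue. norm (box_bump a b m x * ?G x) \<le> \<bar>?G x\<bar>" for m
    proof (rule AE_I2)
      fix x :: "real ^ 'a"
      have "\<bar>box_bump a b m x\<bar> \<le> 1"
        using box_bump_nonneg[of a b m x] box_bump_le[of a b m x] by (auto split: split_indicator_asm)
      then show "norm (box_bump a b m x * ?G x) \<le> \<bar>?G x\<bar>"
        by (simp add: abs_mult mult_left_le_one_le)
    qed
  qed
  moreover have "(LINT x|lebesgue. indicator (box a b) x * ?G x) = (LINT x:box a b|lebesgue. G x $ i)"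
    unfolding set_lebesgue_integral_def
    using box_subset_cbox[of a b] by (intro Bochner_Integration.integral_cong) (auto split: split_indicator)
  moreover have "(LINT x|lebesgue. box_bump a b m x * ?G x) =
      - (LINT x:S|lebesgue. u x * grad (box_bump a b m) x $ i)" for m
  proof -
    have "box_bump a b m x = 0" if "x \<notin> cbox a b" for x
      using that box_bump_nonneg[of a b m x] box_bump_le[of a b m x] box_subset_cbox[of a b]
      by (auto split: split_indicator_asm)
    then have "(LINT x|lebesgue. box_bump a b m x * ?G x) = (LINT x:S|lebesgue. G x $ i * box_bump a b m x)"
      unfolding set_lebesgue_integral_def
      using sub by (intro Bochner_Integration.integral_cong) (auto split: split_indicator)
    then show ?thesis
      using G box_bump_test_fun[OF sub, of m] by (simp add: weak_grad_def)
  qed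
  ultimately show ?thesis by simp
qed

lemma weak_grad_unique:
  fixes G G' :: "real ^ 'n::finite \<Rightarrow> real ^ 'n"
  assumes G: "weak_grad S u G" and G': "weak_grad S u G'" and S: "open S"
  shows "AE x in lebesgue. x \<in> S \<longrightarrow> G x = G' x"
proof -
  have Sl: "S \<in> sets lebesgue" using S by simp
  have comp: "AE x in lebesgue. x \<in> box a b \<longrightarrow> G x $ i = G' x $ i" if sub: "cbox a b \<subseteq> S" for a b i
  proof -
    define f where "f x = indicator (box a b) x * (G x $ i - G' x $ i)" for x
    have "integrable lebesgue (\<lambda>x. indicator (box a b) x * H x $ i)" if "weak_grad S u H" for H
      by (rule weak_grad_component_integrable[OF that sub]) (auto simp: box_subset_cbox)
    then have f: "integrable lebesgue f"
      unfolding f_def right_diff_distrib using G G' by (intro Bochner_Integration.integrable_diff) auto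
    \<comment> \<open>The Dynkin argument works for Borel functions and \<open>lborel\<close>, so
      \<open>f\<close> is replaced by a Borel representative, cut off once more to restore its
      support.\<close>
    then obtain g where g: "g \<in> borel_measurable lborel" "AE x in lborel. f x = g x"
      using completion_ex_borel_measurable_real[of f lborel] by auto
    define h where "h x = indicator (box a b) x * g x" for x
    have h [measurable]: "h \<in> borel_measurable borel" using g by (simp add: h_def[abs_def])
    have fh: "AE x in lebesgue. f x = h x"
      using AE_completion[OF g(2)] by eventually_elim (auto simp: h_def f_def split: split_indicator)
    have hl: "h \<in> borel_measurable lebesgue" using h by (rule borel_imp_lebesgue_measurable)
    have "integrable lebesgue h"
      using f fh hl by (subst integrable_cong_AE[where g=f]) (auto elim: eventually_mono)
    then have hi: "integrable lborel h" using integrable_completion[of h lborel] by simp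
    have "AE x in lborel. h x = 0"
    proof (rule AE_zero_of_box_integrals[OF hi])
      show "h x = 0" if "x \<notin> box a b" for x using that by (simp add: h_def)
      fix c d
      \<comment> \<open>The part of an arbitrary box inside \<open>box a b\<close> is again a box,
        with its closure in \<open>S\<close>; an empty intersection is represented by a box whose
        closed version is empty as well.\<close>
      obtain c' d' where cd: "box c d \<inter> box a b = box c' d'" "cbox c' d' \<subseteq> S"
      proof (cases "box c d \<inter> box a b = {}")
        case True
        moreover have "box 1 0 = ({} :: (real ^ 'n) set)" "cbox 1 0 = ({} :: (real ^ 'n) set)"
          unfolding interval_eq_empty_cart by simp_all
        ultimately show ?thesis using that[of 1 0] by simp
      next
        case False
        obtain c' d' where cd: "box c d \<inter> box a b = box c' d'" using box_Int_box[of c d a b] by blast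
        then have "box c' d' \<noteq> {}" "box c' d' \<subseteq> box a b" using False by auto
        then have "closure (box c' d') \<subseteq> closure (box a b)" "box a b \<noteq> {}"
          using closure_mono[of "box c' d'" "box a b"] by auto
        then have "cbox c' d' \<subseteq> cbox a b"
          using \<open>box c' d' \<noteq> {}\<close> by (simp add: closure_box)
        then show ?thesis using that[of c' d'] cd sub by blast
      qed
      have m: "(\<lambda>x. indicator (box c d) x *\<^sub>R h x) \<in> borel_measurable borel" by measurable
      have "(LINT x:box c d|lborel. h x) = (LINT x:box c d|lebesgue. h x)"
        unfolding set_lebesgue_integral_def using m by (subst integral_completion) auto
      also have "\<dots> = (LINT x:box c d|lebesgue. f x)"
        unfolding set_lebesgue_integral_def
      proof (rule integral_cong_AE)
        show "(\<lambda>x. indicator (box c d) x *\<^sub>R h x) \<in> borel_measurable lebesgue"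
          using m by (rule borel_imp_lebesgue_measurable)
        show "(\<lambda>x. indicator (box c d) x *\<^sub>R f x) \<in> borel_measurable lebesgue"
          using f by (intro borel_measurable_scaleR borel_measurable_indicator) auto
        show "AE x in lebesgue. indicator (box c d) x *\<^sub>R h x = indicator (box c d) x *\<^sub>R f x"
          using fh by eventually_elim simp
      qed
      also have "\<dots> = (LINT x|lebesgue. indicator (box c' d') x *\<^sub>R G x $ i - indicator (box c' d') x *\<^sub>R G' x $ i)"
        unfolding set_lebesgue_integral_def cd(1)[symmetric] f_def
        by (intro Bochner_Integration.integral_cong) (auto split: split_indicator)
      also have "\<dots> = (LINT x:box c' d'|lebesgue. G x $ i) - (LINT x:box c' d'|lebesgue. G' x $ i)"
      proof -
        have "integrable lebesgue (\<lambda>x. indicator (box c' d') x * H x $ i)" if "weak_grad S u H" for H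
          by (rule weak_grad_component_integrable[OF that cd(2)]) (auto simp: box_subset_cbox)
        then show ?thesis
          unfolding set_lebesgue_integral_def real_scaleR_def
          using G G' by (intro Bochner_Integration.integral_diff) auto
      qed
      also have "\<dots> = 0"
        using LIMSEQ_unique[OF weak_grad_box_integral[OF G cd(2) Sl] weak_grad_box_integral[OF G' cd(2) Sl], of i] by simp
      finally show "(LINT x:box c d|lborel. h x) = 0" .
    qed
    then have "AE x in lebesgue. h x = 0" by (rule AE_completion)
    then show ?thesis
      using fh by eventually_elim (auto simp: f_def)
  qed
  obtain \<D> where \<D>: "countable \<D>" "\<D> \<subseteq> Pow S" "\<And>X. X \<in> \<D> \<Longrightarrow> \<exists>a b. X = cbox a b" "\<Union>\<D> = S"
    using open_countable_Union_open_cbox[OF S] by blast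
  have "\<forall>X\<in>\<D>. AE x in lebesgue. x \<in> X \<longrightarrow> G x = G' x"
  proof
    fix X assume X: "X \<in> \<D>"
    then obtain a b where ab: "X = cbox a b" using \<D> by blast
    have sub: "cbox a b \<subseteq> S" using X ab \<D> by blast
    \<comment> \<open>The comparison was made on open boxes; the faces of the closed ones are null
      sets.\<close>
    have "AE x in lebesgue. x \<notin> cbox a b - box a b"
      by (rule AE_not_in) (simp add: null_sets_cbox_Diff_box null_sets_completionI)
    moreover have "AE x in lebesgue. \<forall>i\<in>UNIV. x \<in> box a b \<longrightarrow> G x $ i = G' x $ i"
      using comp[OF sub] by (subst AE_finite_all) auto
    ultimately show "AE x in lebesgue. x \<in> X \<longrightarrow> G x = G' x"
      unfolding ab by eventually_elim (auto simp: vec_eq_iff)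
  qed
  then have "AE x in lebesgue. \<forall>X\<in>\<D>. x \<in> X \<longrightarrow> G x = G' x"
    by (rule AE_ball_countable[OF \<D>(1), THEN iffD2])
  then show ?thesis
    by eventually_elim (use \<D>(4) in auto)
qed

section \<open>Integration in time\<close>

text \<open>Mean square convergence gives almost everywhere convergence after passing to a
  subsequence. Uniqueness of weak gradients identifies the gradient supplied by the trace with the
  prescribed \<open>W\<close>.\<close>

lemma H1_0L_trace_approx:
  assumes u: "u \<in> H1_0L k R" and W: "weak_grad (half_ball k R) u W"
  obtains G v where "trace_approx k R (\<lambda>x. indicator (half_ball k R) x *\<^sub>R u x) G v"
    "AE x in lebesgue. x \<in> half_ball k R \<longrightarrow> G x = W x"
proof -
  let ?B = "half_ball k R"
  have uL2: "L2_on lebesgue ?B u" using u by (auto simp: H1_0L_def H1_def)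
  obtain G v where G: "weak_grad ?B u G" "L2_on lebesgue ?B G" and v: "\<And>j::nat. smooth_fun (v j)"
    and lim: "(\<lambda>j. half_ball_int k R (\<lambda>x. (v j x - u x)\<^sup>2 + (norm (grad (v j) x - G x))\<^sup>2)) \<longlonglongrightarrow> 0"
    and flat: "(\<lambda>j. \<integral>\<^sup>+x\<in>flat_part k R. ennreal ((v j x - 0)\<^sup>2) \<partial>hyperplane_measure k) \<longlonglongrightarrow> 0"
    using u unfolding H1_0L_def has_flat_trace_def by blast
  define u1 where "u1 = (\<lambda>x. indicator ?B x *\<^sub>R u x)"
  define G1 where "G1 = (\<lambda>x. indicator ?B x *\<^sub>R G x)"
  have u1 [measurable]: "u1 \<in> borel_measurable lebesgue"
    using uL2 unfolding L2_on_def u1_def by (simp add: borel_measurable_restrict_space_iff)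
  have G1 [measurable]: "G1 \<in> borel_measurable lebesgue"
    using G(2) unfolding L2_on_def G1_def by (simp add: borel_measurable_restrict_space_iff)
  have [measurable]: "v j \<in> borel_measurable lebesgue" for j
    using smooth_fun_borel[OF v] by (auto intro: borel_imp_lebesgue_measurable)
  have lim_u: "(\<lambda>j. half_ball_int k R (\<lambda>x. (v j x - u1 x)\<^sup>2)) \<longlonglongrightarrow> 0"
  proof (rule tendsto_sandwich[OF _ _ tendsto_const lim])
    show "\<forall>\<^sub>F j in sequentially. half_ball_int k R (\<lambda>x. (v j x - u1 x)\<^sup>2)
      \<le> half_ball_int k R (\<lambda>x. (v j x - u x)\<^sup>2 + (norm (grad (v j) x - G x))\<^sup>2)"
      by (intro always_eventually allI set_nn_integral_real_mono) (simp add: u1_def)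
  qed simp
  have lim_G: "(\<lambda>j. half_ball_int k R (\<lambda>x. (norm (grad (v j) x - G1 x))\<^sup>2)) \<longlonglongrightarrow> 0"
  proof (rule tendsto_sandwich[OF _ _ tendsto_const lim])
    show "\<forall>\<^sub>F j in sequentially. half_ball_int k R (\<lambda>x. (norm (grad (v j) x - G1 x))\<^sup>2)
      \<le> half_ball_int k R (\<lambda>x. (v j x - u x)\<^sup>2 + (norm (grad (v j) x - G x))\<^sup>2)"
      by (intro always_eventually allI set_nn_integral_real_mono) (simp add: G1_def)
  qed simp
  define w where "w j x = indicator ?B x * (v j x - u1 x)\<^sup>2" for j x
  have w_nn: "(\<integral>\<^sup>+x. ennreal (w j x) \<partial>lebesgue) = half_ball_int k R (\<lambda>x. (v j x - u1 x)\<^sup>2)" for j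
    by (intro nn_integral_cong) (auto simp: w_def split: split_indicator)
  have [measurable]: "w j \<in> borel_measurable lebesgue" for j
    unfolding w_def by measurable
  \<comment> \<open>The limit bounds the integrals only from some index on; the sequence starting at
    \<open>J\<close> is integrable throughout.\<close>
  obtain J where J: "\<And>j. J \<le> j \<Longrightarrow> (\<integral>\<^sup>+x. ennreal (w j x) \<partial>lebesgue) < 1"
    using order_tendstoD(2)[OF lim_u, of 1] by (auto simp: eventually_sequentially w_nn)
  have w_int: "integrable lebesgue (w (j + J))" for j
    using J[of "j + J"] by (auto simp: integrable_iff_bounded w_def intro: less_trans)
  have "(\<lambda>j. \<integral>x. norm (w (j + J) x) \<partial>lebesgue) \<longlonglongrightarrow> 0"
  proof -
    have "(\<integral>x. norm (w (j + J) x) \<partial>lebesgue) = enn2real (half_ball_int k R (\<lambda>x. (v (j + J) x - u1 x)\<^sup>2))" for j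
    proof -
      have "(\<integral>x. norm (w (j + J) x) \<partial>lebesgue) = (\<integral>x. w (j + J) x \<partial>lebesgue)"
        by (intro Bochner_Integration.integral_cong) (auto simp: w_def)
      also have "\<dots> = enn2real (\<integral>\<^sup>+x. ennreal (w (j + J) x) \<partial>lebesgue)"
        by (intro integral_eq_nn_integral) (auto simp: w_def)
      finally show ?thesis by (simp add: w_nn)
    qed
    moreover have "(\<lambda>j. enn2real (half_ball_int k R (\<lambda>x. (v (j + J) x - u1 x)\<^sup>2))) \<longlonglongrightarrow> enn2real 0"
      using LIMSEQ_ignore_initial_segment[OF lim_u, of J] by (intro tendsto_enn2real) simp_all
    ultimately show ?thesis by simp
  qed
  from tendsto_L1_AE_subseq[where u="\<lambda>j. w (j + J)", OF w_int this] obtain r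
    where r: "strict_mono r" "AE x in lebesgue. (\<lambda>j. w (r j + J) x) \<longlonglongrightarrow> 0" by blast
  define s where "s j = r j + J" for j
  have s: "strict_mono s" using r(1) by (simp add: s_def strict_mono_def)
  have AE_v: "AE x in lebesgue. x \<in> ?B \<longrightarrow> (\<lambda>j. v (s j) x) \<longlonglongrightarrow> u1 x"
    using r(2)
  proof eventually_elim
    case (elim x)
    show ?case
    proof
      assume "x \<in> ?B"
      then have "(\<lambda>j. (v (s j) x - u1 x)\<^sup>2) \<longlonglongrightarrow> 0" using elim by (simp add: w_def s_def)
      then have "(\<lambda>j. sqrt ((v (s j) x - u1 x)\<^sup>2)) \<longlonglongrightarrow> sqrt 0" by (rule tendsto_real_sqrt)
      then have "(\<lambda>j. v (s j) x - u1 x) \<longlonglongrightarrow> 0" by (simp add: tendsto_rabs_zero_iff)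
      then show "(\<lambda>j. v (s j) x) \<longlonglongrightarrow> u1 x" by (rule LIM_zero_cancel)
    qed
  qed
  have "trace_approx k R u1 G1 (\<lambda>j. v (s j))"
  proof
    have "half_ball_int k R (\<lambda>x. (u1 x)\<^sup>2) = half_ball_int k R (\<lambda>x. (norm (u x))\<^sup>2)"
      by (intro nn_integral_cong) (auto simp: u1_def split: split_indicator)
    then show "half_ball_int k R (\<lambda>x. (u1 x)\<^sup>2) < \<infinity>"
      using uL2 by (simp add: L2_on_def)
    have "half_ball_int k R (\<lambda>x. (norm (G1 x))\<^sup>2) = half_ball_int k R (\<lambda>x. (norm (G x))\<^sup>2)"
      by (intro nn_integral_cong) (auto simp: G1_def split: split_indicator)
    then show "half_ball_int k R (\<lambda>x. (norm (G1 x))\<^sup>2) < \<infinity>"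
      using G(2) by (simp add: L2_on_def)
    show "(\<lambda>j. half_ball_int k R (\<lambda>x. (v (s j) x - u1 x)\<^sup>2)) \<longlonglongrightarrow> 0"
      using LIMSEQ_subseq_LIMSEQ[OF lim_u s] by (simp add: o_def)
    show "(\<lambda>j. half_ball_int k R (\<lambda>x. (norm (grad (v (s j)) x - G1 x))\<^sup>2)) \<longlonglongrightarrow> 0"
      using LIMSEQ_subseq_LIMSEQ[OF lim_G s] by (simp add: o_def)
    show "(\<lambda>j. \<integral>\<^sup>+x\<in>flat_part k R. ennreal ((v (s j) x)\<^sup>2) \<partial>hyperplane_measure k) \<longlonglongrightarrow> 0"
      using LIMSEQ_subseq_LIMSEQ[OF flat s] by (simp add: o_def)
  qed (use u1 G1 v AE_v in auto)
  moreover have "open ?B"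
    unfolding half_ball_def by (intro open_Int open_ball open_halfspace_component_gt_cart)
  then have "AE x in lebesgue. x \<in> ?B \<longrightarrow> G1 x = W x"
    using weak_grad_unique[OF G(1) W] by (auto simp: G1_def elim: eventually_mono)
  ultimately show ?thesis using that unfolding u1_def by blast
qed

text \<open>Linearity in the energy is what permits integration in time. \<open>W\<close> is
  arbitrary because a slice of \<open>spatial_grad\<close> is only known to be some weak gradient,
  at almost every time.\<close>

definition slice_ineq :: "'n::finite \<Rightarrow> real \<Rightarrow> real \<Rightarrow> real \<Rightarrow> real \<Rightarrow> bool" where
  "slice_ineq k R p q K \<longleftrightarrow> (\<forall>u W a. u \<in> H1_0L k R \<longrightarrow> weak_grad (half_ball k R) u W \<longrightarrow> 0 \<le> a \<longrightarrow>
     half_ball_int k R (\<lambda>x. (u x)\<^sup>2 * (x $ k) powr p) \<le> ennreal a \<longrightarrow>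
     half_ball_int k R (\<lambda>x. \<bar>u x\<bar> powr (2 * q) * (x $ k) powr p)
       \<le> ennreal (K * a powr (q - 1)) * half_ball_int k R (\<lambda>x. (norm (W x))\<^sup>2))"

lemma slice_ineqI:
  fixes k :: "'n::finite"
  assumes K: "0 \<le> K"
    and *: "\<And>u G v a d. trace_approx k R u G v \<Longrightarrow> trace_approx.energy k R G \<le> ennreal d \<Longrightarrow> 0 \<le> d \<Longrightarrow>
      half_ball_int k R (\<lambda>x. (u x)\<^sup>2 * (x $ k) powr p) \<le> ennreal a \<Longrightarrow> 0 \<le> a \<Longrightarrow>
      half_ball_int k R (\<lambda>x. \<bar>u x\<bar> powr (2 * q) * (x $ k) powr p)
        \<le> ennreal (K * a powr (q - 1) * d)"
  shows "slice_ineq k R p q K"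
  unfolding slice_ineq_def
proof (intro allI impI)
  fix u :: "real ^ 'n \<Rightarrow> real" and W and a :: real
  let ?B = "half_ball k R"
  assume u: "u \<in> H1_0L k R" "weak_grad ?B u W" and a: "0 \<le> a"
    "half_ball_int k R (\<lambda>x. (u x)\<^sup>2 * (x $ k) powr p) \<le> ennreal a"
  obtain G v where T: "trace_approx k R (\<lambda>x. indicator ?B x *\<^sub>R u x) G v"
    and GW: "AE x in lebesgue. x \<in> ?B \<longrightarrow> G x = W x"
    using H1_0L_trace_approx[OF u] by blast
  interpret trace_approx k R "\<lambda>x. indicator ?B x *\<^sub>R u x" G v by (rule T)
  have en: "energy = half_ball_int k R (\<lambda>x. (norm (W x))\<^sup>2)"
    unfolding energy_def
    by (rule nn_integral_cong_AE, use GW in eventually_elim) (auto split: split_indicator)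
  have "energy < \<infinity>" using G_L2 by (simp add: energy_def)
  then obtain d where d: "energy = ennreal d" "0 \<le> d" by (cases energy) auto
  have "half_ball_int k R (\<lambda>x. \<bar>u x\<bar> powr (2 * q) * (x $ k) powr p) =
    half_ball_int k R (\<lambda>x. \<bar>indicator ?B x *\<^sub>R u x\<bar> powr (2 * q) * (x $ k) powr p)"
    by (intro nn_integral_cong) (auto split: split_indicator)
  also have "\<dots> \<le> ennreal (K * a powr (q - 1) * d)"
  proof (rule *[OF T])
    have "half_ball_int k R (\<lambda>x. (indicator ?B x *\<^sub>R u x)\<^sup>2 * (x $ k) powr p) =
      half_ball_int k R (\<lambda>x. (u x)\<^sup>2 * (x $ k) powr p)"
      by (intro nn_integral_cong) (auto split: split_indicator)
    then show "half_ball_int k R (\<lambda>x. (indicator ?B x *\<^sub>R u x)\<^sup>2 * (x $ k) powr p) \<le> ennreal a"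
      using a by simp
  qed (use d a in auto)
  also have "\<dots> = ennreal (K * a powr (q - 1)) * energy"
    unfolding d(1) by (rule ennreal_mult) (use K d in auto)
  finally show "half_ball_int k R (\<lambda>x. \<bar>u x\<bar> powr (2 * q) * (x $ k) powr p)
      \<le> ennreal (K * a powr (q - 1)) * half_ball_int k R (\<lambda>x. (norm (W x))\<^sup>2)"
    unfolding en .
qed

text \<open>Tonelli for the completed measure: \<open>F\<close> agrees with a Borel function off a
  Borel null set, almost all of whose sections are null. \<open>D\<close> is the section integral of
  the Borel function, as that of \<open>F\<close> itself need not be Borel measurable in
  \<open>t\<close>.\<close>

lemma nn_integral_lebesgue_sections:
  fixes F :: "'a::euclidean_space \<times> 'b::euclidean_space \<Rightarrow> ennreal"
  assumes F: "F \<in> borel_measurable lebesgue"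
  obtains D where "D \<in> borel_measurable lborel" "AE t in lborel. (\<integral>\<^sup>+x. F (x, t) \<partial>lborel) = D t"
    "(\<integral>\<^sup>+z. F z \<partial>lebesgue) = (\<integral>\<^sup>+t. D t \<partial>lborel)"
proof -
  obtain F' where F' [measurable]: "F' \<in> borel_measurable lborel" and AE: "AE z in lborel. F z = F' z"
    using completion_ex_borel_measurable[OF F] by blast
  have F'_pair [measurable]: "F' \<in> borel_measurable (lborel \<Otimes>\<^sub>M lborel)"
    unfolding lborel_prod by measurable
  obtain N where N: "N \<in> null_sets lborel" "{z. F z \<noteq> F' z} \<subseteq> N"
    using AE unfolding eventually_ae_filter by auto
  have N_pair [measurable]: "N \<in> sets (lborel \<Otimes>\<^sub>M lborel)" unfolding lborel_prod using N by auto
  have "(\<integral>\<^sup>+t. (\<integral>\<^sup>+x. indicator N (x, t) \<partial>lborel) \<partial>lborel) = (\<integral>\<^sup>+z. indicator N z \<partial>(lborel \<Otimes>\<^sub>M lborel))"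
    by (rule lborel_pair.nn_integral_snd) measurable
  also have "\<dots> = 0" using N by (simp add: lborel_prod null_sets_def)
  finally have "AE t in lborel. (\<integral>\<^sup>+x. indicator N (x, t) \<partial>lborel) = 0"
    by (subst (asm) nn_integral_0_iff_AE) measurable
  then have "AE t in lborel. (\<integral>\<^sup>+x. F (x, t) \<partial>lborel) = (\<integral>\<^sup>+x. F' (x, t) \<partial>lborel)"
  proof eventually_elim
    case (elim t)
    then have "AE x in lborel. indicator N (x, t) = (0 :: ennreal)"
      by (subst (asm) nn_integral_0_iff_AE) measurable
    then have "AE x in lborel. F (x, t) = F' (x, t)"
      by eventually_elim (use N in \<open>auto split: split_indicator_asm\<close>)
    then show ?case by (rule nn_integral_cong_AE)
  qed
  moreover have "(\<integral>\<^sup>+z. F z \<partial>lebesgue) = (\<integral>\<^sup>+t. (\<integral>\<^sup>+x. F' (x, t) \<partial>lborel) \<partial>lborel)"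
  proof -
    have "(\<integral>\<^sup>+z. F z \<partial>lebesgue) = (\<integral>\<^sup>+z. F' z \<partial>lborel)"
      unfolding nn_integral_completion using AE by (rule nn_integral_cong_AE)
    also have "\<dots> = (\<integral>\<^sup>+z. F' z \<partial>(lborel \<Otimes>\<^sub>M lborel))" by (simp add: lborel_prod)
    also have "\<dots> = (\<integral>\<^sup>+t. (\<integral>\<^sup>+x. F' (x, t) \<partial>lborel) \<partial>lborel)"
      by (rule lborel_pair.nn_integral_snd[symmetric]) measurable
    finally show ?thesis .
  qed
  moreover have "(\<lambda>t. \<integral>\<^sup>+x. F' (x, t) \<partial>lborel) \<in> borel_measurable lborel" by measurable
  ultimately show ?thesis using that by blast
qed

lemma AE_lebesgue_on_interval:
  fixes S :: "real set"
  assumes "AE t in lebesgue_on S. P t" "S \<in> sets lebesgue"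
  shows "AE t in lborel. t \<in> S \<longrightarrow> P t"
  using assms by (simp add: AE_restrict_space_iff AE_completion_iff)

lemma cyl_lebesgue: "cyl k R T \<in> sets lebesgue"
proof -
  have "cyl k R T \<in> sets (borel \<Otimes>\<^sub>M borel)"
    unfolding cyl_def by (intro pair_measureI) auto
  then have "cyl k R T \<in> sets borel" unfolding borel_prod .
  then show ?thesis by auto
qed

text \<open>Integrating the slice inequality with the uniform bound \<open>a\<close> gives
  \<open>K * a powr (q - 1) * d\<close>, and the power \<open>1 / q\<close> makes this quadratic in
  the norm.\<close>

lemma V2_embedding_of_slice_ineq:
  fixes k :: "'n::finite"
  assumes slice: "slice_ineq k R p q K" and K: "0 < K" and q: "1 < q"
    and u: "u \<in> Linf_L2w k p R T" "u \<in> L2_H1_0L k R T"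
  shows "V2_embedding_ineq k p R T q (K powr (1 / q)) u"
proof -
  let ?B = "half_ball k R" and ?Q = "cyl k R T" and ?I = "{- T<..0::real}"
  let ?g = "spatial_grad k R T u"
  let ?w = "\<lambda>x t. \<bar>u x t\<bar> powr (2 * q) * (x $ k) powr p"
  define A where "A = sup_weighted_L2 k p R T u"
  define D where "D = (\<integral>\<^sup>+z\<in>?Q. ennreal ((norm (?g (fst z) (snd z)))\<^sup>2) \<partial>lebesgue)"
  have Q [measurable]: "?Q \<in> sets lebesgue" by (rule cyl_lebesgue)
  have "A < \<infinity>" using u by (simp add: Linf_L2w_def A_def)
  then obtain a where a: "A = ennreal a" "0 \<le> a" by (cases A) auto
  have gL2: "L2_on lebesgue ?Q (\<lambda>(x, t). ?g x t)" using u by (simp add: L2_H1_0L_def)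
  then have "D < \<infinity>" by (simp add: D_def L2_on_def case_prod_beta)
  then obtain d where d: "D = ennreal d" "0 \<le> d" by (cases D) auto
  have V2: "(V2_norm k p R T u)\<^sup>2 = a + d"
    using a d unfolding V2_norm_def A_def[symmetric] D_def[symmetric]
    by (simp flip: ennreal_plus)
  have sg: "is_spatial_grad k R T u ?g"
  proof -
    have "\<exists>G. is_spatial_grad k R T u G" using u by (simp add: L2_H1_0L_def)
    then show ?thesis unfolding spatial_grad_def by (rule someI_ex)
  qed
  have AE_grad: "AE t in lborel. t \<in> ?I \<longrightarrow> weak_grad ?B (\<lambda>x. u x t) (\<lambda>x. ?g x t)"
    using sg unfolding is_spatial_grad_def by (intro AE_lebesgue_on_interval) auto
  have AE_H1: "AE t in lborel. t \<in> ?I \<longrightarrow> (\<lambda>x. u x t) \<in> H1_0L k R"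
    using u unfolding L2_H1_0L_def by (intro AE_lebesgue_on_interval) auto
  have AE_sup: "AE t in lborel. t \<in> {- T<..<0} \<longrightarrow> half_ball_int k R (\<lambda>x. (u x t)\<^sup>2 * (x $ k) powr p) \<le> ennreal a"
    unfolding a(1)[symmetric] A_def sup_weighted_L2_def
    by (intro AE_lebesgue_on_interval esssup_AE) auto
  define U where "U z = indicator ?Q z *\<^sub>R u (fst z) (snd z)" for z
  define V where "V z = indicator ?Q z *\<^sub>R ?g (fst z) (snd z)" for z
  have U [measurable]: "U \<in> borel_measurable lebesgue"
    using u Q unfolding Linf_L2w_def U_def[abs_def]
    by (simp add: borel_measurable_restrict_space_iff case_prod_beta)
  have V [measurable]: "V \<in> borel_measurable lebesgue"
    using gL2 Q unfolding L2_on_def V_def[abs_def]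
    by (simp add: borel_measurable_restrict_space_iff case_prod_beta)
  have xk [measurable]: "(\<lambda>z. fst z $ k) \<in> borel_measurable (lebesgue :: ((real ^ 'n) \<times> real) measure)"
  proof (rule borel_imp_lebesgue_measurable)
    show "(\<lambda>z. fst z $ k) \<in> borel_measurable (borel :: ((real ^ 'n) \<times> real) measure)"
      unfolding borel_prod[symmetric] by measurable
  qed
  define F where "F z = ennreal (\<bar>U z\<bar> powr (2 * q) * (fst z $ k) powr p) * indicator ?Q z" for z
  define H where "H z = ennreal ((norm (V z))\<^sup>2) * indicator ?Q z" for z
  have F: "F \<in> borel_measurable lebesgue" unfolding F_def by measurable
  have H: "H \<in> borel_measurable lebesgue" unfolding H_def by measurable
  obtain Ft where Ft: "Ft \<in> borel_measurable lborel" "AE t in lborel. (\<integral>\<^sup>+x. F (x, t) \<partial>lborel) = Ft t"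
    "(\<integral>\<^sup>+z. F z \<partial>lebesgue) = (\<integral>\<^sup>+t. Ft t \<partial>lborel)"
    using nn_integral_lebesgue_sections[OF F] by blast
  obtain Ht where Ht: "Ht \<in> borel_measurable lborel" "AE t in lborel. (\<integral>\<^sup>+x. H (x, t) \<partial>lborel) = Ht t"
    "(\<integral>\<^sup>+z. H z \<partial>lebesgue) = (\<integral>\<^sup>+t. Ht t \<partial>lborel)"
    using nn_integral_lebesgue_sections[OF H] by blast
  let ?c = "ennreal (K * a powr (q - 1))"
  have "AE t in lborel. Ft t \<le> ?c * Ht t"
    \<comment> \<open>The essential supremum is taken over the open time interval; the final time 0
      is removed as a null set.\<close>
    using AE_grad AE_H1 AE_sup Ft(2) Ht(2) AE_lborel_singleton[of 0]
  proof eventually_elim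
    case (elim t)
    show ?case
    proof (cases "t \<in> ?I")
      case True
      have "(\<integral>\<^sup>+x. F (x, t) \<partial>lborel) = half_ball_int k R (\<lambda>x. ?w x t)"
        unfolding nn_integral_completion
        using True by (intro nn_integral_cong) (auto simp: F_def U_def cyl_def split: split_indicator)
      moreover have "(\<integral>\<^sup>+x. H (x, t) \<partial>lborel) = half_ball_int k R (\<lambda>x. (norm (?g x t))\<^sup>2)"
        unfolding nn_integral_completion
        using True by (intro nn_integral_cong) (auto simp: H_def V_def cyl_def split: split_indicator)
      moreover have "half_ball_int k R (\<lambda>x. ?w x t)
        \<le> ?c * half_ball_int k R (\<lambda>x. (norm (?g x t))\<^sup>2)"
        using slice[unfolded slice_ineq_def] elim True a(2) by auto
      ultimately show ?thesis using elim by simp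
    next
      case False
      then have "(\<integral>\<^sup>+x. F (x, t) \<partial>lborel) = (\<integral>\<^sup>+x. 0 \<partial>(lborel :: (real ^ 'n) measure))"
        by (intro nn_integral_cong) (auto simp: F_def cyl_def)
      then show ?thesis using elim by simp
    qed
  qed
  then have "(\<integral>\<^sup>+t. Ft t \<partial>lborel) \<le> (\<integral>\<^sup>+t. ?c * Ht t \<partial>lborel)" by (rule nn_integral_mono_AE)
  also have "\<dots> = ?c * (\<integral>\<^sup>+t. Ht t \<partial>lborel)" using Ht(1) by (rule nn_integral_cmult)
  also have "(\<integral>\<^sup>+t. Ht t \<partial>lborel) = D"
    unfolding Ht(3)[symmetric] D_def
    by (intro nn_integral_cong) (auto simp: H_def V_def split: split_indicator)
  also have "?c * D = ennreal (K * a powr (q - 1) * d)"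
    unfolding d(1) by (rule ennreal_mult[symmetric]) (use K d in auto)
  finally have E: "(\<integral>\<^sup>+z. F z \<partial>lebesgue) \<le> ennreal (K * a powr (q - 1) * d)"
    unfolding Ft(3) .
  define f where "f z = indicator ?Q z *\<^sub>R (case z of (x, t) \<Rightarrow> ?w x t)" for z
  have fF: "F z = ennreal (f z)" for z
    by (auto simp: F_def f_def U_def split: split_indicator prod.splits)
  have f_nonneg: "0 \<le> f z" for z by (auto simp: f_def split: split_indicator prod.splits)
  have f_meas: "f \<in> borel_measurable lebesgue"
  proof -
    have "f z = indicator ?Q z * (\<bar>U z\<bar> powr (2 * q) * (fst z $ k) powr p)" for z
      by (auto simp: f_def U_def split: split_indicator prod.splits)
    then have "f = (\<lambda>z. indicator ?Q z * (\<bar>U z\<bar> powr (2 * q) * (fst z $ k) powr p))" by auto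
    then show ?thesis by simp
  qed
  have int: "integrable lebesgue f"
  proof (rule integrableI_nonneg[OF f_meas])
    show "(\<integral>\<^sup>+z. ennreal (f z) \<partial>lebesgue) < \<infinity>"
      using E unfolding fF by (rule le_less_trans) simp
  qed (use f_nonneg in auto)
  have "ennreal (\<integral>z. f z \<partial>lebesgue) \<le> ennreal (K * a powr (q - 1) * d)"
    using E unfolding fF using nn_integral_eq_integral[OF int] f_nonneg by simp
  then have I: "(\<integral>z. f z \<partial>lebesgue) \<le> K * a powr (q - 1) * d"
    using K d by (subst (asm) ennreal_le_iff) auto
  have "(\<integral>z. f z \<partial>lebesgue) powr (1 / q) \<le> (K * (a + d) powr q) powr (1 / q)"
  proof (rule powr_mono2)
    \<comment> \<open>The squared norm is \<open>a + d\<close>, which dominates both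
      factors.\<close>
    have "a powr (q - 1) * d \<le> (a + d) powr (q - 1) * (a + d)"
      using a d q by (intro mult_mono powr_mono2) auto
    also have "\<dots> = (a + d) powr q"
      using a d by (cases "a + d = 0") (auto simp: powr_diff)
    finally have "K * (a powr (q - 1) * d) \<le> K * (a + d) powr q"
      using K by (intro mult_left_mono) auto
    then show "(\<integral>z. f z \<partial>lebesgue) \<le> K * (a + d) powr q" using I by (simp add: mult.assoc)
    show "0 \<le> (\<integral>z. f z \<partial>lebesgue)" by (intro integral_nonneg_AE) (use f_nonneg in auto)
  qed (use q in auto)
  also have "\<dots> = K powr (1 / q) * (a + d)"
    using K q a d by (simp add: powr_mult powr_powr)
  finally have "(\<integral>z. f z \<partial>lebesgue) powr (1 / q) \<le> K powr (1 / q) * (V2_norm k p R T u)\<^sup>2"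
    unfolding V2 .
  then show ?thesis
    using int unfolding V2_embedding_ineq_def set_integrable_def set_lebesgue_integral_def f_def[abs_def] by simp
qed

text \<open>The power of \<open>R\<close> in \<open>K\<close> is \<open>(p + 3) / 2\<close> in
  dimension 1 and \<open>(p + 2) / 2\<close> in dimension 2, as in the slice estimates; the final
  power \<open>2 / 3\<close> turns the denominator 2 into 3.\<close>

lemma V2_embedding_dim_le_2:
  fixes k :: "'n::finite" and p R :: real
  assumes p: "- 2 < p" "p < 0" and n: "CARD('n) = 1 \<or> CARD('n) = 2" and R: "0 < R"
    and u: "u \<in> Linf_L2w k p R T \<inter> L2_H1_0L k R T"
  shows "V2_embedding_ineq k p R T (3 / 2) (24 powr (2 / 3) * R powr ((p + 4 - real CARD('n)) / 3)) u"
proof -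
  define K where "K = 24 * R powr ((p + 4 - real CARD('n)) / 2)"
  have K: "0 < K" using R by (simp add: K_def)
  have slice: "slice_ineq k R p (3 / 2) K"
  proof (rule slice_ineqI)
    fix u G v a d
    assume "trace_approx k R u G v"
    then interpret trace_approx k R u G v .
    assume *: "energy \<le> ennreal d" "0 \<le> d" "B_int (\<lambda>x. (u x)\<^sup>2 * (x $ k) powr p) \<le> ennreal a" "0 \<le> a"
    have "a powr (3 / 2 - 1) = sqrt a" using *(4) by (simp add: powr_half_sqrt)
    then show "B_int (\<lambda>x. \<bar>u x\<bar> powr (2 * (3 / 2)) * (x $ k) powr p) \<le> ennreal (K * a powr (3 / 2 - 1) * d)"
      using n slice_dim1[OF _ p(1) R *] slice_dim2[OF _ p R *] by (auto simp: K_def add.commute)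
  qed (use K in simp)
  have "K powr (1 / (3 / 2)) = 24 powr (2 / 3) * R powr ((p + 4 - real CARD('n)) / 3)"
  proof -
    have "(p + 4 - real CARD('n)) / 2 * (1 / (3 / 2)) = (p + 4 - real CARD('n)) / 3"
      "1 / (3 / 2) = (2 / 3 :: real)" by simp_all
    then show ?thesis by (simp only: K_def powr_mult powr_powr)
  qed
  then show ?thesis
    using V2_embedding_of_slice_ineq[OF slice K, of u T] u by simp
qed

theorem theorem2p10:
  fixes p :: real
  assumes "- 2 < p" and "p < 0"
  shows
    "(CARD('n::finite) \<ge> 3 \<longrightarrow>
       (\<exists>C>0. \<forall>(k::'n) R T. R > 0 \<and> T > 0 \<longrightarrow>
          (\<forall>u \<in> Linf_L2w k p R T \<inter> L2_H1_0L k R T.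
             V2_embedding_ineq k p R T
               ((real CARD('n) + 2 * p + 2) / (real CARD('n) + p)) C u))) \<and>
     (\<exists>C>0.
       (\<forall>(k::1) R T. R > 0 \<and> T > 0 \<longrightarrow>
          (\<forall>u \<in> Linf_L2w k p R T \<inter> L2_H1_0L k R T.
             V2_embedding_ineq k p R T (3 / 2) (C * R powr ((p + 4 - 1) / 3)) u)) \<and>
       (\<forall>(k::2) R T. R > 0 \<and> T > 0 \<longrightarrow>
          (\<forall>u \<in> Linf_L2w k p R T \<inter> L2_H1_0L k R T.
             V2_embedding_ineq k p R T (3 / 2) (C * R powr ((p + 4 - 2) / 3)) u)))"
proof (intro conjI impI)
  assume n: "3 \<le> CARD('n)"
  define N where "N = real CARD('n)"
  define Cs where "Cs = (2 powr N * (4 * (N - 1) / (N - 2)) powr (N / (N - 1))) powr (2 * (N - 1) / (N - 2))"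
  define K where "K = 8 powr ((N - 2) / (N + p) * (- p / 2)) * Cs powr ((N - 2) / (N + p) * (1 + p / 2))"
  define q where "q = (N + 2 * p + 2) / (N + p)"
  have N: "3 \<le> N" "N + p > 0" using n assms by (auto simp: N_def)
  \<comment> \<open>The power of \<open>a\<close> in the slice estimate is exactly
    \<open>q - 1\<close>, as \<open>slice_ineq\<close> requires.\<close>
  have q1: "q - 1 = (p + 2) / (N + p)" using N by (simp add: q_def field_simps)
  have "0 < (p + 2) / (N + p)" using N assms by (intro divide_pos_pos) auto
  then have q: "1 < q" using q1 by linarith
  have "0 < Cs" using N by (simp add: Cs_def)
  then have K: "0 < K" by (simp add: K_def)
  have slice: "slice_ineq k R p q K" for k :: 'n and R
  proof (rule slice_ineqI)
    fix u G v a d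
    assume "trace_approx k R u G v"
    then interpret trace_approx k R u G v .
    assume *: "energy \<le> ennreal d" "0 \<le> d" "B_int (\<lambda>x. (u x)\<^sup>2 * (x $ k) powr p) \<le> ennreal a" "0 \<le> a"
    show "B_int (\<lambda>x. \<bar>u x\<bar> powr (2 * q) * (x $ k) powr p) \<le> ennreal (K * a powr (q - 1) * d)"
      using slice_high[OF n assms *] unfolding q1 by (simp only: q_def N_def K_def Cs_def)
  qed (use K in simp)
  show "\<exists>C>0. \<forall>(k::'n) R T. R > 0 \<and> T > 0 \<longrightarrow>
          (\<forall>u \<in> Linf_L2w k p R T \<inter> L2_H1_0L k R T.
             V2_embedding_ineq k p R T ((real CARD('n) + 2 * p + 2) / (real CARD('n) + p)) C u)"
    using V2_embedding_of_slice_ineq[OF slice K q] K unfolding q_def N_def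
    by (intro exI[of _ "K powr (1 / q)"]) (auto simp: q_def N_def)
next
  show "\<exists>C>0.
       (\<forall>(k::1) R T. R > 0 \<and> T > 0 \<longrightarrow>
          (\<forall>u \<in> Linf_L2w k p R T \<inter> L2_H1_0L k R T.
             V2_embedding_ineq k p R T (3 / 2) (C * R powr ((p + 4 - 1) / 3)) u)) \<and>
       (\<forall>(k::2) R T. R > 0 \<and> T > 0 \<longrightarrow>
          (\<forall>u \<in> Linf_L2w k p R T \<inter> L2_H1_0L k R T.
             V2_embedding_ineq k p R T (3 / 2) (C * R powr ((p + 4 - 2) / 3)) u))"
    using V2_embedding_dim_le_2[OF assms, where 'n=1] V2_embedding_dim_le_2[OF assms, where 'n=2]
    by (intro exI[of _ "24 powr (2 / 3)"]) auto
qed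

end
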